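(* Let $X$ be a closed oriented surface of genus $\geq 2$, let $\star\in X$, and let $\Gamma=\mathrm{Mod}(X')$, where $X'=X\setminus\{\star\}$. Then there exist subgroups $H\leq G\leq\Gamma$ such that $[G:H]=\infty$ and $[\rho(G):\rho(H)]<\infty$ for every homological representation $\rho$ of $\Gamma$.
   Context: $\Gamma=\mathrm{Mod}(X')$ is the group of orientation-preserving diffeomorphisms $X\to X$ fixing the point $\star$, modulo isotopies fixing $\star$. It acts on $\pi=\pi_1(X,\star)$, giving a natural map $\Gamma\to\mathrm{Aut}(\pi)$. Homological representations: let $f:Y\to X$ be a finite characteristic cover, i.e. the cover corresponding to a finite-index characteristic subgroup $K\leq\pi$. Since $K$ is characteristic, restriction gives a homomorphism $\Gamma\to\mathrm{Aut}(\pi)\to\mathrm{Aut}(K)$, which induces $\rho=\rho_f:\Gamma\to\mathrm{Aut}(H_1(K,\mathbb{Z}))\cong\mathrm{GL}(H_1(Y,\mathbb{Z}))$. The homological representations of $\Gamma$ are the representations $\rho_f$ arising in this way. The subgroups $H$ and $G$ in the claim do not depend on $\rho$. *)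

theory Defs
  imports
    "HOL-Analysis.Analysis"
    "HOL-Algebra.Coset"
    "HOL-Algebra.Bij"
    "HOL-Algebra.Generated_Groups"
begin

subsection \<open>Smooth functions on open sets\<close>

primrec Ck_on :: "nat \<Rightarrow> ('a::real_normed_vector \<Rightarrow> 'b::real_normed_vector) \<Rightarrow> 'a set \<Rightarrow> bool" where
  "Ck_on 0 f S \<longleftrightarrow> continuous_on S f"
| "Ck_on (Suc k) f S \<longleftrightarrow>
     (\<forall>x\<in>S. f differentiable (at x)) \<and>
     (\<forall>v. Ck_on k (\<lambda>x. frechet_derivative f (at x) v) S)"

text \<open>Only meaningful for open sets, and only used for such.\<close>

definition smooth_on :: "'a::real_normed_vector set \<Rightarrow> ('a \<Rightarrow> 'b::real_normed_vector) \<Rightarrow> bool" where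
  "smooth_on S f \<longleftrightarrow> (\<forall>k. Ck_on k f S)"

definition jacobian :: "(real^2 \<Rightarrow> real^2) \<Rightarrow> real^2 \<Rightarrow> real" where
  "jacobian f u = det (matrix (frechet_derivative f (at u)))"


subsection \<open>Closed oriented smooth surfaces\<close>

text \<open>A chart is a pair of its domain, a subset of the surface, and the coordinate map; the values
  of the latter outside the domain are irrelevant. An orientation is given by
  the choice of an atlas whose coordinate changes have positive Jacobian. Neither the smooth
  structure nor the orientation depends on the atlas being maximal.\<close>

type_synonym 'a chart = "'a set \<times> ('a \<Rightarrow> real^2)"

definition surface_chart :: "'a::topological_space set \<Rightarrow> 'a chart \<Rightarrow> bool" where
  "surface_chart X = (\<lambda>(U, \<phi>).
     openin (top_of_set X) U \<and> open (\<phi> ` U) \<and> homeomorphism U (\<phi> ` U) \<phi> (inv_into U \<phi>))"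

definition oriented_smooth_atlas :: "'a::topological_space set \<Rightarrow> 'a chart set \<Rightarrow> bool" where
  "oriented_smooth_atlas X A \<longleftrightarrow>
     (\<forall>c\<in>A. surface_chart X c) \<and>
     \<Union> (fst ` A) = X \<and>
     (\<forall>(U, \<phi>)\<in>A. \<forall>(V, \<psi>)\<in>A.
        smooth_on (\<phi> ` (U \<inter> V)) (\<psi> \<circ> inv_into U \<phi>) \<and>
        (\<forall>u\<in>\<phi> ` (U \<inter> V). jacobian (\<psi> \<circ> inv_into U \<phi>) u > 0))"

text \<open>The Hausdorff axiom is imposed by the type class; second countability follows from
  compactness.\<close>

definition closed_oriented_surface :: "'a::t2_space set \<Rightarrow> 'a chart set \<Rightarrow> bool" where
  "closed_oriented_surface X A \<longleftrightarrow>
     compact X \<and> connected X \<and> X \<noteq> {} \<and> oriented_smooth_atlas X A"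


subsection \<open>Genus\<close>

text \<open>For \<open>g \<ge> 1\<close> the standard surface of genus \<open>g\<close> is the quotient of a \<open>4g\<close>-gon, here the closed
  unit disc with boundary circle divided into \<open>4g\<close> arcs of equal length, by the side identifications
  with boundary word \<open>a\<^sub>1 b\<^sub>1 a\<^sub>1\<^sup>-\<^sup>1 b\<^sub>1\<^sup>-\<^sup>1 \<dots> a\<^sub>g b\<^sub>g a\<^sub>g\<^sup>-\<^sup>1 b\<^sub>g\<^sup>-\<^sup>1\<close>. The \<open>j\<close>-th arc is the image of
  \<open>[j, j + 1]\<close> under \<open>polygon_boundary g\<close>. The map \<open>q\<close> in \<open>has_genus\<close> exhibits \<open>X\<close> as
  homeomorphic to the quotient space.\<close>

definition polygon_boundary :: "nat \<Rightarrow> real \<Rightarrow> complex" where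
  "polygon_boundary g t = cis (2 * pi * t / (4 * real g))"

inductive side_pairing :: "nat \<Rightarrow> complex \<Rightarrow> complex \<Rightarrow> bool" for g where
  side_a: "i < g \<Longrightarrow> s \<in> {0..1} \<Longrightarrow>
    side_pairing g (polygon_boundary g (4 * real i + s)) (polygon_boundary g (4 * real i + 3 - s))"
| side_b: "i < g \<Longrightarrow> s \<in> {0..1} \<Longrightarrow>
    side_pairing g (polygon_boundary g (4 * real i + 1 + s)) (polygon_boundary g (4 * real i + 4 - s))"

definition has_genus :: "'a::topological_space set \<Rightarrow> nat \<Rightarrow> bool" where
  "has_genus X g \<longleftrightarrow>
     (if g = 0 then X homeomorphic sphere (0::real^3) 1
      else \<exists>q. quotient_map (top_of_set (cball 0 1)) (top_of_set X) q \<and>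
             (\<forall>x\<in>cball 0 1. \<forall>y\<in>cball 0 1. q x = q y \<longleftrightarrow> equivclp (side_pairing g) x y))"


subsection \<open>The mapping class group of a surface with a marked point\<close>

definition smooth_map :: "'a::topological_space set \<Rightarrow> 'a chart set \<Rightarrow> ('a \<Rightarrow> 'a) \<Rightarrow> bool" where
  "smooth_map X A f \<longleftrightarrow>
     f ` X \<subseteq> X \<and> continuous_on X f \<and>
     (\<forall>(U, \<phi>)\<in>A. \<forall>(V, \<psi>)\<in>A.
        smooth_on {u \<in> \<phi> ` U. f (inv_into U \<phi> u) \<in> V} (\<psi> \<circ> f \<circ> inv_into U \<phi>))"

definition diffeo :: "'a::topological_space set \<Rightarrow> 'a chart set \<Rightarrow> ('a \<Rightarrow> 'a) \<Rightarrow> bool" where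
  "diffeo X A f \<longleftrightarrow> bij_betw f X X \<and> smooth_map X A f \<and> smooth_map X A (inv_into X f)"

definition orientation_preserving :: "'a::topological_space set \<Rightarrow> 'a chart set \<Rightarrow> ('a \<Rightarrow> 'a) \<Rightarrow> bool" where
  "orientation_preserving X A f \<longleftrightarrow>
     (\<forall>(U, \<phi>)\<in>A. \<forall>(V, \<psi>)\<in>A. \<forall>u\<in>\<phi> ` U. f (inv_into U \<phi> u) \<in> V \<longrightarrow>
        jacobian (\<psi> \<circ> f \<circ> inv_into U \<phi>) u > 0)"

definition Diff_marked :: "'a::topological_space set \<Rightarrow> 'a chart set \<Rightarrow> 'a \<Rightarrow> ('a \<Rightarrow> 'a) set" where
  "Diff_marked X A star =
     {f \<in> extensional X. diffeo X A f \<and> orientation_preserving X A f \<and> f star = star}"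

definition Diff_group :: "'a::topological_space set \<Rightarrow> 'a chart set \<Rightarrow> 'a \<Rightarrow> ('a \<Rightarrow> 'a) monoid" where
  "Diff_group X A star = BijGroup X \<lparr>carrier := Diff_marked X A star\<rparr>"

text \<open>Smoothness of an isotopy on \<open>[0,1] \<times> X\<close>, a manifold with boundary, means that it is the
  restriction of a map that is smooth on \<open>J \<times> X\<close> for an open set \<open>J \<supseteq> [0,1]\<close> of times.\<close>

definition smooth_isotopy ::
    "'a::topological_space set \<Rightarrow> 'a chart set \<Rightarrow> 'a \<Rightarrow> real set \<Rightarrow> (real \<times> 'a \<Rightarrow> 'a) \<Rightarrow> bool" where
  "smooth_isotopy X A star J F \<longleftrightarrow>
     open J \<and> {0..1} \<subseteq> J \<and> F ` (J \<times> X) \<subseteq> X \<and> continuous_on (J \<times> X) F \<and>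
     (\<forall>(U, \<phi>)\<in>A. \<forall>(V, \<psi>)\<in>A.
        smooth_on {(t, u). t \<in> J \<and> u \<in> \<phi> ` U \<and> F (t, inv_into U \<phi> u) \<in> V}
          (\<lambda>(t, u). \<psi> (F (t, inv_into U \<phi> u)))) \<and>
     (\<forall>t\<in>{0..1}. (\<lambda>x\<in>X. F (t, x)) \<in> Diff_marked X A star)"

definition isotopic ::
    "'a::topological_space set \<Rightarrow> 'a chart set \<Rightarrow> 'a \<Rightarrow> ('a \<Rightarrow> 'a) \<Rightarrow> ('a \<Rightarrow> 'a) \<Rightarrow> bool" where
  "isotopic X A star f h \<longleftrightarrow>
     (\<exists>J F. smooth_isotopy X A star J F \<and> (\<forall>x\<in>X. F (0, x) = f x \<and> F (1, x) = h x))"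

text \<open>Composing an isotopy with a fixed diffeomorphism shows that \<open>f\<close> and \<open>h\<close> are isotopic if
  and only if \<open>f \<circ> h\<^sup>-\<^sup>1\<close> is isotopic to the identity. The isotopy classes are therefore the cosets
  of the following normal subgroup.\<close>

definition Diff_isotopic_id :: "'a::topological_space set \<Rightarrow> 'a chart set \<Rightarrow> 'a \<Rightarrow> ('a \<Rightarrow> 'a) set" where
  "Diff_isotopic_id X A star = {f \<in> Diff_marked X A star. isotopic X A star (\<lambda>x\<in>X. x) f}"

definition mapping_class_group ::
    "'a::topological_space set \<Rightarrow> 'a chart set \<Rightarrow> 'a \<Rightarrow> ('a \<Rightarrow> 'a) set monoid" where
  "mapping_class_group X A star = Diff_group X A star Mod Diff_isotopic_id X A star"


subsection \<open>The fundamental group and the action of the mapping class group\<close>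

definition loops :: "'a::topological_space set \<Rightarrow> 'a \<Rightarrow> (real \<Rightarrow> 'a) set" where
  "loops X star = {p. path p \<and> path_image p \<subseteq> X \<and> pathstart p = star \<and> pathfinish p = star}"

definition loop_class :: "'a::topological_space set \<Rightarrow> (real \<Rightarrow> 'a) \<Rightarrow> (real \<Rightarrow> 'a) set" where
  "loop_class X p = {q. homotopic_paths X p q}"

definition fundamental_group :: "'a::topological_space set \<Rightarrow> 'a \<Rightarrow> (real \<Rightarrow> 'a) set monoid" where
  "fundamental_group X star =
     \<lparr>carrier = loop_class X ` loops X star,
      mult = (\<lambda>P Q. \<Union>p\<in>P. \<Union>q\<in>Q. loop_class X (p +++ q)),
      one = loop_class X (\<lambda>_. star)\<rparr>"

definition pushforward ::
    "'a::topological_space set \<Rightarrow> 'a \<Rightarrow> ('a \<Rightarrow> 'a) \<Rightarrow> (real \<Rightarrow> 'a) set \<Rightarrow> (real \<Rightarrow> 'a) set" where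
  "pushforward X star f =
     (\<lambda>P \<in> carrier (fundamental_group X star). \<Union>p\<in>P. loop_class X (f \<circ> p))"

text \<open>All members of a mapping class have the same \<open>pushforward\<close>.\<close>

definition mapping_class_action ::
    "'a::topological_space set \<Rightarrow> 'a \<Rightarrow> ('a \<Rightarrow> 'a) set \<Rightarrow> (real \<Rightarrow> 'a) set \<Rightarrow> (real \<Rightarrow> 'a) set" where
  "mapping_class_action X star c = the_elem (pushforward X star ` c)"


subsection \<open>Homological representations\<close>

definition finite_index :: "'g set \<Rightarrow> ('g, 'b) monoid_scheme \<Rightarrow> bool" where
  "finite_index H G \<longleftrightarrow> finite (rcosets\<^bsub>G\<^esub> H)"

definition characteristic_subgroup :: "'g set \<Rightarrow> ('g, 'b) monoid_scheme \<Rightarrow> bool" where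
  "characteristic_subgroup K G \<longleftrightarrow> subgroup K G \<and> (\<forall>\<alpha>\<in>auto G. \<alpha> ` K = K)"

text \<open>The first integral homology group of a group is its abelianization.\<close>

definition H1 :: "('g, 'b) monoid_scheme \<Rightarrow> 'g set monoid" where
  "H1 G = G Mod derived G (carrier G)"

definition H1_map :: "('g, 'b) monoid_scheme \<Rightarrow> ('g \<Rightarrow> 'g) \<Rightarrow> 'g set \<Rightarrow> 'g set" where
  "H1_map G \<alpha> = (\<lambda>D \<in> carrier (H1 G). \<alpha> ` D)"

text \<open>A finite characteristic cover \<open>Y \<rightarrow> X\<close> is specified by the corresponding subgroup \<open>K\<close> of the
  fundamental group. Automorphisms of the abelian group \<open>H1 K\<close> are the same as invertible
  integer-linear maps, so \<open>AutoGroup\<close> of it plays the role of \<open>GL(H\<^sub>1(Y))\<close>.\<close>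

definition cover_group ::
    "'a::topological_space set \<Rightarrow> 'a \<Rightarrow> (real \<Rightarrow> 'a) set set \<Rightarrow> (real \<Rightarrow> 'a) set monoid" where
  "cover_group X star K = fundamental_group X star \<lparr>carrier := K\<rparr>"

definition homological_rep ::
    "'a::topological_space set \<Rightarrow> 'a \<Rightarrow> (real \<Rightarrow> 'a) set set \<Rightarrow>
     ('a \<Rightarrow> 'a) set \<Rightarrow> (real \<Rightarrow> 'a) set set \<Rightarrow> (real \<Rightarrow> 'a) set set" where
  "homological_rep X star K c =
     H1_map (cover_group X star K) (restrict (mapping_class_action X star c) K)"

end

theory Submission
  imports Defs
begin

text \<open>Take \<open>H\<close> trivial and let \<open>G\<close> consist of the mapping classes that act on \<open>\<pi> = \<pi>\<^sub>1(X)\<close> by inner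
  automorphisms. Conjugation by an element of \<open>K\<close> is trivial on \<open>H\<^sub>1(K)\<close>, so the action of \<open>G\<close> on
  \<open>H\<^sub>1(K)\<close> factors through the finite set \<open>\<pi>/K\<close>. It remains to see that \<open>G\<close> is infinite. Every inner
  automorphism is realised by pushing the marked point around a loop, and a point is pushed along a
  short path by rotating a disc in a chart by a smoothly cut off angle, a diffeomorphism with an
  explicit inverse. Finally \<open>\<pi>\<close> has an infinite conjugacy class: folding the polygon maps \<open>X\<close> to a
  figure eight in \<open>\<complex> - {1, -1}\<close>, and the monodromy of the covering \<open>cos\<close> maps \<open>\<pi>\<close> onto an infinite
  dihedral group, where a reflection has infinitely many conjugates.\<close>

section \<open>Smooth functions\<close>

text \<open>A homological representation sees a mapping class only through its action on \<pi>, so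
  \<open>G\<close> is cut out by that action, and infinitely many elements of \<open>G\<close> are
  told apart by evaluating the action at a single element of \<pi> with infinitely many conjugates.
  Two obstacles shape the proof. A push must end in a diffeomorphism although the loop is only
  continuous: the loop is cut into pieces lying in charts, and each piece is replaced by a half
  circle, the track of one end under a half turn about the midpoint of both ends. Intermediate times
  matter only up to homotopy. Secondly, conjugates must be distinguished in a group given by gluing
  a polygon. The fold sends the generators a_1 and a_2 to the two loops of a figure eight and the
  remaining ones to constants. The figure eight is drawn in the plane without 1 and -1 because its
  lifts through \<open>cos\<close> can be written down: they are the images of one arc under the
  deck transformations z -> z + 2 pi n and z -> -z + 2 pi n. Existence and uniqueness of lifts come
  from square roots and logarithms of nowhere vanishing functions.\<close>

lemma Ck_on_subset: "Ck_on k f S \<Longrightarrow> T \<subseteq> S \<Longrightarrow> Ck_on k f T"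
  by (induction k arbitrary: f) (auto intro: continuous_on_subset)

lemma Ck_on_cong:
  assumes "open S" "\<And>x. x \<in> S \<Longrightarrow> f x = g x" "Ck_on k f S"
  shows "Ck_on k g S"
  using assms(2,3)
proof (induction k arbitrary: f g)
  case 0
  then show ?case by (metis Ck_on.simps(1) continuous_on_cong)
next
  case (Suc k)
  have d: "f differentiable (at x)" if "x \<in> S" for x
    using Suc.prems that by simp
  have "g differentiable (at x)" if "x \<in> S" for x
    using d[OF that] has_derivative_transform_within_open[OF _ \<open>open S\<close> that] Suc.prems(1)
    unfolding differentiable_def by blast
  moreover have "frechet_derivative f (at x) = frechet_derivative g (at x)" if "x \<in> S" for x
    using frechet_derivative_transform_within_open[OF d[OF that] \<open>open S\<close> that] Suc.prems(1) by blast
  then have "Ck_on k (\<lambda>x. frechet_derivative g (at x) v) S" for v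
    using Suc.IH[of "\<lambda>x. frechet_derivative f (at x) v"] Suc.prems by simp
  ultimately show ?case by simp
qed

lemma Ck_on_local:
  assumes "\<And>x. x \<in> S \<Longrightarrow> \<exists>T. open T \<and> x \<in> T \<and> Ck_on k f T"
  shows "Ck_on k f S"
  using assms
proof (induction k arbitrary: f)
  case 0
  then show ?case
    by (metis Ck_on.simps(1) continuous_at_imp_continuous_on continuous_on_eq_continuous_at)
next
  case (Suc k)
  then show ?case by (metis Ck_on.simps(2))
qed

lemma Ck_on_SucD: "Ck_on (Suc k) f S \<Longrightarrow> Ck_on k f S"
proof (induction k arbitrary: f)
  case 0
  then show ?case
    by (auto intro!: continuous_at_imp_continuous_on differentiable_imp_continuous_within)
next
  case (Suc k)
  then show ?case by (metis Ck_on.simps(2))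
qed

text \<open>\<open>Ck_on\<close> speaks of the chosen \<open>frechet_derivative\<close>; on an open
  set any explicitly known derivative may take its place, by uniqueness.\<close>

lemma Ck_on_SucI:
  assumes "open S" "\<And>x. x \<in> S \<Longrightarrow> (f has_derivative f' x) (at x)"
    and "\<And>v. Ck_on k (\<lambda>x. f' x v) S"
  shows "Ck_on (Suc k) f S"
proof -
  have "frechet_derivative f (at x) = f' x" if "x \<in> S" for x
    using frechet_derivative_at[OF assms(2)[OF that]] by simp
  then have "Ck_on k (\<lambda>x. frechet_derivative f (at x) v) S" for v
    by (intro Ck_on_cong[OF assms(1) _ assms(3)[of v]]) simp
  then show ?thesis
    using assms(2) by (auto simp: differentiable_def)
qed

lemma Ck_on_has_derivative:
  assumes "Ck_on (Suc k) f S" "x \<in> S"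
  shows "(f has_derivative frechet_derivative f (at x)) (at x)"
  using assms frechet_derivative_works by auto

lemma Ck_on_const: "open S \<Longrightarrow> Ck_on k (\<lambda>x. c) S"
proof (induction k arbitrary: c)
  case (Suc k)
  show ?case by (rule Ck_on_SucI[OF Suc.prems, where f' = "\<lambda>x v. 0"]) (use Suc in auto)
qed simp

lemma Ck_on_linear:
  assumes "open S" "bounded_linear f" shows "Ck_on k f S"
proof (cases k)
  case 0
  then show ?thesis using assms by (simp add: linear_continuous_on)
next
  case (Suc n)
  show ?thesis unfolding Suc
    by (rule Ck_on_SucI[OF assms(1), where f' = "\<lambda>x. f"])
       (use assms in \<open>auto intro: bounded_linear_imp_has_derivative Ck_on_const\<close>)
qed

lemma Ck_on_add:
  assumes "open S" "Ck_on k f S" "Ck_on k g S" shows "Ck_on k (\<lambda>x. f x + g x) S"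
  using assms(2,3)
proof (induction k arbitrary: f g)
  case (Suc k)
  show ?case
    by (rule Ck_on_SucI[OF \<open>open S\<close>, where f' = "\<lambda>x v. frechet_derivative f (at x) v + frechet_derivative g (at x) v"])
       (use Suc in \<open>auto intro!: has_derivative_add Ck_on_has_derivative[where k=k]\<close>)
qed (auto intro: continuous_intros)

lemma Ck_on_sum:
  assumes "open S" "finite I" "\<And>i. i \<in> I \<Longrightarrow> Ck_on k (f i) S"
  shows "Ck_on k (\<lambda>x. \<Sum>i\<in>I. f i x) S"
  using assms(2,3) by (induction I) (auto intro: Ck_on_const Ck_on_add assms(1))

text \<open>Leibniz rule: the derivative is a sum of two products of the same kind. One induction
  thus serves scalar multiples, inner products and real products.\<close>

lemma Ck_on_bilinear:
  assumes "open S" "bounded_bilinear pr" "Ck_on k f S" "Ck_on k g S"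
  shows "Ck_on k (\<lambda>x. pr (f x) (g x)) S"
  using assms(3,4)
proof (induction k arbitrary: f g)
  case 0
  then show ?case using bounded_bilinear.continuous_on[OF assms(2)] by simp
next
  case (Suc k)
  show ?case
    by (rule Ck_on_SucI[OF \<open>open S\<close> bounded_bilinear.FDERIV[OF assms(2)]])
       (use Suc in \<open>auto intro!: Ck_on_add assms(1) Suc.IH intro: Ck_on_has_derivative[where k=k] Ck_on_SucD simp del: Ck_on.simps\<close>, auto)
qed

text \<open>In the chain rule the derivative of \<open>f\<close> is taken in a direction that varies
  with the point, which the induction hypothesis does not cover. Expanding this direction in the
  basis leaves derivatives of \<open>f\<close> in fixed directions, composed with \<open>g\<close>,
  times coefficients of class C^k.\<close>

lemma Ck_on_compose:
  fixes g :: "'a::real_normed_vector \<Rightarrow> 'b::euclidean_space"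
    and f :: "'b \<Rightarrow> 'c::real_normed_vector"
  assumes "open S" "open T" "Ck_on k f T" "Ck_on k g S" "g ` S \<subseteq> T"
  shows "Ck_on k (\<lambda>x. f (g x)) S"
  using assms(3,4)
proof (induction k arbitrary: f)
  case 0
  then show ?case using assms(5) by (auto intro: continuous_on_compose2)
next
  case (Suc k)
  let ?Df = "\<lambda>y. frechet_derivative f (at y)" and ?Dg = "\<lambda>x. frechet_derivative g (at x)"
  have Dg: "(g has_derivative ?Dg x) (at x)" if "x \<in> S" for x
    using Ck_on_has_derivative[OF Suc.prems(2) that] .
  have Df: "(f has_derivative ?Df (g x)) (at (g x))" if "x \<in> S" for x
    using Ck_on_has_derivative[OF Suc.prems(1)] that assms(5) by blast
  have ex: "?Df (g x) w = (\<Sum>b\<in>Basis. (w \<bullet> b) *\<^sub>R ?Df (g x) b)" if "x \<in> S" for x w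
  proof -
    have "linear (?Df (g x))"
      using Df[OF that] has_derivative_linear by blast
    then have "?Df (g x) (\<Sum>b\<in>Basis. (w \<bullet> b) *\<^sub>R b) = (\<Sum>b\<in>Basis. (w \<bullet> b) *\<^sub>R ?Df (g x) b)"
      by (simp add: linear_sum linear_scale)
    then show ?thesis by (simp add: euclidean_representation)
  qed
  show ?case
  proof (rule Ck_on_SucI[OF \<open>open S\<close>])
    show "((\<lambda>x. f (g x)) has_derivative
             (\<lambda>v. \<Sum>b\<in>Basis. (?Dg x v \<bullet> b) *\<^sub>R ?Df (g x) b)) (at x)" if "x \<in> S" for x
      using has_derivative_compose[OF Dg[OF that] Df[OF that]]
      unfolding ex[OF that, symmetric] .
    show "Ck_on k (\<lambda>x. \<Sum>b\<in>Basis. (?Dg x v \<bullet> b) *\<^sub>R ?Df (g x) b) S" for v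
    proof (intro Ck_on_sum assms(1) finite_Basis Ck_on_bilinear[OF _ bounded_bilinear_scaleR])
      fix b :: 'b
      show "Ck_on k (\<lambda>x. ?Dg x v \<bullet> b) S"
        by (intro Ck_on_bilinear[OF _ bounded_bilinear_inner] assms(1) Ck_on_const)
           (use Suc.prems in auto)
      show "Ck_on k (\<lambda>x. ?Df (g x) b) S"
        by (rule Suc.IH) (use Suc.prems Ck_on_SucD in auto)
    qed
  qed
qed

section \<open>Infinitely differentiable maps on open sets\<close>

lemma smooth_on_subset: "smooth_on S f \<Longrightarrow> T \<subseteq> S \<Longrightarrow> smooth_on T f"
  by (auto simp: smooth_on_def intro: Ck_on_subset)

lemma smooth_on_cong: "smooth_on S f \<Longrightarrow> open S \<Longrightarrow> (\<And>x. x \<in> S \<Longrightarrow> f x = g x) \<Longrightarrow> smooth_on S g"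
  by (auto simp: smooth_on_def intro: Ck_on_cong)

lemma smooth_on_local:
  "(\<And>x. x \<in> S \<Longrightarrow> \<exists>T. open T \<and> x \<in> T \<and> smooth_on T f) \<Longrightarrow> smooth_on S f"
  unfolding smooth_on_def by (meson Ck_on_local)

lemma smooth_on_imp_continuous_on: "smooth_on S f \<Longrightarrow> continuous_on S f"
  unfolding smooth_on_def by (metis Ck_on.simps(1))

lemma smooth_on_imp_differentiable: "smooth_on S f \<Longrightarrow> x \<in> S \<Longrightarrow> f differentiable (at x)"
  unfolding smooth_on_def by (metis Ck_on.simps(2))

lemma smooth_on_const: "open S \<Longrightarrow> smooth_on S (\<lambda>x. c)"
  by (simp add: smooth_on_def Ck_on_const)

lemma smooth_on_linear: "open S \<Longrightarrow> bounded_linear f \<Longrightarrow> smooth_on S f"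
  by (simp add: smooth_on_def Ck_on_linear)

lemma smooth_on_id: "open S \<Longrightarrow> smooth_on S (\<lambda>x. x)"
  by (simp add: smooth_on_linear)

lemma smooth_on_add: "open S \<Longrightarrow> smooth_on S f \<Longrightarrow> smooth_on S g \<Longrightarrow> smooth_on S (\<lambda>x. f x + g x)"
  by (simp add: smooth_on_def Ck_on_add)

lemma smooth_on_scaleR:
  "open S \<Longrightarrow> smooth_on S f \<Longrightarrow> smooth_on S g \<Longrightarrow> smooth_on S (\<lambda>x. f x *\<^sub>R g x)"
  by (simp add: smooth_on_def Ck_on_bilinear[OF _ bounded_bilinear_scaleR])

lemma smooth_on_inner:
  "open S \<Longrightarrow> smooth_on S f \<Longrightarrow> smooth_on S g \<Longrightarrow> smooth_on S (\<lambda>x. f x \<bullet> g x)"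
  by (simp add: smooth_on_def Ck_on_bilinear[OF _ bounded_bilinear_inner])

lemma smooth_on_compose:
  fixes g :: "'a::real_normed_vector \<Rightarrow> 'b::euclidean_space"
  assumes "open S" "open T" "smooth_on T f" "smooth_on S g" "g ` S \<subseteq> T"
  shows "smooth_on S (\<lambda>x. f (g x))"
  using assms Ck_on_compose unfolding smooth_on_def by metis

lemma smooth_on_linear_compose:
  fixes g :: "'a::real_normed_vector \<Rightarrow> 'b::euclidean_space"
  assumes "open S" "bounded_linear f" "smooth_on S g"
  shows "smooth_on S (\<lambda>x. f (g x))"
  by (rule smooth_on_compose[OF assms(1) open_UNIV smooth_on_linear[OF open_UNIV assms(2)] assms(3)]) simp

lemma smooth_on_Pair:
  fixes f :: "'a::real_normed_vector \<Rightarrow> 'b::euclidean_space" and g :: "'a \<Rightarrow> 'c::euclidean_space"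
  assumes "open S" "smooth_on S f" "smooth_on S g"
  shows "smooth_on S (\<lambda>x. (f x, g x))"
proof -
  have "smooth_on S (\<lambda>x. (f x, 0) + (0, g x))"
    by (intro smooth_on_add assms smooth_on_linear_compose[OF _ _ assms(2), where f = "\<lambda>y. (y, 0)"]
        smooth_on_linear_compose[OF _ _ assms(3), where f = "\<lambda>y. (0, y)"])
      (auto intro!: bounded_linear_intros)
  then show ?thesis by simp
qed

section \<open>Smooth functions of one real variable\<close>

lemma Ck_on_Suc_real:
  fixes f :: "real \<Rightarrow> real"
  assumes "open S" "\<And>x. x \<in> S \<Longrightarrow> (f has_real_derivative f' x) (at x)" "Ck_on k f' S"
  shows "Ck_on (Suc k) f S"
  by (rule Ck_on_SucI[OF assms(1), where f' = "\<lambda>x v. f' x * v"])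
     (use assms(2) in \<open>auto simp: has_field_derivative_def intro!: Ck_on_bilinear[OF assms(1) bounded_bilinear_mult assms(3)] Ck_on_const assms(1)\<close>)

lemma smooth_on_cos_sin: "smooth_on UNIV (cos :: real \<Rightarrow> real)" "smooth_on UNIV (sin :: real \<Rightarrow> real)"
proof -
  have "Ck_on k (cos :: real \<Rightarrow> real) UNIV \<and> Ck_on k (sin :: real \<Rightarrow> real) UNIV" for k
  proof (induction k)
    case (Suc k)
    have "Ck_on k (\<lambda>x::real. (-1) *\<^sub>R sin x) UNIV"
      by (intro Ck_on_bilinear[OF _ bounded_bilinear_scaleR] Ck_on_const) (use Suc in auto)
    then have "Ck_on (Suc k) (cos :: real \<Rightarrow> real) UNIV"
      by (intro Ck_on_Suc_real[where f' = "\<lambda>x. - sin x"]) (auto intro!: derivative_eq_intros)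
    moreover have "Ck_on (Suc k) (sin :: real \<Rightarrow> real) UNIV"
      by (intro Ck_on_Suc_real[where f' = cos]) (use Suc in \<open>auto intro!: derivative_eq_intros\<close>)
    ultimately show ?case by blast
  qed (auto intro: continuous_intros)
  then show "smooth_on UNIV (cos :: real \<Rightarrow> real)" "smooth_on UNIV (sin :: real \<Rightarrow> real)"
    by (auto simp: smooth_on_def)
qed

text \<open>For \<open>n = 0\<close> this is the classical smooth function exp(-1/x) extended by
  zero. The powers of 1/x are carried along because differentiation produces them: the span of the
  family is closed under derivatives.\<close>

definition flat :: "nat \<Rightarrow> real \<Rightarrow> real" where
  "flat n x = (if x > 0 then exp (- inverse x) * inverse x ^ n else 0)"

lemma flat_tendsto_0: "(flat n \<longlongrightarrow> 0) (at 0)"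
proof -
  have "((\<lambda>x::real. inverse x ^ n / exp (inverse x)) \<longlongrightarrow> 0) (at_right 0)"
    by (rule filterlim_compose[OF tendsto_power_div_exp_0 filterlim_inverse_at_top_right])
  then have "(flat n \<longlongrightarrow> 0) (at_right 0)"
    by (rule Lim_transform_eventually)
       (auto simp: flat_def exp_minus eventually_at_filter divide_inverse)
  moreover have "(flat n \<longlongrightarrow> 0) (at_left 0)"
    by (rule Lim_transform_eventually[OF tendsto_const]) (auto simp: flat_def eventually_at_filter)
  ultimately show ?thesis by (simp add: filterlim_split_at)
qed

lemma flat_deriv:
  "(flat n has_real_derivative flat (n + 2) x - real n * flat (n + 1) x) (at x)"
proof -
  consider "x > 0" | "x < 0" | "x = 0" by linarith
  then show ?thesis
  proof cases
    case 1
    define y where "y = inverse x"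
    have "((\<lambda>x. exp (- inverse x) * inverse x ^ n) has_real_derivative
        exp (- y) * y\<^sup>2 * y ^ n - exp (- y) * (real n * y ^ (n - 1) * y) * y) (at x)"
      using 1 by (auto intro!: derivative_eq_intros simp: y_def algebra_simps power2_eq_square)
    \<comment> \<open>For \<open>n = 0\<close> the exponent \<open>n - 1\<close> is truncated to 0,
      but the factor \<open>real n\<close> vanishes.\<close>
    moreover have "real n * y ^ (n - 1) * y = real n * y ^ n"
      by (cases n) auto
    moreover have "exp (- y) * y\<^sup>2 * y ^ n - exp (- y) * (real n * y ^ n) * y
        = flat (n + 2) x - real n * flat (n + 1) x"
      using 1 by (simp add: flat_def y_def power2_eq_square algebra_simps)
    ultimately have "((\<lambda>x. exp (- inverse x) * inverse x ^ n) has_real_derivative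
        flat (n + 2) x - real n * flat (n + 1) x) (at x)"
      by (simp only:)
    then show ?thesis
      by (rule has_field_derivative_transform_within_open[where S = "{0<..}"]) (use 1 in \<open>auto simp: flat_def\<close>)
  next
    case 2
    have "((\<lambda>x. 0) has_real_derivative flat (n + 2) x - real n * flat (n + 1) x) (at x)"
      using 2 by (auto simp: flat_def)
    then show ?thesis
      by (rule has_field_derivative_transform_within_open[where S = "{..<0}"]) (use 2 in \<open>auto simp: flat_def\<close>)
  next
    case 3
    \<comment> \<open>The difference quotient of \<open>flat n\<close> at 0 is
      \<open>flat (n + 1)\<close>.\<close>
    have "((\<lambda>y. (flat n y - flat n 0) / (y - 0)) \<longlongrightarrow> 0) (at 0)"
      by (rule Lim_transform_eventually[OF flat_tendsto_0[of "n + 1"]])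
         (auto simp: flat_def eventually_at_filter field_simps)
    then show ?thesis
      by (simp add: 3 has_field_derivative_iff flat_def)
  qed
qed

lemma smooth_on_flat: "smooth_on UNIV (flat n)"
proof -
  have "Ck_on k (flat n) UNIV" for k n
  proof (induction k arbitrary: n)
    case 0
    show ?case using DERIV_isCont[OF flat_deriv] by (simp add: continuous_at_imp_continuous_on)
  next
    case (Suc k)
    have "Ck_on k (\<lambda>x. flat (n + 2) x + (- real n) *\<^sub>R flat (n + 1) x) UNIV"
      by (intro Ck_on_add Ck_on_bilinear[OF _ bounded_bilinear_scaleR] Ck_on_const Suc.IH) auto
    then show ?case
      by (intro Ck_on_Suc_real[OF _ flat_deriv]) auto
  qed
  then show ?thesis by (simp add: smooth_on_def)
qed

section \<open>The group of diffeomorphisms\<close>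

lemma jacobian_compose:
  assumes "g differentiable at u" "f differentiable at (g u)"
  shows "jacobian (\<lambda>x. f (g x)) u = jacobian f (g u) * jacobian g u"
proof -
  have "frechet_derivative (\<lambda>x. f (g x)) (at u)
      = frechet_derivative f (at (g u)) \<circ> frechet_derivative g (at u)"
    using frechet_derivative_compose[OF assms] by (simp add: o_def)
  moreover have "linear (frechet_derivative f (at (g u)))" "linear (frechet_derivative g (at u))"
    using assms linear_frechet_derivative by auto
  ultimately show ?thesis
    unfolding jacobian_def by (simp add: matrix_compose det_mul)
qed

lemma jacobian_cong:
  assumes "f differentiable at u" "open S" "u \<in> S" "\<And>x. x \<in> S \<Longrightarrow> f x = g x"
  shows "jacobian f u = jacobian g u"
  unfolding jacobian_def using frechet_derivative_transform_within_open[OF assms] by simp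

lemma jacobian_id: "jacobian (\<lambda>x. x) u = 1"
  by (simp add: jacobian_def frechet_derivative_ident[unfolded id_def] matrix_id_mat_1[unfolded id_def])

section \<open>Charts and plots of a surface\<close>

locale smooth_surface =
  fixes X :: "'a::t2_space set" and A :: "'a chart set"
  assumes atlas: "oriented_smooth_atlas X A"
begin

lemma chart_inverse:
  assumes "(U, \<phi>) \<in> A"
  shows "x \<in> U \<Longrightarrow> inv_into U \<phi> (\<phi> x) = x" "u \<in> \<phi> ` U \<Longrightarrow> \<phi> (inv_into U \<phi> u) = u"
    "u \<in> \<phi> ` U \<Longrightarrow> inv_into U \<phi> u \<in> U"
  using assms atlas
  by (auto simp: oriented_smooth_atlas_def surface_chart_def homeomorphism_def f_inv_into_f inv_into_into)

lemma chart_facts: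
  assumes "(U, \<phi>) \<in> A"
  shows "openin (top_of_set X) U" "U \<subseteq> X" "open (\<phi> ` U)" "continuous_on U \<phi>"
    "continuous_on (\<phi> ` U) (inv_into U \<phi>)"
proof -
  show "openin (top_of_set X) U" "open (\<phi> ` U)" "continuous_on U \<phi>"
    "continuous_on (\<phi> ` U) (inv_into U \<phi>)"
    using assms atlas by (auto simp: oriented_smooth_atlas_def surface_chart_def homeomorphism_def)
  then show "U \<subseteq> X" using openin_imp_subset by blast
qed

lemma chart_ex: "x \<in> X \<Longrightarrow> \<exists>U \<phi>. (U, \<phi>) \<in> A \<and> x \<in> U"
  using atlas by (force simp: oriented_smooth_atlas_def)

lemma transition:
  assumes "(U, \<phi>) \<in> A" "(V, \<psi>) \<in> A"
  shows "smooth_on (\<phi> ` (U \<inter> V)) (\<psi> \<circ> inv_into U \<phi>)"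
    "u \<in> \<phi> ` (U \<inter> V) \<Longrightarrow> jacobian (\<psi> \<circ> inv_into U \<phi>) u > 0"
  using assms atlas unfolding oriented_smooth_atlas_def by blast+

text \<open>Smooth maps from open sets of an arbitrary Euclidean space into the surface, called
  plots in diffeology. The domain is left variable so that inverse charts (dimension 2) and
  isotopies read in a chart (dimension 3) are both covered.\<close>

definition plot :: "'e::euclidean_space set \<Rightarrow> ('e \<Rightarrow> 'a) \<Rightarrow> bool" where
  "plot W m \<longleftrightarrow> open W \<and> m ` W \<subseteq> X \<and> continuous_on W m \<and>
     (\<forall>(V, \<psi>)\<in>A. smooth_on {w \<in> W. m w \<in> V} (\<psi> \<circ> m))"

lemma open_preimage:
  assumes "open W" "m ` W \<subseteq> X" "continuous_on W m" "openin (top_of_set X) V"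
  shows "open {w \<in> W. m w \<in> V}"
proof -
  have "openin (top_of_set W) (W \<inter> m -` V)"
    by (rule continuous_openin_preimage[OF assms(3) _ assms(4)]) (use assms(2) in auto)
  moreover have "W \<inter> m -` V = {w \<in> W. m w \<in> V}" by auto
  ultimately show ?thesis using assms(1) by (simp add: openin_open_eq)
qed

lemma plot_open_preimage: "plot W m \<Longrightarrow> openin (top_of_set X) V \<Longrightarrow> open {w \<in> W. m w \<in> V}"
  unfolding plot_def by (intro open_preimage) auto

lemma plot_smooth: "plot W m \<Longrightarrow> (V, \<psi>) \<in> A \<Longrightarrow> smooth_on {w \<in> W. m w \<in> V} (\<psi> \<circ> m)"
  unfolding plot_def by auto

lemma plot_chart:
  assumes "(U, \<phi>) \<in> A" shows "plot (\<phi> ` U) (inv_into U \<phi>)"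
proof -
  have "{u \<in> \<phi> ` U. inv_into U \<phi> u \<in> V} = \<phi> ` (U \<inter> V)" for V
    using chart_inverse[OF assms] by force
  then show ?thesis
    using chart_facts[OF assms] chart_inverse[OF assms] transition(1)[OF assms]
    unfolding plot_def by auto
qed

lemma plot_local:
  assumes "\<And>w. w \<in> W \<Longrightarrow> \<exists>T. w \<in> T \<and> T \<subseteq> W \<and> plot T m"
  shows "plot W m"
  unfolding plot_def
proof (intro conjI ballI)
  show "open W"
    using assms unfolding plot_def by (meson openI open_contains_ball subset_trans open_subopen)
  show "m ` W \<subseteq> X"
    using assms unfolding plot_def by blast
  show "continuous_on W m"
    using assms unfolding plot_def
    by (metis continuous_at_imp_continuous_on continuous_on_eq_continuous_at)
  show "case c of (V, \<psi>) \<Rightarrow> smooth_on {w \<in> W. m w \<in> V} (\<psi> \<circ> m)" if "c \<in> A" for c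
  proof -
    obtain V \<psi> where c: "c = (V, \<psi>)" by force
    have "smooth_on {w \<in> W. m w \<in> V} (\<psi> \<circ> m)"
    proof (rule smooth_on_local)
      fix w assume "w \<in> {w \<in> W. m w \<in> V}"
      then obtain T where "w \<in> T" "plot T m" "m w \<in> V" using assms by blast
      then show "\<exists>T. open T \<and> w \<in> T \<and> smooth_on T (\<psi> \<circ> m)"
        using plot_open_preimage[of T m V] plot_smooth[of T m V \<psi>] chart_facts(1) that c
        by (intro exI[of _ "{w \<in> T. m w \<in> V}"]) auto
    qed
    then show ?thesis using c by simp
  qed
qed

lemma plot_cong:
  assumes "plot W m" "\<And>w. w \<in> W \<Longrightarrow> m w = m' w"
  shows "plot W m'"
proof -
  have "smooth_on {w \<in> W. m' w \<in> V} (\<psi> \<circ> m')" if "(V, \<psi>) \<in> A" for V \<psi>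
  proof -
    have "{w \<in> W. m' w \<in> V} = {w \<in> W. m w \<in> V}" using assms(2) by auto
    then show ?thesis
      using plot_smooth[OF assms(1) that] plot_open_preimage[OF assms(1) chart_facts(1)[OF that]] assms(2)
      by (auto intro: smooth_on_cong)
  qed
  then show ?thesis
    using assms continuous_on_cong[of W W m m'] unfolding plot_def by auto
qed

lemma plot_compose_smooth:
  assumes "plot W m" "open W'" "smooth_on W' g" "g ` W' \<subseteq> W"
  shows "plot W' (\<lambda>w. m (g w))"
proof -
  have cont: "continuous_on W' (\<lambda>w. m (g w))"
    using assms(1,4) unfolding plot_def
    by (intro continuous_on_compose2[OF _ smooth_on_imp_continuous_on[OF assms(3)]]) auto
  have X: "(\<lambda>w. m (g w)) ` W' \<subseteq> X" using assms unfolding plot_def by blast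
  have "smooth_on {w \<in> W'. m (g w) \<in> V} (\<lambda>w. (\<psi> \<circ> m) (g w))" if "(V, \<psi>) \<in> A" for V \<psi>
  proof (rule smooth_on_compose[where T = "{w \<in> W. m w \<in> V}"])
    show "open {w \<in> W'. m (g w) \<in> V}"
      by (rule open_preimage[OF assms(2) X cont chart_facts(1)[OF that]])
    show "open {w \<in> W. m w \<in> V}"
      by (rule plot_open_preimage[OF assms(1) chart_facts(1)[OF that]])
  qed (use assms plot_smooth[OF assms(1) that] in \<open>auto simp: o_def intro: smooth_on_subset\<close>)
  then show ?thesis
    using cont X assms(2) unfolding plot_def by (auto simp: o_def)
qed

lemma plot_restrict: "plot W m \<Longrightarrow> open T \<Longrightarrow> T \<subseteq> W \<Longrightarrow> plot T m"
  using plot_compose_smooth[of W m T "\<lambda>w. w"] smooth_on_id by auto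

section \<open>Smooth families of self-maps\<close>

text \<open>The smoothness content of an isotopy, separated from the marked point and from the maps
  being diffeomorphisms. Composition at each time and reversal of time can then be treated once and
  for all.\<close>

definition smooth_family :: "real set \<Rightarrow> (real \<times> 'a \<Rightarrow> 'a) \<Rightarrow> bool" where
  "smooth_family J F \<longleftrightarrow> open J \<and> F ` (J \<times> X) \<subseteq> X \<and> continuous_on (J \<times> X) F \<and>
     (\<forall>(U, \<phi>)\<in>A. plot (J \<times> \<phi> ` U) (\<lambda>(t, u). F (t, inv_into U \<phi> u)))"

lemma smooth_isotopy_iff:
  "smooth_isotopy X A star J F \<longleftrightarrow>
     smooth_family J F \<and> {0..1} \<subseteq> J \<and> (\<forall>t\<in>{0..1}. (\<lambda>x\<in>X. F (t, x)) \<in> Diff_marked X A star)"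
proof -
  have "plot (J \<times> \<phi> ` U) (\<lambda>(t, u). F (t, inv_into U \<phi> u)) \<longleftrightarrow>
      (\<forall>(V, \<psi>)\<in>A. smooth_on {(t, u). t \<in> J \<and> u \<in> \<phi> ` U \<and> F (t, inv_into U \<phi> u) \<in> V}
          (\<lambda>(t, u). \<psi> (F (t, inv_into U \<phi> u))))"
    if "open J" "F ` (J \<times> X) \<subseteq> X" "continuous_on (J \<times> X) F" "(U, \<phi>) \<in> A" for U \<phi>
  proof -
    have "(\<lambda>(t, u). F (t, inv_into U \<phi> u)) ` (J \<times> \<phi> ` U) \<subseteq> X"
      using that(2) chart_inverse(3)[OF that(4)] chart_facts(2)[OF that(4)] by force
    moreover have "continuous_on (J \<times> \<phi> ` U) (\<lambda>p. F (fst p, inv_into U \<phi> (snd p)))"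
    proof (rule continuous_on_compose2[OF that(3)])
      show "continuous_on (J \<times> \<phi> ` U) (\<lambda>p. (fst p, inv_into U \<phi> (snd p)))"
        by (intro continuous_intros continuous_on_compose2[OF chart_facts(5)[OF that(4)]]) auto
      show "(\<lambda>p. (fst p, inv_into U \<phi> (snd p))) ` (J \<times> \<phi> ` U) \<subseteq> J \<times> X"
        using chart_inverse(3)[OF that(4)] chart_facts(2)[OF that(4)] by force
    qed
    moreover have "open (J \<times> \<phi> ` U)"
      using that(1) chart_facts(3)[OF that(4)] by (intro open_Times)
    moreover have "{w \<in> J \<times> \<phi> ` U. (\<lambda>(t, u). F (t, inv_into U \<phi> u)) w \<in> V}
        = {(t, u). t \<in> J \<and> u \<in> \<phi> ` U \<and> F (t, inv_into U \<phi> u) \<in> V}" for V by auto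
    moreover have "\<psi> \<circ> (\<lambda>(t, u). F (t, inv_into U \<phi> u)) = (\<lambda>(t, u). \<psi> (F (t, inv_into U \<phi> u)))"
      for \<psi> :: "'a \<Rightarrow> real^2" by auto
    ultimately show ?thesis
      unfolding plot_def by (simp add: case_prod_unfold)
  qed
  then show ?thesis
    unfolding smooth_isotopy_def smooth_family_def by blast
qed

text \<open>Smoothness may be tested against plots instead of charts, which turns the closure properties
  below into formalities.\<close>

lemma smooth_family_plot:
  assumes F: "smooth_family J F" and m: "plot W m"
    and \<tau>: "smooth_on W \<tau>" "\<tau> ` W \<subseteq> J"
  shows "plot W (\<lambda>w. F (\<tau> w, m w))"
proof (rule plot_local)
  fix w assume w: "w \<in> W"
  then have "m w \<in> X" using m unfolding plot_def by blast
  then obtain U \<phi> where U: "(U, \<phi>) \<in> A" "m w \<in> U" using chart_ex by blast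
  define T where "T = {w \<in> W. m w \<in> U}"
  have T: "open T" "T \<subseteq> W" "w \<in> T"
    using plot_open_preimage[OF m chart_facts(1)[OF U(1)]] w U by (auto simp: T_def)
  have F': "plot (J \<times> \<phi> ` U) (\<lambda>(t, u). F (t, inv_into U \<phi> u))"
    using F U(1) unfolding smooth_family_def by auto
  have "smooth_on T (\<lambda>w. (\<tau> w, (\<phi> \<circ> m) w))"
    using smooth_on_Pair[OF T(1)] smooth_on_subset[OF \<tau>(1) T(2)] plot_smooth[OF m U(1)]
    unfolding T_def by blast
  then have "plot T (\<lambda>w. (\<lambda>(t, u). F (t, inv_into U \<phi> u)) (\<tau> w, (\<phi> \<circ> m) w))"
    by (rule plot_compose_smooth[OF F' T(1)]) (use \<tau>(2) in \<open>auto simp: T_def\<close>)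
  then have "plot T (\<lambda>w. F (\<tau> w, m w))"
    by (rule plot_cong) (auto simp: T_def chart_inverse[OF U(1)])
  then show "\<exists>T. w \<in> T \<and> T \<subseteq> W \<and> plot T (\<lambda>w. F (\<tau> w, m w))" using T by blast
qed

lemma smooth_mapD:
  assumes "smooth_map X A f"
  shows "f ` X \<subseteq> X" "continuous_on X f"
  using assms by (auto simp: smooth_map_def)

lemma smooth_map_iff:
  "smooth_map X A f \<longleftrightarrow> f ` X \<subseteq> X \<and> continuous_on X f \<and>
     (\<forall>(U, \<phi>)\<in>A. plot (\<phi> ` U) (\<lambda>u. f (inv_into U \<phi> u)))"
proof -
  have "plot (\<phi> ` U) (\<lambda>u. f (inv_into U \<phi> u)) \<longleftrightarrow>
      (\<forall>(V, \<psi>)\<in>A. smooth_on {u \<in> \<phi> ` U. f (inv_into U \<phi> u) \<in> V} (\<psi> \<circ> f \<circ> inv_into U \<phi>))"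
    if "f ` X \<subseteq> X" "continuous_on X f" "(U, \<phi>) \<in> A" for U \<phi>
  proof -
    have "(\<lambda>u. f (inv_into U \<phi> u)) ` (\<phi> ` U) \<subseteq> X"
      using that(1) chart_inverse(3)[OF that(3)] chart_facts(2)[OF that(3)] by blast
    moreover have "continuous_on (\<phi> ` U) (\<lambda>u. f (inv_into U \<phi> u))"
      using chart_inverse(3)[OF that(3)] chart_facts(2)[OF that(3)]
      by (intro continuous_on_compose2[OF that(2) chart_facts(5)[OF that(3)]]) blast
    ultimately show ?thesis
      unfolding plot_def using chart_facts(3)[OF that(3)] by (simp add: o_def)
  qed
  then show ?thesis unfolding smooth_map_def by blast
qed

lemma smooth_family_const:
  assumes f: "smooth_map X A f" shows "smooth_family UNIV (\<lambda>(t, x). f x)"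
  unfolding smooth_family_def
proof (intro conjI ballI)
  show "(\<lambda>(t, x). f x) ` (UNIV \<times> X) \<subseteq> X" using smooth_mapD[OF f] by auto
  have "continuous_on (UNIV \<times> X) (\<lambda>p :: real \<times> 'a. f (snd p))"
    by (intro continuous_on_compose2[OF smooth_mapD(2)[OF f]] continuous_intros) auto
  then show "continuous_on (UNIV \<times> X) (\<lambda>(t :: real, x). f x)"
    by (simp add: case_prod_unfold)
  fix c assume "c \<in> A"
  then obtain U \<phi> where c: "c = (U, \<phi>)" "(U, \<phi>) \<in> A" by (cases c) auto
  have o: "open ((UNIV :: real set) \<times> \<phi> ` U)"
    using chart_facts(3)[OF c(2)] by (intro open_Times) auto
  have "plot (\<phi> ` U) (\<lambda>u. f (inv_into U \<phi> u))"
    using f c(2) unfolding smooth_map_iff by auto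
  then have "plot ((UNIV :: real set) \<times> \<phi> ` U) (\<lambda>w. f (inv_into U \<phi> (snd w)))"
    by (rule plot_compose_smooth[OF _ o smooth_on_linear[OF o bounded_linear_snd]]) auto
  then show "case c of (U, \<phi>) \<Rightarrow> plot ((UNIV :: real set) \<times> \<phi> ` U)
      (\<lambda>(t, u). (\<lambda>(t, x). f x) (t, inv_into U \<phi> u))"
    using c by (simp add: case_prod_unfold)
qed auto

text \<open>A smooth map is a family that is constant in time, here evaluated at time 0.\<close>

lemma smooth_map_plot:
  assumes "smooth_map X A f" "plot W m" shows "plot W (\<lambda>w. f (m w))"
  using smooth_family_plot[OF smooth_family_const[OF assms(1)] assms(2), of "\<lambda>_. 0"] assms(2)
  by (auto simp: plot_def smooth_on_const)

lemma smooth_map_compose: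
  assumes "smooth_map X A f" "smooth_map X A g" shows "smooth_map X A (f \<circ> g)"
  unfolding smooth_map_iff
proof (intro conjI ballI)
  show "(f \<circ> g) ` X \<subseteq> X"
    using smooth_mapD(1)[OF assms(1)] smooth_mapD(1)[OF assms(2)] by auto
  show "continuous_on X (f \<circ> g)"
    using smooth_mapD[OF assms(1)] smooth_mapD[OF assms(2)]
    by (meson continuous_on_compose continuous_on_subset)
  fix c assume "c \<in> A"
  then obtain U \<phi> where c: "c = (U, \<phi>)" "(U, \<phi>) \<in> A" by (cases c) auto
  have "plot (\<phi> ` U) (\<lambda>u. f (g (inv_into U \<phi> u)))"
    by (rule smooth_map_plot[OF assms(1) smooth_map_plot[OF assms(2) plot_chart[OF c(2)]]])
  then show "case c of (U, \<phi>) \<Rightarrow> plot (\<phi> ` U) (\<lambda>u. (f \<circ> g) (inv_into U \<phi> u))"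
    using c by simp
qed

lemma smooth_map_id: "smooth_map X A (\<lambda>x. x)"
  unfolding smooth_map_iff using plot_chart by auto

lemma smooth_map_cong:
  assumes "smooth_map X A f" "\<And>x. x \<in> X \<Longrightarrow> f x = g x" shows "smooth_map X A g"
  unfolding smooth_map_iff
proof (intro conjI ballI)
  show "g ` X \<subseteq> X" "continuous_on X g"
    using smooth_mapD[OF assms(1)] assms(2) continuous_on_cong[of X X f g] by auto
  fix c assume "c \<in> A"
  then obtain U \<phi> where c: "c = (U, \<phi>)" "(U, \<phi>) \<in> A" by (cases c) auto
  have "plot (\<phi> ` U) (\<lambda>u. f (inv_into U \<phi> u))"
    using assms(1) c(2) unfolding smooth_map_iff by auto
  then have "plot (\<phi> ` U) (\<lambda>u. g (inv_into U \<phi> u))"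
    by (rule plot_cong) (use assms(2) chart_facts(2)[OF c(2)] chart_inverse(3)[OF c(2)] in blast)
  then show "case c of (U, \<phi>) \<Rightarrow> plot (\<phi> ` U) (\<lambda>u. g (inv_into U \<phi> u))"
    using c by simp
qed

lemma smooth_family_compose:
  assumes F: "smooth_family J F" and G: "smooth_family J' G"
  shows "smooth_family (J \<inter> J') (\<lambda>(t, x). F (t, G (t, x)))"
  unfolding smooth_family_def
proof (intro conjI ballI)
  have JJ: "open J" "open J'" "F ` (J \<times> X) \<subseteq> X" "G ` (J' \<times> X) \<subseteq> X"
    "continuous_on (J \<times> X) F" "continuous_on (J' \<times> X) G"
    using F G unfolding smooth_family_def by auto
  show o: "open (J \<inter> J')" using JJ by auto
  show "(\<lambda>(t, x). F (t, G (t, x))) ` ((J \<inter> J') \<times> X) \<subseteq> X"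
    using JJ(3,4) by (force simp: image_subset_iff)
  have "continuous_on ((J \<inter> J') \<times> X) (\<lambda>p. F (fst p, G p))"
    using JJ(4) by (intro continuous_on_compose2[OF JJ(5)] continuous_intros continuous_on_subset[OF JJ(6)]) auto
  then show "continuous_on ((J \<inter> J') \<times> X) (\<lambda>(t, x). F (t, G (t, x)))"
    by (simp add: case_prod_unfold)
  fix c assume "c \<in> A"
  then obtain U \<phi> where c: "c = (U, \<phi>)" "(U, \<phi>) \<in> A" by (cases c) auto
  let ?W = "(J \<inter> J') \<times> \<phi> ` U"
  have W: "open ?W" using o chart_facts(3)[OF c(2)] by (rule open_Times)
  have fs: "smooth_on ?W fst" "smooth_on ?W snd"
    using W by (auto intro: smooth_on_linear bounded_linear_fst bounded_linear_snd)
  have "plot ?W (\<lambda>w. inv_into U \<phi> (snd w))"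
    by (rule plot_compose_smooth[OF plot_chart[OF c(2)] W fs(2)]) auto
  then have "plot ?W (\<lambda>w. F (fst w, G (fst w, inv_into U \<phi> (snd w))))"
    by (intro smooth_family_plot[OF F] smooth_family_plot[OF G] fs(1)) auto
  then show "case c of (U, \<phi>) \<Rightarrow> plot ((J \<inter> J') \<times> \<phi> ` U)
      (\<lambda>(t, u). (\<lambda>(t, x). F (t, G (t, x))) (t, inv_into U \<phi> u))"
    using c by (simp add: case_prod_unfold)
qed

text \<open>Serves to invert isotopies: a family from the identity to f, run backwards and
  precomposed with the inverse of f, leads from the identity to that inverse.\<close>

lemma smooth_family_reflect:
  assumes F: "smooth_family J F"
  shows "smooth_family {t. 1 - t \<in> J} (\<lambda>(t, x). F (1 - t, x))"
  unfolding smooth_family_def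
proof (intro conjI ballI)
  let ?J = "{t :: real. 1 - t \<in> J}"
  have JJ: "open J" "F ` (J \<times> X) \<subseteq> X" "continuous_on (J \<times> X) F"
    using F unfolding smooth_family_def by auto
  have "open ((\<lambda>t. 1 - t) -` J)"
    by (intro open_vimage JJ continuous_intros)
  then show o: "open ?J" by (simp add: vimage_def)
  show "(\<lambda>(t, x). F (1 - t, x)) ` (?J \<times> X) \<subseteq> X" using JJ by auto
  have "continuous_on (?J \<times> X) (\<lambda>p. F (1 - fst p, snd p))"
    by (intro continuous_on_compose2[OF JJ(3)] continuous_intros) auto
  then show "continuous_on (?J \<times> X) (\<lambda>(t, x). F (1 - t, x))"
    by (simp add: case_prod_unfold)
  fix c assume "c \<in> A"
  then obtain U \<phi> where c: "c = (U, \<phi>)" "(U, \<phi>) \<in> A" by (cases c) auto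
  let ?W = "?J \<times> \<phi> ` U"
  have W: "open ?W" using o chart_facts(3)[OF c(2)] by (rule open_Times)
  have fs: "smooth_on ?W (\<lambda>w. 1 + (-1) *\<^sub>R fst w)" "smooth_on ?W snd"
    by (intro smooth_on_add smooth_on_const smooth_on_scaleR smooth_on_linear
        bounded_linear_fst bounded_linear_snd W)+
  have "plot ?W (\<lambda>w. inv_into U \<phi> (snd w))"
    by (rule plot_compose_smooth[OF plot_chart[OF c(2)] W fs(2)]) auto
  then have "plot ?W (\<lambda>w. F (1 + (-1) *\<^sub>R fst w, inv_into U \<phi> (snd w)))"
    by (intro smooth_family_plot[OF F] fs(1)) auto
  then show "case c of (U, \<phi>) \<Rightarrow> plot (?J \<times> \<phi> ` U)
      (\<lambda>(t, u). (\<lambda>(t, x). F (1 - t, x)) (t, inv_into U \<phi> u))"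
    using c by (simp add: case_prod_unfold)
qed

section \<open>Diffeomorphisms and orientation\<close>

lemma diffeoI:
  assumes "smooth_map X A f" "smooth_map X A g"
    and "\<And>x. x \<in> X \<Longrightarrow> g (f x) = x" "\<And>x. x \<in> X \<Longrightarrow> f (g x) = x"
  shows "diffeo X A f"
proof -
  have "bij_betw f X X"
    by (rule bij_betw_byWitness[where f' = g]) (use assms smooth_mapD(1) in auto)
  moreover have "inv_into X f x = g x" if "x \<in> X" for x
    using that assms smooth_mapD(1)[OF assms(2)] calculation
    by (metis bij_betw_imp_inj_on image_subset_iff inv_into_f_eq)
  then have "smooth_map X A (inv_into X f)"
    using assms(2) smooth_map_cong by metis
  ultimately show ?thesis using assms(1) by (simp add: diffeo_def)
qed

lemma diffeo_inv:
  assumes "diffeo X A f"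
  shows "x \<in> X \<Longrightarrow> inv_into X f (f x) = x" "x \<in> X \<Longrightarrow> f (inv_into X f x) = x"
    "diffeo X A (inv_into X f)"
proof -
  have *: "inv_into X f (f x) = x" "f (inv_into X f x) = x" if "x \<in> X" for x
    using assms that by (auto simp: diffeo_def bij_betw_def f_inv_into_f)
  then show "x \<in> X \<Longrightarrow> inv_into X f (f x) = x" "x \<in> X \<Longrightarrow> f (inv_into X f x) = x" by auto
  show "diffeo X A (inv_into X f)"
    by (rule diffeoI[of _ f]) (use assms * in \<open>auto simp: diffeo_def\<close>)
qed

lemma diffeo_compose:
  assumes "diffeo X A f" "diffeo X A g" shows "diffeo X A (f \<circ> g)"
proof (rule diffeoI)
  have fg: "f ` X \<subseteq> X" "g ` X \<subseteq> X" "inv_into X f ` X \<subseteq> X" "inv_into X g ` X \<subseteq> X"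
    using assms smooth_mapD(1) unfolding diffeo_def by blast+
  show "smooth_map X A (f \<circ> g)" "smooth_map X A (inv_into X g \<circ> inv_into X f)"
    using assms by (auto simp: diffeo_def intro: smooth_map_compose)
  fix x assume x: "x \<in> X"
  then have "g x \<in> X" "inv_into X f x \<in> X" using fg by blast+
  then show "(inv_into X g \<circ> inv_into X f) ((f \<circ> g) x) = x" "(f \<circ> g) ((inv_into X g \<circ> inv_into X f) x) = x"
    using x diffeo_inv(1,2)[OF assms(1)] diffeo_inv(1,2)[OF assms(2)] by simp_all
qed

lemma diffeo_cong:
  assumes "diffeo X A f" "\<And>x. x \<in> X \<Longrightarrow> f x = g x" shows "diffeo X A g"
proof (rule diffeoI)
  have fg: "inv_into X f ` X \<subseteq> X"
    using assms smooth_mapD(1) unfolding diffeo_def by blast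
  show "smooth_map X A g"  "smooth_map X A (inv_into X f)"
    using assms(1) smooth_map_cong[OF _ assms(2)] by (auto simp: diffeo_def)
  fix x assume x: "x \<in> X"
  then have ix: "inv_into X f x \<in> X" using fg by blast
  show "inv_into X f (g x) = x"
    using diffeo_inv(1)[OF assms(1) x] assms(2)[OF x] by simp
  show "g (inv_into X f x) = x"
    using diffeo_inv(2)[OF assms(1) x] assms(2)[OF ix] by simp
qed

lemma smooth_map_local_smooth:
  assumes f: "smooth_map X A f" and c: "(U, \<phi>) \<in> A" "(V, \<psi>) \<in> A"
  shows "open {u \<in> \<phi> ` U. f (inv_into U \<phi> u) \<in> V}"
    "smooth_on {u \<in> \<phi> ` U. f (inv_into U \<phi> u) \<in> V} (\<psi> \<circ> f \<circ> inv_into U \<phi>)"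
proof -
  have "plot (\<phi> ` U) (\<lambda>u. f (inv_into U \<phi> u))"
    using f c unfolding smooth_map_iff by auto
  then show "open {u \<in> \<phi> ` U. f (inv_into U \<phi> u) \<in> V}"
    using plot_open_preimage chart_facts(1)[OF c(2)] by blast
  show "smooth_on {u \<in> \<phi> ` U. f (inv_into U \<phi> u) \<in> V} (\<psi> \<circ> f \<circ> inv_into U \<phi>)"
    using f c unfolding smooth_map_def by auto
qed

lemma jacobian_chain:
  assumes f: "smooth_map X A f" and g: "smooth_map X A g"
    and c: "(U, \<phi>) \<in> A" "(V, \<psi>) \<in> A" "(W, \<theta>) \<in> A"
    and u: "u \<in> \<phi> ` U" "g (inv_into U \<phi> u) \<in> V" "f (g (inv_into U \<phi> u)) \<in> W"
  shows "jacobian (\<theta> \<circ> (f \<circ> g) \<circ> inv_into U \<phi>) u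
    = jacobian (\<theta> \<circ> f \<circ> inv_into V \<psi>) (\<psi> (g (inv_into U \<phi> u))) * jacobian (\<psi> \<circ> g \<circ> inv_into U \<phi>) u"
proof -
  let ?g = "\<psi> \<circ> g \<circ> inv_into U \<phi>" and ?f = "\<theta> \<circ> f \<circ> inv_into V \<psi>"
  have dg: "?g differentiable at u"
    using smooth_on_imp_differentiable[OF smooth_map_local_smooth(2)[OF g c(1,2)]] u by simp
  have df: "?f differentiable at (?g u)"
    using smooth_on_imp_differentiable[OF smooth_map_local_smooth(2)[OF f c(2,3)]] u
      chart_inverse[OF c(2)] by simp
  \<comment> \<open>The coordinate map \<open>\<psi>\<close> cancels against its inverse only where
    \<open>g\<close> takes values in \<open>V\<close>; this is an open set around \<open>u\<close>,
    which suffices for derivatives.\<close>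
  have "jacobian (\<lambda>x. ?f (?g x)) u = jacobian (\<theta> \<circ> (f \<circ> g) \<circ> inv_into U \<phi>) u"
  proof (rule jacobian_cong)
    show "(\<lambda>x. ?f (?g x)) differentiable at u"
      using differentiable_chain_at[OF dg df] by (simp add: o_def)
    show "open {u \<in> \<phi> ` U. g (inv_into U \<phi> u) \<in> V}"
      by (rule smooth_map_local_smooth(1)[OF g c(1,2)])
  qed (use u chart_inverse[OF c(2)] in auto)
  then show ?thesis
    using jacobian_compose[OF dg df] by (simp add: o_def)
qed

text \<open>One pair of charts around each point decides the sign. Coordinate changes are the
  identity map read in two charts, so \<open>jacobian_chain\<close> applied on both sides multiplies
  the given Jacobian by two factors that the atlas makes positive.\<close>

lemma orientation_preservingI:
  assumes f: "smooth_map X A f"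
    and pos: "\<And>x. x \<in> X \<Longrightarrow> \<exists>U \<phi> V \<psi>. (U, \<phi>) \<in> A \<and> (V, \<psi>) \<in> A \<and> x \<in> U \<and> f x \<in> V \<and>
      jacobian (\<psi> \<circ> f \<circ> inv_into U \<phi>) (\<phi> x) > 0"
  shows "orientation_preserving X A f"
proof -
  have "jacobian (\<psi>' \<circ> f \<circ> inv_into U' \<phi>') u > 0"
    if c': "(U', \<phi>') \<in> A" "(V', \<psi>') \<in> A" and u: "u \<in> \<phi>' ` U'" "f (inv_into U' \<phi>' u) \<in> V'"
    for U' \<phi>' V' \<psi>' u
  proof -
    let ?x = "inv_into U' \<phi>' u"
    have x: "?x \<in> U'" "?x \<in> X" "\<phi>' ?x = u" using chart_inverse[OF c'(1)] chart_facts(2)[OF c'(1)] u by auto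
    obtain U \<phi> V \<psi> where c: "(U, \<phi>) \<in> A" "(V, \<psi>) \<in> A" "?x \<in> U" "f ?x \<in> V"
      and p: "jacobian (\<psi> \<circ> f \<circ> inv_into U \<phi>) (\<phi> ?x) > 0"
      using pos[OF x(2)] by blast
    have t1: "jacobian (\<phi> \<circ> (\<lambda>x. x) \<circ> inv_into U' \<phi>') u > 0"
      using transition(2)[OF c'(1) c(1), of u] x c(3) by (simp add: comp_def image_iff) (metis IntI)
    have t2: "jacobian (\<psi>' \<circ> (\<lambda>x. x) \<circ> inv_into V \<psi>) (\<psi> (f ?x)) > 0"
      using transition(2)[OF c(2) c'(2)] u c(4) by (simp add: comp_def)
    have "jacobian (\<psi> \<circ> (f \<circ> (\<lambda>x. x)) \<circ> inv_into U' \<phi>') u > 0"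
      by (subst jacobian_chain[OF f smooth_map_id c'(1) c(1,2) u(1)]) (use c p t1 in auto)
    then have "jacobian (\<psi> \<circ> f \<circ> inv_into U' \<phi>') u > 0"
      by (simp add: comp_def)
    then have "jacobian (\<psi>' \<circ> ((\<lambda>x. x) \<circ> f) \<circ> inv_into U' \<phi>') u > 0"
      by (subst jacobian_chain[OF smooth_map_id f c'(1) c(2) c'(2) u(1)]) (use c t2 u in auto)
    then show ?thesis by (simp add: comp_def)
  qed
  then show ?thesis unfolding orientation_preserving_def by blast
qed

lemma orientation_preservingD:
  "orientation_preserving X A f \<Longrightarrow> (U, \<phi>) \<in> A \<Longrightarrow> (V, \<psi>) \<in> A \<Longrightarrow> u \<in> \<phi> ` U \<Longrightarrow>
    f (inv_into U \<phi> u) \<in> V \<Longrightarrow> jacobian (\<psi> \<circ> f \<circ> inv_into U \<phi>) u > 0"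
  unfolding orientation_preserving_def by blast

lemma orientation_preserving_compose:
  assumes "smooth_map X A f" "smooth_map X A g"
    "orientation_preserving X A f" "orientation_preserving X A g"
  shows "orientation_preserving X A (f \<circ> g)"
proof (rule orientation_preservingI[OF smooth_map_compose[OF assms(1,2)]])
  fix x assume x: "x \<in> X"
  then have "g x \<in> X" "f (g x) \<in> X" using assms(1,2) smooth_mapD(1) by blast+
  then obtain U \<phi> V \<psi> W \<theta> where c: "(U, \<phi>) \<in> A" "(V, \<psi>) \<in> A" "(W, \<theta>) \<in> A"
    and m: "x \<in> U" "g x \<in> V" "f (g x) \<in> W" using chart_ex x by meson
  have "jacobian (\<theta> \<circ> (f \<circ> g) \<circ> inv_into U \<phi>) (\<phi> x) > 0"
    by (subst jacobian_chain[OF assms(1,2) c])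
       (use m chart_inverse[OF c(1)] chart_inverse[OF c(2)] orientation_preservingD[OF assms(3) c(2,3)]
         orientation_preservingD[OF assms(4) c(1,2)] in auto)
  then show "\<exists>U \<phi> V \<psi>. (U, \<phi>) \<in> A \<and> (V, \<psi>) \<in> A \<and> x \<in> U \<and> (f \<circ> g) x \<in> V \<and>
      jacobian (\<psi> \<circ> (f \<circ> g) \<circ> inv_into U \<phi>) (\<phi> x) > 0"
    using c m by auto
qed

lemma orientation_preserving_cong:
  assumes f: "smooth_map X A f" "orientation_preserving X A f" and eq: "\<And>x. x \<in> X \<Longrightarrow> f x = g x"
  shows "orientation_preserving X A g"
  unfolding orientation_preserving_def
proof (clarify)
  fix U \<phi> V \<psi> x
  assume c: "(U, \<phi>) \<in> A" "(V, \<psi>) \<in> A" and u: "x \<in> U" "g (inv_into U \<phi> (\<phi> x)) \<in> V"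
  have gf: "g (inv_into U \<phi> u) = f (inv_into U \<phi> u)" if "u \<in> \<phi> ` U" for u
    using eq chart_inverse(3)[OF c(1) that] chart_facts(2)[OF c(1)] by auto
  have "jacobian (\<psi> \<circ> f \<circ> inv_into U \<phi>) (\<phi> x) = jacobian (\<psi> \<circ> g \<circ> inv_into U \<phi>) (\<phi> x)"
    by (rule jacobian_cong[OF _ chart_facts(3)[OF c(1)]])
       (use smooth_on_imp_differentiable[OF smooth_map_local_smooth(2)[OF f(1) c]] u gf in auto)
  then show "jacobian (\<psi> \<circ> g \<circ> inv_into U \<phi>) (\<phi> x) > 0"
    using orientation_preservingD[OF f(2) c, of "\<phi> x"] u gf by auto
qed

lemma orientation_preserving_id: "orientation_preserving X A (\<lambda>x. x)"
proof (rule orientation_preservingI[OF smooth_map_id])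
  fix x assume "x \<in> X"
  then obtain U \<phi> where "(U, \<phi>) \<in> A" "x \<in> U" using chart_ex by blast
  then show "\<exists>U \<phi> V \<psi>. (U, \<phi>) \<in> A \<and> (V, \<psi>) \<in> A \<and> x \<in> U \<and> x \<in> V \<and>
      jacobian (\<psi> \<circ> (\<lambda>x. x) \<circ> inv_into U \<phi>) (\<phi> x) > 0"
    using transition(2)[of U \<phi> U \<phi> "\<phi> x"] by (auto simp: comp_def)
qed

text \<open>The Jacobians of \<open>f\<close> and of its inverse multiply to the Jacobian of a map
  that is the identity on \<open>X\<close>, so they have the same sign.\<close>

lemma orientation_preserving_inv:
  assumes f: "diffeo X A f" "orientation_preserving X A f"
  shows "orientation_preserving X A (inv_into X f)"
proof (rule orientation_preservingI)
  have s: "smooth_map X A f" "smooth_map X A (inv_into X f)" using f by (auto simp: diffeo_def)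
  show "smooth_map X A (inv_into X f)" by fact
  fix x assume x: "x \<in> X"
  let ?y = "inv_into X f x"
  have y: "?y \<in> X" "f ?y = x" using x smooth_mapD(1)[OF s(2)] diffeo_inv[OF f(1)] by auto
  obtain U \<phi> V \<psi> where c: "(U, \<phi>) \<in> A" "(V, \<psi>) \<in> A" and m: "x \<in> U" "?y \<in> V"
    using chart_ex x y by meson
  have "orientation_preserving X A (f \<circ> inv_into X f)"
    by (rule orientation_preserving_cong[OF smooth_map_id orientation_preserving_id])
       (use diffeo_inv[OF f(1)] in auto)
  then have "jacobian (\<phi> \<circ> (f \<circ> inv_into X f) \<circ> inv_into U \<phi>) (\<phi> x) > 0"
    using orientation_preservingD[OF _ c(1,1), of "f \<circ> inv_into X f" "\<phi> x"] m y chart_inverse[OF c(1)] by auto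
  moreover have "jacobian (\<phi> \<circ> (f \<circ> inv_into X f) \<circ> inv_into U \<phi>) (\<phi> x)
     = jacobian (\<phi> \<circ> f \<circ> inv_into V \<psi>) (\<psi> ?y) * jacobian (\<psi> \<circ> inv_into X f \<circ> inv_into U \<phi>) (\<phi> x)"
    using jacobian_chain[OF s c(1,2,1), of "\<phi> x"] m y chart_inverse[OF c(1)] by auto
  moreover have "jacobian (\<phi> \<circ> f \<circ> inv_into V \<psi>) (\<psi> ?y) > 0"
    using orientation_preservingD[OF f(2) c(2,1), of "\<psi> ?y"] m y chart_inverse[OF c(2)] by auto
  ultimately have "jacobian (\<psi> \<circ> inv_into X f \<circ> inv_into U \<phi>) (\<phi> x) > 0"
    by (simp add: zero_less_mult_iff)
  then show "\<exists>U \<phi> V \<psi>. (U, \<phi>) \<in> A \<and> (V, \<psi>) \<in> A \<and> x \<in> U \<and> ?y \<in> V \<and>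
      jacobian (\<psi> \<circ> inv_into X f \<circ> inv_into U \<phi>) (\<phi> x) > 0"
    using c m by blast
qed

section \<open>The group of marked diffeomorphisms and its subgroup of those isotopic to the
  identity\<close>

lemma Diff_marked_restrictI:
  assumes "diffeo X A f" "orientation_preserving X A f" "f star = star" "star \<in> X"
  shows "restrict f X \<in> Diff_marked X A star"
  using assms diffeo_cong[of f "restrict f X"] orientation_preserving_cong[of f "restrict f X"]
  by (auto simp: Diff_marked_def diffeo_def)

lemma Diff_markedD:
  assumes "f \<in> Diff_marked X A star"
  shows "f \<in> extensional X" "diffeo X A f" "orientation_preserving X A f" "f star = star"
    "smooth_map X A f" "bij_betw f X X" "f \<in> Bij X" "\<And>x. x \<in> X \<Longrightarrow> f x \<in> X" "continuous_on X f"
  using assms smooth_mapD by (auto simp: Diff_marked_def diffeo_def Bij_def bij_betw_def)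

lemma Diff_marked_compose:
  assumes "f \<in> Diff_marked X A star" "g \<in> Diff_marked X A star" "star \<in> X"
  shows "compose X f g \<in> Diff_marked X A star"
  using Diff_marked_restrictI[OF diffeo_compose orientation_preserving_compose, of f g star]
    assms Diff_markedD[of f star] Diff_markedD[of g star] by (simp add: compose_def o_def)

lemma Diff_marked_inv:
  assumes "f \<in> Diff_marked X A star" "star \<in> X"
  shows "restrict (inv_into X f) X \<in> Diff_marked X A star"
proof -
  note f = Diff_markedD[OF assms(1)]
  have "inv_into X f star = star" using diffeo_inv(1)[OF f(2) assms(2)] f(4) by simp
  then show ?thesis
    using Diff_marked_restrictI[OF diffeo_inv(3)[OF f(2)] orientation_preserving_inv[OF f(2,3)]] assms(2) by blast
qed

lemma Diff_marked_id: "star \<in> X \<Longrightarrow> (\<lambda>x\<in>X. x) \<in> Diff_marked X A star"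
  using Diff_marked_restrictI[OF _ orientation_preserving_id] diffeoI[OF smooth_map_id smooth_map_id]
  by simp

lemma subgroup_Diff_marked:
  assumes "star \<in> X" shows "subgroup (Diff_marked X A star) (BijGroup X)"
proof (rule subgroup.intro)
  have B: "Diff_marked X A star \<subseteq> Bij X" using Diff_markedD(7) by auto
  then show "Diff_marked X A star \<subseteq> carrier (BijGroup X)" by (simp add: BijGroup_def)
  show "x \<otimes>\<^bsub>BijGroup X\<^esub> y \<in> Diff_marked X A star"
    if "x \<in> Diff_marked X A star" "y \<in> Diff_marked X A star" for x y
    using that B Diff_marked_compose[OF that assms] by (auto simp: BijGroup_def)
  show "\<one>\<^bsub>BijGroup X\<^esub> \<in> Diff_marked X A star"
    using Diff_marked_id[OF assms] by (simp add: BijGroup_def)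
  show "inv\<^bsub>BijGroup X\<^esub> x \<in> Diff_marked X A star" if "x \<in> Diff_marked X A star" for x
    using that B Diff_marked_inv[OF that assms] inv_BijGroup[of x X] by auto
qed

lemma group_Diff_group: "star \<in> X \<Longrightarrow> group (Diff_group X A star)"
  unfolding Diff_group_def
  by (rule subgroup.subgroup_is_group[OF subgroup_Diff_marked group_BijGroup])

lemma Diff_group_simps:
  "carrier (Diff_group X A star) = Diff_marked X A star"
  "\<one>\<^bsub>Diff_group X A star\<^esub> = (\<lambda>x\<in>X. x)"
  "f \<in> Diff_marked X A star \<Longrightarrow> h \<in> Diff_marked X A star \<Longrightarrow> f \<otimes>\<^bsub>Diff_group X A star\<^esub> h = compose X f h"
  using Diff_markedD(7)[of f star] Diff_markedD(7)[of h star] by (simp_all add: Diff_group_def BijGroup_def)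

lemma Diff_group_inv:
  assumes "star \<in> X" "f \<in> Diff_marked X A star"
  shows "inv\<^bsub>Diff_group X A star\<^esub> f = (\<lambda>x\<in>X. inv_into X f x)"
proof -
  have "inv\<^bsub>Diff_group X A star\<^esub> f = inv\<^bsub>BijGroup X\<^esub> f"
    unfolding Diff_group_def
    by (rule group.m_inv_consistent[OF group_BijGroup subgroup_Diff_marked[OF assms(1)] assms(2)])
  then show ?thesis using inv_BijGroup[OF Diff_markedD(7)[OF assms(2)]] by simp
qed

lemma Diff_isotopic_idI:
  assumes "smooth_family J F" "{0..1} \<subseteq> J" "\<And>t. t \<in> {0..1} \<Longrightarrow> (\<lambda>x\<in>X. F (t, x)) \<in> Diff_marked X A star"
    "\<And>x. x \<in> X \<Longrightarrow> F (0, x) = x" "\<And>x. x \<in> X \<Longrightarrow> F (1, x) = f x" "f \<in> extensional X"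
  shows "f \<in> Diff_isotopic_id X A star"
proof -
  have "(\<lambda>x\<in>X. F (1, x)) = f"
    using assms(5,6) by (intro extensionalityI[of _ X]) auto
  then have "f \<in> Diff_marked X A star" using assms(3)[of 1] by simp
  moreover have "isotopic X A star (\<lambda>x\<in>X. x) f"
    unfolding isotopic_def smooth_isotopy_iff using assms by (intro exI[of _ J] exI[of _ F]) auto
  ultimately show ?thesis by (simp add: Diff_isotopic_id_def)
qed

lemma Diff_isotopic_idE:
  assumes "f \<in> Diff_isotopic_id X A star"
  obtains J F where "smooth_family J F" "{0..1} \<subseteq> J"
    "\<And>t. t \<in> {0..1} \<Longrightarrow> (\<lambda>x\<in>X. F (t, x)) \<in> Diff_marked X A star"
    "\<And>x. x \<in> X \<Longrightarrow> F (0, x) = x" "\<And>x. x \<in> X \<Longrightarrow> F (1, x) = f x"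
    "f \<in> Diff_marked X A star"
  using assms unfolding Diff_isotopic_id_def isotopic_def smooth_isotopy_iff by auto

text \<open>With isotopies F and F' from the identity to f and h, the products are joined to it by
  F_t o F'_t, conjugates by h o F_t o h^-1, inverses by F_(1-t) o f^-1. At each time these are
  products of marked diffeomorphisms.\<close>

lemma normal_Diff_isotopic_id:
  assumes star: "star \<in> X"
  shows "Diff_isotopic_id X A star \<lhd> Diff_group X A star"
proof -
  interpret D: group "Diff_group X A star" by (rule group_Diff_group[OF star])
  note simps = Diff_group_simps[where star = star]
  let ?N = "Diff_isotopic_id X A star"
  have sub: "?N \<subseteq> Diff_marked X A star" by (auto simp: Diff_isotopic_id_def)
  have XX: "x \<in> X \<Longrightarrow> (\<lambda>x\<in>X. F (t, x)) \<in> Diff_marked X A star \<Longrightarrow> F (t, x) \<in> X" for F x and t :: real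
    using Diff_markedD(8)[of "\<lambda>x\<in>X. F (t, x)" star x] by auto
  have comp: "compose X f h \<in> ?N" if fh: "f \<in> ?N" "h \<in> ?N" for f h
  proof -
    obtain J F where F: "smooth_family J F" "{0..1} \<subseteq> J"
      "\<And>t. t \<in> {0..1} \<Longrightarrow> (\<lambda>x\<in>X. F (t, x)) \<in> Diff_marked X A star"
      "\<And>x. x \<in> X \<Longrightarrow> F (0, x) = x" "\<And>x. x \<in> X \<Longrightarrow> F (1, x) = f x"
      using Diff_isotopic_idE[OF fh(1)] by metis
    obtain J' F' where F': "smooth_family J' F'" "{0..1} \<subseteq> J'"
      "\<And>t. t \<in> {0..1} \<Longrightarrow> (\<lambda>x\<in>X. F' (t, x)) \<in> Diff_marked X A star"
      "\<And>x. x \<in> X \<Longrightarrow> F' (0, x) = x" "\<And>x. x \<in> X \<Longrightarrow> F' (1, x) = h x"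
      using Diff_isotopic_idE[OF fh(2)] by metis
    show ?thesis
    proof (rule Diff_isotopic_idI[OF smooth_family_compose[OF F(1) F'(1)]])
      show "{0..1} \<subseteq> J \<inter> J'" using F F' by auto
      fix t :: real assume t: "t \<in> {0..1}"
      have "(\<lambda>x\<in>X. (\<lambda>(t, x). F (t, F' (t, x))) (t, x))
          = compose X (\<lambda>x\<in>X. F (t, x)) (\<lambda>x\<in>X. F' (t, x))"
        using XX[OF _ F'(3)[OF t]] by (auto simp: compose_def)
      then show "(\<lambda>x\<in>X. (\<lambda>(t, x). F (t, F' (t, x))) (t, x)) \<in> Diff_marked X A star"
        using Diff_marked_compose[OF F(3) F'(3) star] t by simp
    next
      fix x assume "x \<in> X"
      then show "(\<lambda>(t, x). F (t, F' (t, x))) (0, x) = x" "(\<lambda>(t, x). F (t, F' (t, x))) (1, x) = compose X f h x"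
        using F(4,5) F'(4,5) XX[OF _ F'(3)[of 1]] by (auto simp: compose_def)
    qed auto
  qed
  have inv: "(\<lambda>x\<in>X. inv_into X f x) \<in> ?N" if f: "f \<in> ?N" for f
  proof -
    obtain J F where F: "smooth_family J F" "{0..1} \<subseteq> J"
      "\<And>t. t \<in> {0..1} \<Longrightarrow> (\<lambda>x\<in>X. F (t, x)) \<in> Diff_marked X A star"
      "\<And>x. x \<in> X \<Longrightarrow> F (0, x) = x" "\<And>x. x \<in> X \<Longrightarrow> F (1, x) = f x" and fD: "f \<in> Diff_marked X A star"
      using Diff_isotopic_idE[OF f] by metis
    let ?i = "\<lambda>x\<in>X. inv_into X f x"
    note i = Diff_markedD[OF Diff_marked_inv[OF fD star]]
    have fi: "f (?i x) = x" "?i x \<in> X" if "x \<in> X" for x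
      using diffeo_inv(2)[OF Diff_markedD(2)[OF fD] that] i(8)[OF that] that by simp_all
    \<comment> \<open>Only the end map \<open>f\<close> gets inverted. Inverting F at every time
      would raise the question whether the inverses depend smoothly on time and point
      together.\<close>
    have "smooth_family ({t. 1 - t \<in> J} \<inter> UNIV) (\<lambda>(t, x). (\<lambda>(t, x). F (1 - t, x)) (t, (\<lambda>(t, x). ?i x) (t, x)))"
      by (rule smooth_family_compose[OF smooth_family_reflect[OF F(1)] smooth_family_const[OF i(5)]])
    then have fam: "smooth_family {t. 1 - t \<in> J} (\<lambda>(t, x). F (1 - t, ?i x))"
      by simp
    show ?thesis
    proof (rule Diff_isotopic_idI[OF fam])
      show "{0..1} \<subseteq> {t. 1 - t \<in> J}" using F(2) by auto
      fix t :: real assume t: "t \<in> {0..1}"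
      have "(\<lambda>x\<in>X. (\<lambda>(t, x). F (1 - t, ?i x)) (t, x)) = compose X (\<lambda>x\<in>X. F (1 - t, x)) ?i"
        using fi(2) by (auto simp: compose_def)
      then show "(\<lambda>x\<in>X. (\<lambda>(t, x). F (1 - t, ?i x)) (t, x)) \<in> Diff_marked X A star"
        using Diff_marked_compose[OF F(3)[of "1 - t"] Diff_marked_inv[OF fD star] star] t by simp
    next
      fix x assume "x \<in> X"
      then show "(\<lambda>(t, x). F (1 - t, ?i x)) (0, x) = x" "(\<lambda>(t, x). F (1 - t, ?i x)) (1, x) = ?i x"
        using F(4,5) fi by (auto simp del: restrict_apply)
    qed auto
  qed
  have conj: "compose X (compose X h f) (\<lambda>x\<in>X. inv_into X h x) \<in> ?N"
    if h: "h \<in> Diff_marked X A star" and f: "f \<in> ?N" for h f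
  proof -
    obtain J F where F: "smooth_family J F" "{0..1} \<subseteq> J"
      "\<And>t. t \<in> {0..1} \<Longrightarrow> (\<lambda>x\<in>X. F (t, x)) \<in> Diff_marked X A star"
      "\<And>x. x \<in> X \<Longrightarrow> F (0, x) = x" "\<And>x. x \<in> X \<Longrightarrow> F (1, x) = f x" and fD: "f \<in> Diff_marked X A star"
      using Diff_isotopic_idE[OF f] by metis
    let ?i = "\<lambda>x\<in>X. inv_into X h x"
    note i = Diff_markedD[OF Diff_marked_inv[OF h star]]
    have hi: "h (?i x) = x" "?i x \<in> X" if "x \<in> X" for x
      using diffeo_inv(2)[OF Diff_markedD(2)[OF h] that] i(8)[OF that] that by simp_all
    have "smooth_family (UNIV \<inter> J) (\<lambda>(t, x). (\<lambda>(t, x). h x) (t, F (t, x)))"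
      by (rule smooth_family_compose[OF smooth_family_const[OF Diff_markedD(5)[OF h]] F(1)])
    then have "smooth_family (J \<inter> UNIV) (\<lambda>(t, x). (\<lambda>(t, x). h (F (t, x))) (t, (\<lambda>(t, x). ?i x) (t, x)))"
      by (intro smooth_family_compose smooth_family_const[OF i(5)]) (simp add: case_prod_unfold)
    then have fam: "smooth_family J (\<lambda>(t, x). h (F (t, ?i x)))" by simp
    show ?thesis
    proof (rule Diff_isotopic_idI[OF fam F(2)])
      fix t :: real assume t: "t \<in> {0..1}"
      have "(\<lambda>x\<in>X. (\<lambda>(t, x). h (F (t, ?i x))) (t, x)) = compose X (compose X h (\<lambda>x\<in>X. F (t, x))) ?i"
        using hi(2) by (auto simp: compose_def)
      then show "(\<lambda>x\<in>X. (\<lambda>(t, x). h (F (t, ?i x))) (t, x)) \<in> Diff_marked X A star"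
        using Diff_marked_compose[OF Diff_marked_compose[OF h F(3)[OF t] star] Diff_marked_inv[OF h star] star] by simp
    next
      fix x assume x: "x \<in> X"
      show "(\<lambda>(t, x). h (F (t, ?i x))) (0, x) = x"
        using F(4) hi[OF x] by (simp del: restrict_apply)
      show "(\<lambda>(t, x). h (F (t, ?i x))) (1, x) = compose X (compose X h f) ?i x"
        using F(5) hi[OF x] x by (simp add: compose_eq del: restrict_apply)
    qed auto
  qed
  have "\<one>\<^bsub>Diff_group X A star\<^esub> \<in> ?N"
    using Diff_isotopic_idI[OF smooth_family_const[OF smooth_map_id], of star "\<lambda>x\<in>X. x"]
      Diff_marked_id[OF star] by (simp add: simps)
  then have "subgroup ?N (Diff_group X A star)"
    using comp inv sub by (intro subgroup.intro) (auto simp: simps Diff_group_inv[OF star] subset_iff)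
  then show ?thesis
    by (rule D.normal_invI)
       (use conj sub Diff_marked_compose[OF _ _ star] Diff_marked_inv[OF _ star] in
         \<open>auto simp: simps Diff_group_inv[OF star] subset_iff\<close>)
qed

end

section \<open>Pushing a point along a path\<close>

definition rot90 :: "real^2 \<Rightarrow> real^2" where
  "rot90 v = (\<chi> i. if i = 1 then - v $ 2 else v $ 1)"

lemma rot90_simps [simp]: "rot90 v $ 1 = - v $ 2" "rot90 v $ 2 = v $ 1"
  by (auto simp: rot90_def)

lemma bounded_linear_rot90: "bounded_linear rot90"
  by (intro linear_conv_bounded_linear[THEN iffD1] linearI) (auto simp: vec_eq_iff forall_2)

lemma inner_vec2: "(x :: real^2) \<bullet> y = x $ 1 * y $ 1 + x $ 2 * y $ 2"
  by (simp add: inner_vec_def sum_2)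

text \<open>Rotation about \<open>m\<close> by an angle that depends on the squared distance from
  \<open>m\<close>; the square keeps the map smooth at the centre. Circles about \<open>m\<close>
  are preserved, hence the inverse is the twist with the negated angle function.\<close>

definition twist :: "(real \<Rightarrow> real) \<Rightarrow> real^2 \<Rightarrow> real^2 \<Rightarrow> real^2" where
  "twist \<tau> m x = m + (cos (\<tau> ((x - m) \<bullet> (x - m))) *\<^sub>R (x - m) + sin (\<tau> ((x - m) \<bullet> (x - m))) *\<^sub>R rot90 (x - m))"

lemma inner_rotated:
  "(cos a *\<^sub>R w + sin a *\<^sub>R rot90 w) \<bullet> (cos a *\<^sub>R w + sin a *\<^sub>R rot90 w) = w \<bullet> w"
proof -
  have "(c * x - s * y) * (c * x - s * y) + (c * y + s * x) * (c * y + s * x) = x * x + y * y"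
    if "c\<^sup>2 + s\<^sup>2 = 1" for c s x y :: real
    using that by algebra
  from this[OF sin_cos_squared_add2[of a], of "w $ 1" "w $ 2"] show ?thesis
    by (simp add: inner_vec2)
qed

lemma rotate_back:
  "cos a *\<^sub>R (cos a *\<^sub>R w + sin a *\<^sub>R rot90 w) - sin a *\<^sub>R rot90 (cos a *\<^sub>R w + sin a *\<^sub>R rot90 w) = w"
proof -
  have "c * (c * x - s * y) - s * (- (c * y) - s * x) = x" "c * (c * y + s * x) - s * (c * x - s * y) = y"
    if "c\<^sup>2 + s\<^sup>2 = 1" for c s x y :: real
    using that by algebra+
  from this[OF sin_cos_squared_add2[of a], where x = "w $ 1" and y = "w $ 2"] show ?thesis
    by (simp add: vec_eq_iff forall_2)
qed

lemma twist_norm: "norm (twist \<tau> m x - m) = norm (x - m)"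
  unfolding twist_def norm_eq_sqrt_inner by (simp add: inner_rotated)

lemma twist_inverse: "twist (\<lambda>s. - \<tau> s) m (twist \<tau> m x) = x"
  using rotate_back[of "\<tau> ((x - m) \<bullet> (x - m))" "x - m"]
  unfolding twist_def by (simp add: inner_rotated del: rot90_simps)

lemma twist_fixed: "\<tau> ((x - m) \<bullet> (x - m)) = 0 \<Longrightarrow> twist \<tau> m x = x"
  by (simp add: twist_def)

lemma smooth_on_twist:
  assumes "smooth_on UNIV \<tau>" shows "smooth_on UNIV (twist \<tau> m)"
proof -
  have d: "smooth_on UNIV (\<lambda>x. x + (- m))"
    by (intro smooth_on_add smooth_on_id smooth_on_const open_UNIV)
  then have t: "smooth_on UNIV (\<lambda>x. \<tau> ((x + (- m)) \<bullet> (x + (- m))))"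
    by (intro smooth_on_compose[OF open_UNIV open_UNIV assms] smooth_on_inner) auto
  have "smooth_on UNIV (\<lambda>x. m + (cos (\<tau> ((x + (- m)) \<bullet> (x + (- m)))) *\<^sub>R (x + (- m))
      + sin (\<tau> ((x + (- m)) \<bullet> (x + (- m)))) *\<^sub>R rot90 (x + (- m))))"
    by (intro smooth_on_add smooth_on_scaleR smooth_on_const open_UNIV d
        smooth_on_linear_compose[OF open_UNIV bounded_linear_rot90 d]
        smooth_on_compose[OF open_UNIV open_UNIV smooth_on_cos_sin(1) t]
        smooth_on_compose[OF open_UNIV open_UNIV smooth_on_cos_sin(2) t]) auto
  then show ?thesis
    by (rule smooth_on_cong) (auto simp: twist_def)
qed

text \<open>The angle varies only radially while points move along circles, so the derivative is a
  rotation composed with the shear v -> v + 2b (w . v) \<open>rot90\<close> w, and w is orthogonal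
  to \<open>rot90\<close> w. The final polynomial identity is this determinant.\<close>

lemma jacobian_twist:
  assumes "smooth_on UNIV \<tau>" shows "jacobian (twist \<tau> m) x = 1"
proof -
  define w where "w = x - m"
  define a where "a = \<tau> (w \<bullet> w)"
  have "\<tau> differentiable (at (w \<bullet> w))"
    by (rule smooth_on_imp_differentiable[OF assms]) simp
  then obtain b where b: "(\<tau> has_real_derivative b) (at (w \<bullet> w))"
    using real_differentiable_def by blast
  then have b': "(\<tau> has_derivative (\<lambda>h. b * h)) (at (w \<bullet> w))"
    by (simp add: has_field_derivative_def)
  have "((\<lambda>y. (y - m) \<bullet> (y - m)) has_derivative (\<lambda>v. 2 * (w \<bullet> v))) (at x)"
    by (auto intro!: derivative_eq_intros simp: w_def inner_commute)
  then have t: "((\<lambda>y. \<tau> ((y - m) \<bullet> (y - m))) has_derivative (\<lambda>v. b * (2 * (w \<bullet> v)))) (at x)"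
    using has_derivative_compose[of "\<lambda>y. (y - m) \<bullet> (y - m)" _ x UNIV \<tau> "\<lambda>h. b * h"] b' by (simp add: w_def)
  have r: "((\<lambda>y. rot90 (y - m)) has_derivative (\<lambda>v. rot90 v)) (at x)"
    by (rule bounded_linear.has_derivative[OF bounded_linear_rot90]) (auto intro!: derivative_eq_intros)
  let ?D = "\<lambda>v. (cos a *\<^sub>R v + (- sin a * (b * (2 * (w \<bullet> v)))) *\<^sub>R w)
      + (sin a *\<^sub>R rot90 v + (cos a * (b * (2 * (w \<bullet> v)))) *\<^sub>R rot90 w)"
  have tD: "(twist \<tau> m has_derivative ?D) (at x)"
    unfolding twist_def
    by (rule derivative_eq_intros t r refl)+
       (auto simp: a_def w_def fun_eq_iff mult_ac)
  have "frechet_derivative (twist \<tau> m) (at x) = ?D"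
    using frechet_derivative_at[OF tD] by simp
  moreover have "(c - s * (b * (2 * p)) * p - c * (b * (2 * p)) * q) * (c - s * (b * (2 * q)) * q + c * (b * (2 * q)) * p)
      - (- s - c * (b * (2 * q)) * q - s * (b * (2 * q)) * p) * (s + c * (b * (2 * p)) * p - s * (b * (2 * p)) * q) = 1"
    if "c\<^sup>2 + s\<^sup>2 = 1" for c s p q :: real
    using that by algebra
  from this[OF sin_cos_squared_add2[of a]] show ?thesis
    unfolding jacobian_def calculation
    by (simp add: det_2 matrix_def inner_vec2 axis_def)
qed

text \<open>A cut-off in the squared radius, supported in s < R. The constant normalizes the angle
  at squared distance \<open>s\<^sub>0\<close> to pi: a half turn about the midpoint of two points
  exchanges them.\<close>

definition bump_angle :: "real \<Rightarrow> real \<Rightarrow> real \<Rightarrow> real" where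
  "bump_angle R s\<^sub>0 s = pi / flat 0 (R - s\<^sub>0) * flat 0 (R - s)"

lemma smooth_on_bump_angle: "smooth_on UNIV (\<lambda>s. c * bump_angle R s\<^sub>0 s)"
proof -
  have "smooth_on UNIV (\<lambda>s. R + (-1) *\<^sub>R s)"
    by (intro smooth_on_add smooth_on_scaleR smooth_on_const smooth_on_id open_UNIV)
  then have "smooth_on UNIV (\<lambda>s. (c * (pi / flat 0 (R - s\<^sub>0))) *\<^sub>R flat 0 (R + (-1) *\<^sub>R s))"
    by (intro smooth_on_scaleR smooth_on_const open_UNIV smooth_on_compose[OF open_UNIV open_UNIV smooth_on_flat]) auto
  then show ?thesis by (simp add: bump_angle_def mult.assoc)
qed

lemma bump_angle_simps:
  "s\<^sub>0 < R \<Longrightarrow> bump_angle R s\<^sub>0 s\<^sub>0 = pi" "R \<le> s \<Longrightarrow> bump_angle R s\<^sub>0 s = 0"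
  by (auto simp: bump_angle_def flat_def)

section \<open>Twists supported in a disc of a chart\<close>

context smooth_surface
begin

text \<open>Extended by the identity off the chart. This is a reasonable map once
  \<open>\<tau>\<close> vanishes from r^2 on for some closed disc of radius r about \<open>m\<close>
  inside the chart image, as is assumed below.\<close>

definition chart_twist :: "'a chart \<Rightarrow> (real \<Rightarrow> real) \<Rightarrow> real^2 \<Rightarrow> 'a \<Rightarrow> 'a" where
  "chart_twist = (\<lambda>(U, \<phi>) \<tau> m x. if x \<in> U then inv_into U \<phi> (twist \<tau> m (\<phi> x)) else x)"

context
  fixes U \<phi> m r
  assumes c: "(U, \<phi>) \<in> A" and ball: "cball m r \<subseteq> \<phi> ` U" and r: "0 < r"
begin

lemma twist_chart_image:
  assumes "\<forall>s\<ge>r\<^sup>2. \<tau> s = 0"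
  shows "u \<notin> cball m r \<Longrightarrow> twist \<tau> m u = u" "u \<in> \<phi> ` U \<Longrightarrow> twist \<tau> m u \<in> \<phi> ` U"
proof -
  show *: "twist \<tau> m u = u" if "u \<notin> cball m r" for u
  proof -
    have "r \<le> norm (u - m)" using that by (simp add: dist_norm norm_minus_commute)
    then have "r\<^sup>2 \<le> (u - m) \<bullet> (u - m)"
      using r by (metis abs_le_square_iff abs_norm_cancel abs_of_pos power2_norm_eq_inner)
    then show ?thesis using assms by (intro twist_fixed) auto
  qed
  have "twist \<tau> m u \<in> cball m r" if "u \<in> cball m r" for u
    using that twist_norm[of \<tau> m u] by (simp add: dist_norm norm_minus_commute)
  then show "u \<in> \<phi> ` U \<Longrightarrow> twist \<tau> m u \<in> \<phi> ` U" using * ball by (cases "u \<in> cball m r") auto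
qed

lemma chart_twist_in:
  assumes "\<forall>s\<ge>r\<^sup>2. \<tau> s = 0"
  shows "x \<in> U \<Longrightarrow> chart_twist (U, \<phi>) \<tau> m x \<in> U"
    "x \<in> U \<Longrightarrow> \<phi> (chart_twist (U, \<phi>) \<tau> m x) = twist \<tau> m (\<phi> x)"
    "x \<in> X \<Longrightarrow> chart_twist (U, \<phi>) \<tau> m x \<in> X"
  using twist_chart_image(2)[OF assms, where u = "\<phi> x"] chart_inverse[OF c] chart_facts(2)[OF c]
  by (auto simp: chart_twist_def)

lemma chart_twist_outside:
  assumes "\<forall>s\<ge>r\<^sup>2. \<tau> s = 0" "x \<notin> inv_into U \<phi> ` cball m r"
  shows "chart_twist (U, \<phi>) \<tau> m x = x"
proof (cases "x \<in> U")
  case True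
  then have "\<phi> x \<notin> cball m r" using assms(2) chart_inverse(1)[OF c True] by (metis imageI)
  then show ?thesis
    using twist_chart_image(1)[OF assms(1)] chart_inverse(1)[OF c True] by (simp add: chart_twist_def)
qed (simp add: chart_twist_def)

text \<open>The Hausdorff axiom enters here: the disc is compact in the surface, hence
  closed.\<close>

lemma openin_outside: "openin (top_of_set X) (X - inv_into U \<phi> ` cball m r)"
proof -
  have "compact (inv_into U \<phi> ` cball m r)"
    by (intro compact_continuous_image continuous_on_subset[OF chart_facts(5)[OF c] ball]) auto
  then have "closed (inv_into U \<phi> ` cball m r)" by (rule compact_imp_closed)
  then show ?thesis by (simp add: openin_diff closedin_closed_Int Diff_eq openin_open_Int open_Compl)
qed

text \<open>Chart and complement of the disc are two open sets covering the surface; the twist is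
  continuous in the former, the identity on the latter, and both descriptions agree on the overlap.
  The factor \<open>t\<close> on the angle turns the twist into a homotopy starting at the
  identity.\<close>

lemma continuous_chart_twist:
  assumes "\<forall>s\<ge>r\<^sup>2. \<tau> s = 0" "continuous_on UNIV \<tau>"
  shows "continuous_on (UNIV \<times> X) (\<lambda>(t :: real, x). chart_twist (U, \<phi>) (\<lambda>s. t * \<tau> s) m x)"
proof -
  let ?K = "inv_into U \<phi> ` cball m r"
  let ?S = "(UNIV :: real set) \<times> U" and ?T = "(UNIV :: real set) \<times> (X - ?K)"
  let ?f = "\<lambda>p. inv_into U \<phi> (twist (\<lambda>s. fst p * \<tau> s) m (\<phi> (snd p)))"
  have ST: "?S \<union> ?T = UNIV \<times> X"
  proof -
    have "?K \<subseteq> U" using ball chart_inverse(3)[OF c] by blast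
    then show ?thesis using chart_facts(2)[OF c] by auto
  qed
  have z: "\<forall>s\<ge>r\<^sup>2. t * \<tau> s = 0" for t using assms(1) by simp
  have "continuous_on (?S \<union> ?T) (\<lambda>p. if snd p \<in> U then ?f p else snd p)"
  proof (rule continuous_on_cases_local_open)
    show "openin (top_of_set (?S \<union> ?T)) ?S" "openin (top_of_set (?S \<union> ?T)) ?T"
      unfolding ST using chart_facts(1)[OF c] openin_outside by (auto intro!: openin_Times)
    have ph: "continuous_on ?S (\<lambda>p. \<phi> (snd p))"
      by (intro continuous_on_compose2[OF chart_facts(4)[OF c]] continuous_intros) auto
    have "continuous_on ?S (\<lambda>p. twist (\<lambda>s. fst p * \<tau> s) m (\<phi> (snd p)))"
      unfolding twist_def
      by (intro continuous_intros ph continuous_on_compose2[OF assms(2)]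
          bounded_linear.continuous_on[OF bounded_linear_rot90]) auto
    then show "continuous_on ?S ?f"
      by (rule continuous_on_compose2[OF chart_facts(5)[OF c]])
         (use twist_chart_image(2)[OF z] in auto)
    show "continuous_on ?T snd" by (intro continuous_intros)
    show "?f p = snd p" if "p \<in> ?S \<and> snd p \<notin> U \<or> p \<in> ?T \<and> snd p \<in> U" for p
      using that chart_twist_outside[OF z[of "fst p"], where x = "snd p"] by (auto simp: chart_twist_def)
  qed
  moreover have "(\<lambda>(t, x). chart_twist (U, \<phi>) (\<lambda>s. t * \<tau> s) m x) = (\<lambda>p. if snd p \<in> U then ?f p else snd p)"
    by (auto simp: chart_twist_def)
  ultimately show ?thesis using ST by simp
qed

lemma smooth_map_chart_twist:
  assumes "\<forall>s\<ge>r\<^sup>2. \<tau> s = 0" "smooth_on UNIV \<tau>"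
  shows "smooth_map X A (chart_twist (U, \<phi>) \<tau> m)"
  unfolding smooth_map_iff
proof (intro conjI ballI)
  let ?D = "chart_twist (U, \<phi>) \<tau> m" and ?K = "inv_into U \<phi> ` cball m r"
  show "?D ` X \<subseteq> X" using chart_twist_in(3)[OF assms(1)] by blast
  \<comment> \<open>The slice at time 1 of the jointly continuous homotopy.\<close>
  have "continuous_on X (\<lambda>x. (\<lambda>(t :: real, x). chart_twist (U, \<phi>) (\<lambda>s. t * \<tau> s) m x) (1, x))"
    by (rule continuous_on_compose2[OF continuous_chart_twist[OF assms(1) smooth_on_imp_continuous_on[OF assms(2)]]])
       (auto intro: continuous_intros)
  then show "continuous_on X ?D" by simp
  fix d assume "d \<in> A"
  then obtain V \<psi> where d: "d = (V, \<psi>)" "(V, \<psi>) \<in> A" by (cases d) auto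
  note V = plot_chart[OF d(2)]
  have "plot (\<psi> ` V) (\<lambda>u. ?D (inv_into V \<psi> u))"
  proof (rule plot_local)
    fix u assume u: "u \<in> \<psi> ` V"
    show "\<exists>T. u \<in> T \<and> T \<subseteq> \<psi> ` V \<and> plot T (\<lambda>u. ?D (inv_into V \<psi> u))"
    proof (cases "inv_into V \<psi> u \<in> U")
      case True
      let ?T = "{u \<in> \<psi> ` V. inv_into V \<psi> u \<in> U}"
      have T: "open ?T" by (rule plot_open_preimage[OF V chart_facts(1)[OF c]])
      have "smooth_on ?T (\<lambda>u. twist \<tau> m ((\<phi> \<circ> inv_into V \<psi>) u))"
        by (rule smooth_on_compose[OF T open_UNIV smooth_on_twist[OF assms(2)] plot_smooth[OF V c]]) auto
      then have "plot ?T (\<lambda>u. inv_into U \<phi> (twist \<tau> m ((\<phi> \<circ> inv_into V \<psi>) u)))"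
        by (rule plot_compose_smooth[OF plot_chart[OF c] T]) (use twist_chart_image(2)[OF assms(1)] in auto)
      then have "plot ?T (\<lambda>u. ?D (inv_into V \<psi> u))"
        by (rule plot_cong) (auto simp: chart_twist_def)
      then show ?thesis using u True by (intro exI[of _ ?T]) auto
    next
      case False
      let ?T = "{u \<in> \<psi> ` V. inv_into V \<psi> u \<in> X - ?K}"
      have "?K \<subseteq> U" using ball chart_inverse(3)[OF c] by blast
      then have "u \<in> ?T" using u False chart_inverse(3)[OF d(2) u] chart_facts(2)[OF d(2)] by auto
      moreover have "open ?T" by (rule plot_open_preimage[OF V openin_outside])
      then have "plot ?T (inv_into V \<psi>)" by (rule plot_restrict[OF V]) auto
      then have "plot ?T (\<lambda>u. ?D (inv_into V \<psi> u))"
        by (rule plot_cong) (use chart_twist_outside[OF assms(1)] in auto)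
      ultimately show ?thesis by (intro exI[of _ ?T]) auto
    qed
  qed
  then show "case d of (V, \<psi>) \<Rightarrow> plot (\<psi> ` V) (\<lambda>u. ?D (inv_into V \<psi> u))" using d by simp
qed

lemma diffeo_chart_twist:
  assumes "\<forall>s\<ge>r\<^sup>2. \<tau> s = 0" "smooth_on UNIV \<tau>" "smooth_on UNIV (\<lambda>s. - \<tau> s)"
  shows "diffeo X A (chart_twist (U, \<phi>) \<tau> m)"
proof (rule diffeoI)
  have z: "\<forall>s\<ge>r\<^sup>2. - \<tau> s = 0" using assms(1) by simp
  show "smooth_map X A (chart_twist (U, \<phi>) \<tau> m)"
    by (rule smooth_map_chart_twist[OF assms(1,2)])
  show "smooth_map X A (chart_twist (U, \<phi>) (\<lambda>s. - \<tau> s) m)"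
    by (rule smooth_map_chart_twist[OF z assms(3)])
  have *: "chart_twist (U, \<phi>) (\<lambda>s. - \<sigma> s) m (chart_twist (U, \<phi>) \<sigma> m x) = x"
    if "\<forall>s\<ge>r\<^sup>2. \<sigma> s = 0" for \<sigma> x
    using chart_twist_in[OF that, where x = x] twist_inverse[of \<sigma> m "\<phi> x"] chart_inverse(1)[OF c]
    by (auto simp: chart_twist_def)
  show "chart_twist (U, \<phi>) (\<lambda>s. - \<tau> s) m (chart_twist (U, \<phi>) \<tau> m x) = x"
    "chart_twist (U, \<phi>) \<tau> m (chart_twist (U, \<phi>) (\<lambda>s. - \<tau> s) m x) = x" for x
    using *[OF assms(1)] *[OF z] by simp_all
qed

lemma orientation_preserving_chart_twist:
  assumes "\<forall>s\<ge>r\<^sup>2. \<tau> s = 0" "smooth_on UNIV \<tau>"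
  shows "orientation_preserving X A (chart_twist (U, \<phi>) \<tau> m)"
proof (rule orientation_preservingI[OF smooth_map_chart_twist[OF assms]])
  let ?D = "chart_twist (U, \<phi>) \<tau> m" and ?K = "inv_into U \<phi> ` cball m r"
  fix x assume x: "x \<in> X"
  show "\<exists>U \<phi> V \<psi>. (U, \<phi>) \<in> A \<and> (V, \<psi>) \<in> A \<and> x \<in> U \<and> ?D x \<in> V \<and>
      jacobian (\<psi> \<circ> ?D \<circ> inv_into U \<phi>) (\<phi> x) > 0"
  proof (cases "x \<in> U")
    case True
    have "jacobian (twist \<tau> m) (\<phi> x) = jacobian (\<phi> \<circ> ?D \<circ> inv_into U \<phi>) (\<phi> x)"
      by (rule jacobian_cong[OF _ chart_facts(3)[OF c]])
         (use smooth_on_imp_differentiable[OF smooth_on_twist[OF assms(2)]] True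
           chart_twist_in(2)[OF assms(1)] chart_inverse[OF c] in auto)
    then show ?thesis
      using c True chart_twist_in(1)[OF assms(1) True] jacobian_twist[OF assms(2)]
      by (intro exI[of _ U] exI[of _ \<phi>]) simp
  next
    case False
    obtain V \<psi> where d: "(V, \<psi>) \<in> A" "x \<in> V" using chart_ex[OF x] by blast
    have K: "?K \<subseteq> U" using ball chart_inverse(3)[OF c] by blast
    \<comment> \<open>Off the chart, the point has a neighbourhood missing the disc, where the map
      is the identity.\<close>
    have "jacobian (\<lambda>u. u) (\<psi> x) = jacobian (\<psi> \<circ> ?D \<circ> inv_into V \<psi>) (\<psi> x)"
    proof (rule jacobian_cong)
      show "open {u \<in> \<psi> ` V. inv_into V \<psi> u \<in> X - ?K}"
        by (rule plot_open_preimage[OF plot_chart[OF d(1)] openin_outside])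
    qed (use chart_twist_outside[OF assms(1)] chart_inverse[OF d(1)] d x K False in auto)
    moreover have "?D x = x" using chart_twist_outside[OF assms(1), where x = x] K False by blast
    ultimately show ?thesis
      using d jacobian_id by (intro exI[of _ V] exI[of _ \<psi>]) simp
  qed
qed

end

text \<open>Only the end map of the homotopy has to be a diffeomorphism: this suffices to read off its action
  on the fundamental group.\<close>

definition pushes :: "(real \<Rightarrow> 'a) \<Rightarrow> (real \<times> 'a \<Rightarrow> 'a) \<Rightarrow> bool" where
  "pushes p H \<longleftrightarrow> continuous_on ({0..1} \<times> X) H \<and> H ` ({0..1} \<times> X) \<subseteq> X \<and> (\<forall>y\<in>X. H (0, y) = y) \<and>
     diffeo X A (\<lambda>y. H (1, y)) \<and> orientation_preserving X A (\<lambda>y. H (1, y)) \<and>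
     homotopic_paths X (\<lambda>t. H (t, pathstart p)) p"

lemma pushes_homotopic: "pushes p H \<Longrightarrow> homotopic_paths X p q \<Longrightarrow> pushes q H"
  unfolding pushes_def by (metis homotopic_paths_imp_pathstart homotopic_paths_trans)

text \<open>First \<open>H\<close>, then \<open>K\<close> applied to the result of \<open>H\<close>;
  the halves fit together because \<open>K\<close> starts at the identity. The point being pushed
  reaches the start of \<open>q\<close> halfway, so its track is the join of both tracks, and the
  end map is a product of two diffeomorphisms.\<close>

lemma pushes_join:
  assumes H: "pushes p H" and K: "pushes q K" and pq: "pathfinish p = pathstart q"
  shows "pushes (p +++ q) (\<lambda>(t, y). if t \<le> 1/2 then H (2 * t, y) else K (2 * t - 1, H (1, y)))"
    (is "pushes _ ?L")
proof -
  have Hc: "continuous_on ({0..1} \<times> X) H" "H ` ({0..1} \<times> X) \<subseteq> X" "\<And>y. y \<in> X \<Longrightarrow> H (0, y) = y"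
    "diffeo X A (\<lambda>y. H (1, y))" "orientation_preserving X A (\<lambda>y. H (1, y))"
    "homotopic_paths X (\<lambda>t. H (t, pathstart p)) p" using H unfolding pushes_def by auto
  have Kc: "continuous_on ({0..1} \<times> X) K" "K ` ({0..1} \<times> X) \<subseteq> X" "\<And>y. y \<in> X \<Longrightarrow> K (0, y) = y"
    "diffeo X A (\<lambda>y. K (1, y))" "orientation_preserving X A (\<lambda>y. K (1, y))"
    "homotopic_paths X (\<lambda>t. K (t, pathstart q)) q" using K unfolding pushes_def by auto
  have HX: "H (t, y) \<in> X" if "t \<in> {0..1}" "y \<in> X" for t y using Hc(2) that by blast
  have KX: "K (t, y) \<in> X" if "t \<in> {0..1}" "y \<in> X" for t y using Kc(2) that by blast
  have end1: "H (1, pathstart p) = pathstart q"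
    using homotopic_paths_imp_pathfinish[OF Hc(6)] pq by (simp add: pathfinish_def)
  have "homotopic_paths X ((\<lambda>t. H (t, pathstart p)) +++ (\<lambda>t. K (t, pathstart q))) (p +++ q)"
    using end1 by (intro homotopic_paths_join Hc(6) Kc(6))
      (use homotopic_paths_imp_pathstart[OF Kc(6)] in \<open>simp add: pathfinish_def\<close>)
  moreover have "(\<lambda>t. H (t, pathstart p)) +++ (\<lambda>t. K (t, pathstart q)) = (\<lambda>t. ?L (t, pathstart p))"
    using end1 by (auto simp: joinpaths_def)
  ultimately have "homotopic_paths X (\<lambda>t. ?L (t, pathstart p)) (p +++ q)" by simp
  moreover have "continuous_on ({0..1} \<times> X) (\<lambda>w. if fst w \<le> 1/2 then H (2 * fst w, snd w) else K (2 * fst w - 1, H (1, snd w)))"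
  proof (rule continuous_on_cases_le)
    show "continuous_on {w \<in> {0..1} \<times> X. fst w \<le> 1/2} (\<lambda>w. H (2 * fst w, snd w))"
      by (intro continuous_on_compose2[OF Hc(1)] continuous_intros) auto
    have "continuous_on {w \<in> {0..1} \<times> X. (1/2 :: real) \<le> fst w} (\<lambda>w. H (1, snd w))"
      by (intro continuous_on_compose2[OF Hc(1)] continuous_intros) auto
    then show "continuous_on {w \<in> {0..1} \<times> X. 1/2 \<le> fst w} (\<lambda>w. K (2 * fst w - 1, H (1, snd w)))"
      by (intro continuous_on_compose2[OF Kc(1)] continuous_intros) (use HX in auto)
    show "continuous_on ({0..1} \<times> X) fst" by (intro continuous_intros)
    show "H (2 * fst w, snd w) = K (2 * fst w - 1, H (1, snd w))"
      if "w \<in> {0..1} \<times> X" "fst w = 1/2" for w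
    proof -
      have e: "2 * fst w = 1" using that(2) by simp
      show ?thesis
        unfolding e using that(1) Kc(3)[OF HX[of 1 "snd w"]] by auto
    qed
  qed
  then have "continuous_on ({0..1} \<times> X) ?L" by (simp add: case_prod_unfold)
  moreover have "?L ` ({0..1} \<times> X) \<subseteq> X" using HX KX by (auto split: if_splits)
  moreover have "diffeo X A (\<lambda>y. ?L (1, y))" "orientation_preserving X A (\<lambda>y. ?L (1, y))"
    using diffeo_compose[OF Kc(4) Hc(4)] orientation_preserving_compose[OF _ _ Kc(5) Hc(5)] Hc(4) Kc(4)
    by (auto simp: o_def diffeo_def)
  ultimately show ?thesis
    unfolding pushes_def using Hc(3) homotopic_paths_imp_pathstart by auto
qed

text \<open>For a path near \<open>x\<close> only its ends matter: in a chart, a half turn about the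
  midpoint of the ends, cut off away from it, carries one end to the other, and its track is
  homotopic to the path since both run in a convex ball.\<close>

lemma local_push:
  assumes "x \<in> X"
  obtains B where "openin (top_of_set X) B" "x \<in> B"
    "\<And>p. path p \<Longrightarrow> path_image p \<subseteq> B \<Longrightarrow> \<exists>H. pushes p H"
proof -
  obtain U \<phi> where c: "(U, \<phi>) \<in> A" "x \<in> U" using chart_ex[OF assms] by blast
  note inv = chart_inverse[OF c(1)] and ch = chart_facts[OF c(1)]
  obtain e where e: "e > 0" "ball (\<phi> x) e \<subseteq> \<phi> ` U"
    using ch(3) c(2) open_contains_ball by blast
  \<comment> \<open>Both ends will lie within \<open>r\<close> of \<open>\<phi> x\<close>. Then so
    does their midpoint \<open>m\<close>, the disc of radius \<open>r\<close> about \<open>m\<close>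
    stays in the ball of radius \<open>e\<close>, and each end is closer to \<open>m\<close> than
    \<open>r\<close>.\<close>
  define r where "r = e / 2"
  define B where "B = U \<inter> \<phi> -` ball (\<phi> x) r"
  have r: "r > 0" using e by (simp add: r_def)
  have oB: "openin (top_of_set X) B"
  proof -
    have "openin (top_of_set U) B"
      unfolding B_def by (rule continuous_openin_preimage_gen[OF ch(4)]) simp
    then show ?thesis using ch(1) openin_trans by blast
  qed
  have "\<exists>H. pushes p H" if p: "path p" "path_image p \<subseteq> B" for p
  proof -
    have pB: "p t \<in> U" "\<phi> (p t) \<in> ball (\<phi> x) r" if "t \<in> {0..1}" for t
    proof -
      have "p t \<in> B" using p(2) that by (auto simp: path_image_def)
      then show "p t \<in> U" "\<phi> (p t) \<in> ball (\<phi> x) r" by (simp_all add: B_def)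
    qed
    define u v where "u = \<phi> (p 0)" and "v = \<phi> (p 1)"
    define m where "m = midpoint u v"
    have uv: "u \<in> ball (\<phi> x) r" "v \<in> ball (\<phi> x) r" using pB[of 0] pB[of 1] by (auto simp: u_def v_def)
    have m: "m \<in> ball (\<phi> x) r"
      unfolding m_def using uv convex_ball[of "\<phi> x" r] by (metis closed_segment_subset midpoint_in_closed_segment subsetD)
    have um: "norm (u - m) < r"
    proof -
      have "norm (u - m) = dist u v / 2"
        by (metis dist_midpoint(1) dist_norm m_def)
      moreover have "dist u v < 2 * r"
        using uv dist_triangle_less_add[of u "\<phi> x" r v r] by (simp add: dist_commute)
      ultimately show ?thesis by simp
    qed
    have mb: "cball m r \<subseteq> ball (\<phi> x) e"
    proof
      fix y assume "y \<in> cball m r"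
      then show "y \<in> ball (\<phi> x) e"
        using m dist_triangle[of "\<phi> x" y m] by (simp add: r_def)
    qed
    then have mU: "cball m r \<subseteq> \<phi> ` U" using e by blast
    define s0 where "s0 = (u - m) \<bullet> (u - m)"
    have s0: "s0 < r\<^sup>2"
      unfolding s0_def using um r by (metis norm_ge_zero power2_norm_eq_inner power_strict_mono zero_less_numeral)
    define \<tau> where "\<tau> = bump_angle (r\<^sup>2) s0"
    have z: "\<forall>s\<ge>r\<^sup>2. t * \<tau> s = 0" for t by (simp add: \<tau>_def bump_angle_simps)
    have z1: "\<forall>s\<ge>r\<^sup>2. \<tau> s = 0" by (simp add: \<tau>_def bump_angle_simps)
    have sm: "smooth_on UNIV (\<lambda>s. t * \<tau> s)" for t unfolding \<tau>_def by (rule smooth_on_bump_angle)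
    have cont: "continuous_on UNIV \<tau>" using smooth_on_imp_continuous_on[OF sm[of 1]] by simp
    define H where "H = (\<lambda>(t :: real, y). chart_twist (U, \<phi>) (\<lambda>s. t * \<tau> s) m y)"
    have H: "H (t, y) \<in> X" if "y \<in> X" for t y
      using chart_twist_in(3)[OF c(1) mU r z that] by (simp add: H_def)
    \<comment> \<open>The track of the first end in coordinates. Its angle is t times pi, so this is
      a half circle about \<open>m\<close> from \<open>u\<close> to \<open>v\<close>.\<close>
    define w where "w = (\<lambda>t :: real. twist (\<lambda>s. t * \<tau> s) m u)"
    have w: "H (t, p 0) = inv_into U \<phi> (w t)" for t
      using pB(1)[of 0] by (simp add: H_def chart_twist_def w_def u_def)
    have wball: "w t \<in> ball (\<phi> x) e" for t
    proof -
      have "w t \<in> cball m r"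
        using twist_norm[of "\<lambda>s. t * \<tau> s" m u] um by (simp add: w_def dist_norm norm_minus_commute)
      then show ?thesis using mb by blast
    qed
    have wpath: "path w"
    proof -
      have "continuous_on {0..1} w"
        unfolding w_def twist_def by (intro continuous_intros)
      then show ?thesis by (simp add: path_def)
    qed
    have w0: "w 0 = u" by (simp add: w_def twist_fixed)
    have w1: "w 1 = v"
    proof -
      have "\<tau> s0 = pi" using s0 by (simp add: \<tau>_def bump_angle_simps)
      then have "w 1 = m - (u - m)" by (simp add: w_def twist_def s0_def)
      also have "\<dots> = v" by (simp add: m_def midpoint_def scaleR_2 algebra_simps flip: scaleR_add_left)
      finally show ?thesis .
    qed
    have pe: "\<phi> (p t) \<in> ball (\<phi> x) e" if "t \<in> {0..1}" for t
      using pB(2)[OF that] e(1) by (simp add: r_def)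
    have "path (\<phi> \<circ> p)"
      using p pB(1) ch(4) unfolding path_def
      by (intro continuous_on_compose) (auto intro: continuous_on_subset)
    \<comment> \<open>The straight-line homotopy in the convex ball.\<close>
    then have "homotopic_paths (ball (\<phi> x) e) w (\<phi> \<circ> p)"
      using wball pe
      by (intro homotopic_paths_linear wpath closed_segment_subset convex_ball)
         (auto simp: pathstart_def pathfinish_def w0 w1 u_def v_def)
    then have "homotopic_paths X (inv_into U \<phi> \<circ> w) (inv_into U \<phi> \<circ> (\<phi> \<circ> p))"
      by (rule homotopic_paths_continuous_image[OF _ continuous_on_subset[OF ch(5) e(2)]])
         (use e(2) inv(3) ch(2) in blast)
    moreover have "homotopic_paths X p (inv_into U \<phi> \<circ> (\<phi> \<circ> p))"
      using p ch(2) pB(1) inv(1) by (intro homotopic_paths_eq) (auto simp: B_def)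
    ultimately have "homotopic_paths X (inv_into U \<phi> \<circ> w) p"
      using homotopic_paths_trans homotopic_paths_sym by blast
    moreover have "(\<lambda>t. H (t, pathstart p)) = inv_into U \<phi> \<circ> w"
      using w by (auto simp: pathstart_def)
    ultimately have hom: "homotopic_paths X (\<lambda>t. H (t, pathstart p)) p" by simp
    have "continuous_on ({0..1} \<times> X) H"
      using continuous_chart_twist[OF c(1) mU r z1 cont] unfolding H_def by (rule continuous_on_subset) auto
    moreover have "H (0, y) = y" if "y \<in> X" for y
      using chart_inverse(1)[OF c(1)] by (simp add: H_def chart_twist_def twist_fixed)
    moreover have "diffeo X A (\<lambda>y. H (1, y))"
      using diffeo_chart_twist[OF c(1) mU r z1 _ sm[of "- 1", simplified]] sm[of 1] by (simp add: H_def)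
    moreover have "orientation_preserving X A (\<lambda>y. H (1, y))"
      using orientation_preserving_chart_twist[OF c(1) mU r z1] sm[of 1] by (simp add: H_def)
    ultimately show ?thesis
      unfolding pushes_def using hom H by (intro exI[of _ H]) auto
  qed
  moreover have "x \<in> B" using c r by (simp add: B_def)
  ultimately show ?thesis using that oB by blast
qed

text \<open>Being pushable is additive under concatenation and holds for short pieces by
  \<open>local_push\<close>, so a bisection argument on the parameter interval gives it for the
  whole path. Pieces are formed as \<open>p\<close> after a subpath of the interval: homotopies
  between joined pieces are found in the interval and carried over by \<open>p\<close>.\<close>

lemma push_along_path:
  assumes p: "path p" "path_image p \<subseteq> X"
  shows "\<exists>H. pushes p H"
proof -
  define sub where "sub a b = p \<circ> subpath a b id" for a b :: real
  have cp: "continuous_on {0..1} p" "p ` {0..1} \<subseteq> X" using p by (auto simp: path_def path_image_def)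
  have idp: "path (id :: real \<Rightarrow> real)" "path_image (id :: real \<Rightarrow> real) \<subseteq> {0..1}"
    by (auto simp: path_def path_image_def id_def)
  have sub01: "sub 0 1 = p" by (simp add: sub_def)
  \<comment> \<open>The bisection principle also asks about small intervals around 0 or 1 that stick
    out of [0,1]; the premise makes the claim vacuous for those.\<close>
  let ?P = "\<lambda>a b. 0 \<le> a \<and> b \<le> 1 \<longrightarrow> (\<exists>H. pushes (sub a b) H)"
  have "?P 0 1"
  proof (rule Bolzano[where P = ?P])
    fix a b d :: real
    assume trans: "?P a b" "?P b d" "a \<le> b" "b \<le> d"
    show "?P a d"
    proof (intro impI)
      assume ad: "0 \<le> a \<and> d \<le> 1"
      then obtain H K where HK: "pushes (sub a b) H" "pushes (sub b d) K"
        using trans by auto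
      have "pathfinish (sub a b) = pathstart (sub b d)"
        by (simp add: sub_def pathfinish_compose pathstart_compose)
      then have "\<exists>L. pushes (sub a b +++ sub b d) L"
        using pushes_join[OF HK] by blast
      moreover have "homotopic_paths {0..1} (subpath a b id +++ subpath b d id) (subpath a d id)"
        using ad trans by (intro homotopic_join_subpaths1 idp) auto
      then have "homotopic_paths X (p \<circ> (subpath a b id +++ subpath b d id)) (p \<circ> subpath a d id)"
        by (rule homotopic_paths_continuous_image[OF _ cp(1)]) (use cp(2) in auto)
      then have "homotopic_paths X (sub a b +++ sub b d) (sub a d)"
        by (simp add: sub_def path_compose_join)
      ultimately show "\<exists>H. pushes (sub a d) H" using pushes_homotopic by blast
    qed
  next
    fix x :: real
    assume local: "0 \<le> x" "x \<le> 1"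
    then have "p x \<in> X" using cp(2) by auto
    then obtain B where B: "openin (top_of_set X) B" "p x \<in> B"
      "\<And>q. path q \<Longrightarrow> path_image q \<subseteq> B \<Longrightarrow> \<exists>H. pushes q H"
      using local_push by blast
    have "openin (top_of_set {0..1}) ({0..1} \<inter> p -` B)"
      using cp by (intro continuous_openin_preimage[OF _ _ B(1)]) auto
    moreover have "x \<in> {0..1} \<inter> p -` B" using local B(2) by auto
    ultimately obtain d where d: "d > 0" "\<And>y. y \<in> {0..1} \<Longrightarrow> dist y x < d \<Longrightarrow> p y \<in> B"
      unfolding openin_euclidean_subtopology_iff by (metis IntD2 vimageE)
    have "\<exists>H. pushes (sub a b) H" if ab: "a \<le> x" "x \<le> b" "b - a < d" "0 \<le> a" "b \<le> 1" for a b
    proof (rule B(3))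
      have im: "path_image (subpath a b id) = {a..b}"
        using ab by (simp add: path_image_subpath_gen closed_segment_eq_real_ivl)
      show "path (sub a b)"
        unfolding sub_def
        by (rule path_continuous_image[OF path_subpath[OF idp(1)] continuous_on_subset[OF cp(1)]])
           (use ab im in auto)
      have "p y \<in> B" if "y \<in> {a..b}" for y
        using d(2)[of y] that ab by (auto simp: dist_real_def)
      then show "path_image (sub a b) \<subseteq> B"
        using im by (auto simp: sub_def path_image_compose)
    qed
    then show "\<exists>d>0. \<forall>a b. a \<le> x \<and> x \<le> b \<and> b - a < d \<longrightarrow> ?P a b" using d(1) by blast
  qed simp
  then show ?thesis by (simp add: sub01)
qed

end

section \<open>The fundamental group\<close>

text \<open>Two parameter changes with the same ends are joined by a straight line in [0,1], and
  \<open>p\<close> carries this homotopy into \<open>X\<close>. Convexity is used in the interval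
  only, so \<open>X\<close> may be any topological space.\<close>

lemma homotopic_paths_reparam:
  fixes p :: "real \<Rightarrow> 'a::topological_space"
  assumes p: "path p" "path_image p \<subseteq> X"
    and f: "path f" "path_image f \<subseteq> {0..1}" and g: "path g" "path_image g \<subseteq> {0..1}"
    and e: "pathstart f = pathstart g" "pathfinish f = pathfinish g"
  shows "homotopic_paths X (p \<circ> f) (p \<circ> g)"
proof -
  have "homotopic_paths {0..1} f g"
    using f g e
    by (intro homotopic_paths_linear closed_segment_subset convex_real_interval)
       (simp_all add: path_image_def image_subset_iff)
  then show ?thesis
    by (rule homotopic_paths_continuous_image) (use p in \<open>auto simp: path_def path_image_def\<close>)
qed

text \<open>Each left-hand side is \<open>p\<close> after a path in the interval: the identity
  followed by the constant 1, the constant 0 followed by the identity, the identity followed by its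
  reverse.\<close>

lemma
  assumes "path p" "path_image p \<subseteq> X"
  shows homotopic_paths_const_right: "homotopic_paths X (p +++ (\<lambda>_. pathfinish p)) p"
    and homotopic_paths_const_left: "homotopic_paths X ((\<lambda>_. pathstart p) +++ p) p"
    and homotopic_paths_reverse_right: "homotopic_paths X (p +++ reversepath p) (\<lambda>_. pathstart p)"
proof -
  have i: "path (id :: real \<Rightarrow> real)" "path_image (id :: real \<Rightarrow> real) = {0..1}"
    "pathstart (id :: real \<Rightarrow> real) = 0" "pathfinish (id :: real \<Rightarrow> real) = 1"
    by (auto simp: path_def path_image_def pathstart_def pathfinish_def id_def)
  have k: "path (\<lambda>_::real. c)" "path_image (\<lambda>_. c) = {c}" "pathstart (\<lambda>_. c) = c" "pathfinish (\<lambda>_. c) = c"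
    for c :: real
    by (auto simp: path_def path_image_def pathstart_def pathfinish_def)
  have r: "path (reversepath (id :: real \<Rightarrow> real))" "path_image (reversepath (id :: real \<Rightarrow> real)) = {0..1}"
    "pathstart (reversepath (id :: real \<Rightarrow> real)) = 1" "pathfinish (reversepath (id :: real \<Rightarrow> real)) = 0"
    using i by auto
  have "homotopic_paths X (p \<circ> (id +++ (\<lambda>_. 1))) (p \<circ> id)"
    using i k by (intro homotopic_paths_reparam[OF assms]) (auto simp: path_image_join)
  then show "homotopic_paths X (p +++ (\<lambda>_. pathfinish p)) p"
    unfolding path_compose_join by (simp add: o_def pathfinish_def)
  have "homotopic_paths X (p \<circ> ((\<lambda>_. 0) +++ id)) (p \<circ> id)"
    using i k by (intro homotopic_paths_reparam[OF assms]) (auto simp: path_image_join)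
  then show "homotopic_paths X ((\<lambda>_. pathstart p) +++ p) p"
    unfolding path_compose_join by (simp add: o_def pathstart_def)
  have "homotopic_paths X (p \<circ> (id +++ reversepath id)) (p \<circ> (\<lambda>_. 0))"
    using i k r by (intro homotopic_paths_reparam[OF assms]) (auto simp: path_image_join)
  then show "homotopic_paths X (p +++ reversepath p) (\<lambda>_. pathstart p)"
    unfolding path_compose_join path_compose_reversepath by (simp add: o_def pathstart_def)
qed

lemma homotopic_paths_reverse_left:
  assumes "path p" "path_image p \<subseteq> X"
  shows "homotopic_paths X (reversepath p +++ p) (\<lambda>_. pathfinish p)"
  using homotopic_paths_reverse_right[of "reversepath p" X] assms by simp

section \<open>Loops and the fundamental group\<close>

lemma loopsD:
  assumes "p \<in> loops X star"
  shows "path p" "path_image p \<subseteq> X" "pathstart p = star" "pathfinish p = star"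
  using assms by (auto simp: loops_def)

lemma loops_in: "p \<in> loops X star \<Longrightarrow> t \<in> {0..1} \<Longrightarrow> p t \<in> X"
  by (auto simp: loops_def path_image_def)

lemma loops_join: "p \<in> loops X star \<Longrightarrow> q \<in> loops X star \<Longrightarrow> p +++ q \<in> loops X star"
  by (simp add: loops_def subset_path_image_join)

lemma loops_reverse: "p \<in> loops X star \<Longrightarrow> reversepath p \<in> loops X star"
  by (simp add: loops_def)

lemma loops_const: "star \<in> X \<Longrightarrow> (\<lambda>_. star) \<in> loops X star"
  by (auto simp: loops_def path_def path_image_def pathstart_def pathfinish_def)

lemma loops_homotopic: "p \<in> loops X star \<Longrightarrow> homotopic_paths X p q \<Longrightarrow> q \<in> loops X star"
  using homotopic_paths_imp_path[of X p q] homotopic_paths_imp_subset[of X p q]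
    homotopic_paths_imp_pathstart[of X p q] homotopic_paths_imp_pathfinish[of X p q]
  by (auto simp: loops_def)

lemma loop_class_eqI: "homotopic_paths X p q \<Longrightarrow> loop_class X p = loop_class X q"
  unfolding loop_class_def using homotopic_paths_trans homotopic_paths_sym by blast

text \<open>A loop lies in its own class; for a function that is not a path in \<open>X\<close> the
  class is empty, and equality of classes would say nothing.\<close>

lemma loop_class_eqD: "p \<in> loops X star \<Longrightarrow> loop_class X p = loop_class X q \<Longrightarrow> homotopic_paths X p q"
proof -
  assume "p \<in> loops X star" "loop_class X p = loop_class X q"
  moreover have "p \<in> loop_class X p" using calculation(1) by (simp add: loop_class_def loops_def)
  ultimately show ?thesis by (simp add: loop_class_def homotopic_paths_sym)
qed

text \<open>The unions in \<open>fundamental_group\<close> and \<open>pushforward\<close> stand for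
  a common value over all representatives; this lemma evaluates them. The loop \<open>p\<close>
  ensures that there is a representative.\<close>

lemma UN_loop_class:
  assumes "p \<in> loops X star" "\<And>q. homotopic_paths X p q \<Longrightarrow> h q = c"
  shows "(\<Union>q\<in>loop_class X p. h q) = c"
proof -
  have "p \<in> loop_class X p" using assms(1) by (simp add: loop_class_def loops_def)
  moreover have "h q = c" if "q \<in> loop_class X p" for q
    using that assms(2) by (simp add: loop_class_def)
  ultimately show ?thesis by blast
qed

lemma fundamental_group_mult:
  assumes "p \<in> loops X star" "q \<in> loops X star"
  shows "loop_class X p \<otimes>\<^bsub>fundamental_group X star\<^esub> loop_class X q = loop_class X (p +++ q)"
proof -
  have "(\<Union>p'\<in>loop_class X p. \<Union>q'\<in>loop_class X q. loop_class X (p' +++ q')) = loop_class X (p +++ q)"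
  proof (rule UN_loop_class[OF assms(1)], rule UN_loop_class[OF assms(2)])
    fix p' q' assume "homotopic_paths X p p'" "homotopic_paths X q q'"
    then show "loop_class X (p' +++ q') = loop_class X (p +++ q)"
      using assms by (intro loop_class_eqI[symmetric] homotopic_paths_join) (auto simp: loops_def)
  qed
  then show ?thesis by (simp add: fundamental_group_def)
qed

lemma fundamental_group_carrier: "carrier (fundamental_group X star) = loop_class X ` loops X star"
  and fundamental_group_one: "\<one>\<^bsub>fundamental_group X star\<^esub> = loop_class X (\<lambda>_. star)"
  by (simp_all add: fundamental_group_def)

lemma group_fundamental_group:
  assumes "star \<in> X" shows "group (fundamental_group X star)"
proof (rule groupI, unfold fundamental_group_carrier fundamental_group_one)
  fix P Q R assume "P \<in> loop_class X ` loops X star" "Q \<in> loop_class X ` loops X star"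
    "R \<in> loop_class X ` loops X star"
  then obtain p q r where P: "p \<in> loops X star" "P = loop_class X p" and Q: "q \<in> loops X star" "Q = loop_class X q"
    and R: "r \<in> loops X star" "R = loop_class X r" by blast
  have "loop_class X ((p +++ q) +++ r) = loop_class X (p +++ (q +++ r))"
    using P Q R by (intro loop_class_eqI[symmetric] homotopic_paths_assoc) (auto simp: loops_def)
  then show "P \<otimes>\<^bsub>fundamental_group X star\<^esub> Q \<otimes>\<^bsub>fundamental_group X star\<^esub> R
      = P \<otimes>\<^bsub>fundamental_group X star\<^esub> (Q \<otimes>\<^bsub>fundamental_group X star\<^esub> R)"
    using P Q R by (simp add: fundamental_group_mult loops_join)
next
  fix P assume "P \<in> loop_class X ` loops X star"
  then obtain p where P: "p \<in> loops X star" "P = loop_class X p" by blast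
  note p = loopsD[OF P(1)]
  show "loop_class X (\<lambda>_. star) \<otimes>\<^bsub>fundamental_group X star\<^esub> P = P"
    using homotopic_paths_const_left[OF p(1,2)] p(3)
    by (simp add: P fundamental_group_mult[OF loops_const[OF assms] P(1)] loop_class_eqI)
  have "loop_class X (reversepath p) \<otimes>\<^bsub>fundamental_group X star\<^esub> P = loop_class X (\<lambda>_. star)"
    using homotopic_paths_reverse_left[OF p(1,2)] p(4)
    by (simp add: P fundamental_group_mult[OF loops_reverse[OF P(1)] P(1)] loop_class_eqI)
  then show "\<exists>Q\<in>loop_class X ` loops X star. Q \<otimes>\<^bsub>fundamental_group X star\<^esub> P = loop_class X (\<lambda>_. star)"
    using loops_reverse[OF P(1)] by blast
next
  fix P Q assume "P \<in> loop_class X ` loops X star" "Q \<in> loop_class X ` loops X star"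
  then show "P \<otimes>\<^bsub>fundamental_group X star\<^esub> Q \<in> loop_class X ` loops X star"
    by (auto simp: fundamental_group_mult loops_join)
qed (use loops_const[OF assms] in blast)

lemma fundamental_group_inv:
  assumes "star \<in> X" "p \<in> loops X star"
  shows "inv\<^bsub>fundamental_group X star\<^esub> (loop_class X p) = loop_class X (reversepath p)"
proof (rule group.inv_equality[OF group_fundamental_group[OF assms(1)]])
  note p = loopsD[OF assms(2)]
  show "loop_class X (reversepath p) \<otimes>\<^bsub>fundamental_group X star\<^esub> loop_class X p = \<one>\<^bsub>fundamental_group X star\<^esub>"
    using homotopic_paths_reverse_left[OF p(1,2)] p(4)
    by (simp add: fundamental_group_mult[OF loops_reverse[OF assms(2)] assms(2)] loop_class_eqI fundamental_group_one)
qed (use assms loops_reverse in \<open>auto simp: fundamental_group_carrier\<close>)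

lemma pushforward_loop_class:
  assumes "p \<in> loops X star" "continuous_on X f" "f ` X \<subseteq> X"
  shows "pushforward X star f (loop_class X p) = loop_class X (f \<circ> p)"
proof -
  have "(\<Union>q\<in>loop_class X p. loop_class X (f \<circ> q)) = loop_class X (f \<circ> p)"
  proof (rule UN_loop_class[OF assms(1)])
    fix q assume "homotopic_paths X p q"
    then show "loop_class X (f \<circ> q) = loop_class X (f \<circ> p)"
      using assms(2,3) by (intro loop_class_eqI[symmetric] homotopic_paths_continuous_image) auto
  qed
  then show ?thesis
    using assms(1) by (simp add: pushforward_def fundamental_group_carrier)
qed

lemma loops_image:
  assumes "p \<in> loops X star" "continuous_on X f" "f ` X \<subseteq> X" "f star = star"
  shows "f \<circ> p \<in> loops X star"
  using assms unfolding loops_def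
  by (auto simp: path_image_compose pathstart_compose pathfinish_compose intro: path_continuous_image continuous_on_subset)

text \<open>Both sides are boundary paths of the image of the square \<open>[0,1]\<^sup>2\<close> under \<open>(t, s) \<mapsto> H (t, q s)\<close>.\<close>

lemma homotopy_conjugates:
  fixes H :: "real \<times> 'a::topological_space \<Rightarrow> 'a"
  assumes H: "continuous_on ({0..1} \<times> X) H" "H ` ({0..1} \<times> X) \<subseteq> X" "\<And>y. y \<in> X \<Longrightarrow> H (0, y) = y"
    and q: "q \<in> loops X star"
  shows "homotopic_paths X q
    ((\<lambda>t. H (t, star)) +++ ((\<lambda>s. H (1, q s)) +++ reversepath (\<lambda>t. H (t, star))))"
proof -
  note qq = loopsD[OF q]
  define K where "K = (\<lambda>w. H (fst w, q (snd w)))"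
  let ?S = "{0..1} \<times> {0..1} :: (real \<times> real) set"
  have qX: "q s \<in> X" if "s \<in> {0..1}" for s using qq(2) that by (auto simp: path_image_def)
  have "continuous_on {0..1} q" using qq(1) by (simp add: path_def)
  then have "continuous_on ?S (\<lambda>w. q (snd w))"
    by (rule continuous_on_compose2) (auto intro: continuous_intros)
  then have K: "continuous_on ?S K"
    unfolding K_def by (intro continuous_on_compose2[OF H(1)] continuous_intros) (use qX in auto)
  have KX: "K \<in> ?S \<rightarrow> X" using H(2) qX by (force simp: K_def)
  define l b r where "l = (\<lambda>t::real. (t, 0::real))" and "b = (\<lambda>s::real. (1::real, s))"
    and "r = (\<lambda>t::real. (t, 1::real))"
  have lbr: "path l" "path b" "path r" "path_image l \<subseteq> ?S" "path_image b \<subseteq> ?S" "path_image r \<subseteq> ?S"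
    "pathstart l = (0, 0)" "pathfinish l = (1, 0)" "pathstart b = (1, 0)" "pathfinish b = (1, 1)"
    "pathstart r = (0, 1)" "pathfinish r = (1, 1)"
    by (auto simp: l_def b_def r_def path_def path_image_def pathstart_def pathfinish_def intro!: continuous_intros)
  define j where "j = l +++ (b +++ reversepath r)"
  have j: "path j" "path_image j \<subseteq> ?S" "pathstart j = (0, 0)" "pathfinish j = (0, 1)"
    using lbr by (auto simp: j_def path_image_join)
  define a where "a = (\<lambda>s::real. (0::real, s))"
  have a: "path a" "path_image a \<subseteq> ?S" "pathstart a = (0, 0)" "pathfinish a = (0, 1)"
    by (auto simp: a_def path_def path_image_def pathstart_def pathfinish_def intro!: continuous_intros)
  have "homotopic_paths ?S a j"
    using a j by (intro homotopic_paths_linear closed_segment_subset convex_Times convex_real_interval)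
      (auto simp: path_image_def)
  then have "homotopic_paths X (K \<circ> a) (K \<circ> j)"
    by (rule homotopic_paths_continuous_image[OF _ K KX])
  moreover have "homotopic_paths X q (K \<circ> a)"
    using qq qX by (intro homotopic_paths_eq) (auto simp: K_def a_def H(3))
  moreover have "K \<circ> j = (K \<circ> l) +++ ((K \<circ> b) +++ reversepath (K \<circ> r))"
    by (simp add: j_def path_compose_join path_compose_reversepath)
  moreover have "K \<circ> l = (\<lambda>t. H (t, star))" "K \<circ> b = (\<lambda>s. H (1, q s))" "K \<circ> r = (\<lambda>t. H (t, star))"
    using qq(3,4) by (auto simp: K_def l_def b_def r_def pathstart_def pathfinish_def)
  ultimately show ?thesis using homotopic_paths_trans by metis
qed

section \<open>Conjugation and its effect on the abelianization\<close>

text \<open>Restricted to the carrier because \<open>mapping_class_action\<close> takes extensional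
  functions as values, to be compared with inner automorphisms by equality.\<close>

definition conj_by :: "('g, 'b) monoid_scheme \<Rightarrow> 'g \<Rightarrow> 'g \<Rightarrow> 'g" where
  "conj_by G a = (\<lambda>x\<in>carrier G. a \<otimes>\<^bsub>G\<^esub> x \<otimes>\<^bsub>G\<^esub> inv\<^bsub>G\<^esub> a)"

context group
begin

lemma conj_by_closed: "a \<in> carrier G \<Longrightarrow> x \<in> carrier G \<Longrightarrow> conj_by G a x \<in> carrier G"
  by (simp add: conj_by_def)

lemma conj_by_mult:
  assumes "a \<in> carrier G" "b \<in> carrier G" "x \<in> carrier G"
  shows "conj_by G (a \<otimes> b) x = conj_by G a (conj_by G b x)"
  using assms by (simp add: conj_by_def inv_mult_group m_assoc)

lemma conj_by_one: "x \<in> carrier G \<Longrightarrow> conj_by G \<one> x = x"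
  by (simp add: conj_by_def)

lemma conj_by_inv:
  assumes "a \<in> carrier G" "x \<in> carrier G"
  shows "conj_by G a (conj_by G (inv a) x) = x" "conj_by G (inv a) (conj_by G a x) = x"
  using conj_by_mult[of a "inv a" x] conj_by_mult[of "inv a" a x] assms by (simp_all add: conj_by_one)

lemma conj_by_auto:
  assumes a: "a \<in> carrier G" shows "conj_by G a \<in> auto G"
proof -
  have "conj_by G a (x \<otimes> y) = conj_by G a x \<otimes> conj_by G a y" if xy: "x \<in> carrier G" "y \<in> carrier G" for x y
  proof -
    have "a \<otimes> x \<otimes> inv a \<otimes> (a \<otimes> y \<otimes> inv a) = a \<otimes> x \<otimes> (inv a \<otimes> a) \<otimes> y \<otimes> inv a"
      using a xy by (simp only: m_assoc m_closed inv_closed)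
    also have "\<dots> = a \<otimes> (x \<otimes> y) \<otimes> inv a"
      using a xy by (simp add: m_assoc)
    finally show ?thesis using xy by (simp add: conj_by_def)
  qed
  then have "conj_by G a \<in> hom G G"
    using a by (auto simp: hom_def conj_by_closed)
  moreover have "bij_betw (conj_by G a) (carrier G) (carrier G)"
    by (rule bij_betw_byWitness[where f' = "conj_by G (inv a)"])
       (use a conj_by_inv conj_by_closed in auto)
  ultimately show ?thesis
    by (auto simp: auto_def Bij_def conj_by_def)
qed

text \<open>Conjugation multiplies x by the commutator k x k^-1 x^-1, so it moves x within its coset
  of the derived subgroup. Applying this to the inverse of k as well gives equality.\<close>

lemma conj_by_coset_derived:
  assumes k: "k \<in> carrier G" and D: "D \<in> carrier (G Mod derived G (carrier G))"
  shows "conj_by G k ` D = D"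
proof -
  interpret N: normal "derived G (carrier G)" G by (rule derived_self_is_normal)
  obtain y where y: "y \<in> carrier G" "D = derived G (carrier G) #> y"
    using D by (auto simp: carrier_FactGroup)
  have DG: "D \<subseteq> carrier G" using y N.subset r_coset_subset_G by blast
  have in_D: "conj_by G k x \<in> D" if "k \<in> carrier G" "x \<in> D" for k x
  proof -
    have x: "x \<in> carrier G" using that DG by blast
    have "k \<otimes> x \<otimes> inv k \<otimes> inv x \<in> derived G (carrier G)"
      unfolding derived_def using that x by (intro generate.incl) auto
    moreover have "conj_by G k x = (k \<otimes> x \<otimes> inv k \<otimes> inv x) \<otimes> x"
      using that x by (simp add: conj_by_def m_assoc)
    ultimately have "conj_by G k x \<in> derived G (carrier G) #> x"
      by (auto simp: r_coset_def)
    then show ?thesis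
      using repr_independence[of x "derived G (carrier G)" y] y that N.subgroup_axioms by simp
  qed
  moreover have "x \<in> conj_by G k ` D" if "x \<in> D" for x
    using in_D[OF inv_closed[OF k] that] conj_by_inv(1)[OF k, of x] DG that
    by (metis imageI subsetD)
  ultimately show ?thesis using k by blast
qed

end

lemma finite_image_factor:
  assumes "finite (h ` S)" "\<And>x y. x \<in> S \<Longrightarrow> y \<in> S \<Longrightarrow> h x = h y \<Longrightarrow> f x = f y"
  shows "finite (f ` S)"
proof -
  have "f x = f (SOME y. y \<in> S \<and> h y = h x)" if x: "x \<in> S" for x
  proof -
    have "(SOME y. y \<in> S \<and> h y = h x) \<in> S \<and> h (SOME y. y \<in> S \<and> h y = h x) = h x"
      by (rule someI[of _ x]) (simp add: x)
    then show ?thesis by (intro assms(2)[OF x]) auto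
  qed
  then have "f ` S \<subseteq> (\<lambda>c. f (SOME y. y \<in> S \<and> h y = c)) ` h ` S" by auto
  then show ?thesis using assms(1) finite_subset by blast
qed

lemma finite_inner_on_H1:
  fixes G (structure)
  assumes G: "group G" and K: "characteristic_subgroup K G" "finite_index K G"
  shows "finite ((\<lambda>a. H1_map (G\<lparr>carrier := K\<rparr>) (restrict (conj_by G a) K)) ` carrier G)"
proof (rule finite_image_factor[where h = "\<lambda>a. K #>\<^bsub>G\<^esub> a"])
  interpret group G by fact
  have sub: "subgroup K G" using K(1) by (simp add: characteristic_subgroup_def)
  interpret K: subgroup K G by fact
  let ?K = "G\<lparr>carrier := K\<rparr>"
  interpret KG: group ?K by (rule K.subgroup_is_group[OF G])
  have conjK: "conj_by G a ` K = K" if "a \<in> carrier G" for a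
    using K(1) conj_by_auto[OF that] by (simp add: characteristic_subgroup_def)
  show "finite ((\<lambda>a. K #> a) ` carrier G)"
    using K(2) by (simp add: finite_index_def RCOSETS_def UNION_singleton_eq_range)
  fix a b assume a: "a \<in> carrier G" and b: "b \<in> carrier G" and eq: "K #> a = K #> b"
  have "b \<in> K #> a" using eq b rcos_self[OF b sub] by simp
  then obtain k where k: "k \<in> K" "b = k \<otimes> a" by (auto simp: r_coset_def)
  \<comment> \<open>Right cosets yield b = k a. Rewriting this as b = a k', with k' in the normal
    subgroup \<open>K\<close>, lets the conjugation by an element of \<open>K\<close> act first,
    directly on the homology class \<open>D\<close>, where it is trivial.\<close>
  define k' where "k' = conj_by G (inv a) k"
  have k': "k' \<in> K" using conjK[of "inv a"] a k(1) by (auto simp: k'_def)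
  have bk: "b = a \<otimes> k'"
    using a k by (simp add: k'_def conj_by_def m_assoc[symmetric])
  have eqD: "restrict (conj_by G a) K ` D = restrict (conj_by G b) K ` D" if D: "D \<in> carrier (H1 ?K)" for D
  proof -
    have DK: "D \<subseteq> K"
      using D KG.derived_in_carrier[of K] KG.r_coset_subset_G[of "derived ?K K"]
      by (auto simp: H1_def carrier_FactGroup)
    have "conj_by ?K k' x = conj_by G k' x" if "x \<in> K" for x
      using that k' m_inv_consistent[OF sub k'] by (simp add: conj_by_def)
    then have "conj_by ?K k' ` D = conj_by G k' ` D"
      using DK by (intro image_cong) auto
    then have kD: "conj_by G k' ` D = D"
      using KG.conj_by_coset_derived[of k' D] D k' by (simp add: H1_def)
    have "restrict (conj_by G b) K ` D = conj_by G a ` conj_by G k' ` D"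
      unfolding image_image
    proof (rule image_cong)
      fix x assume "x \<in> D"
      then have "x \<in> K" using DK by blast
      then show "restrict (conj_by G b) K x = conj_by G a (conj_by G k' x)"
        using conj_by_mult[OF a, of k' x] k' bk by simp
    qed simp
    also have "\<dots> = restrict (conj_by G a) K ` D"
      unfolding kD using DK by (intro image_cong) auto
    finally show ?thesis by (rule sym)
  qed
  show "H1_map ?K (restrict (conj_by G a) K) = H1_map ?K (restrict (conj_by G b) K)"
    unfolding H1_map_def by (rule restrict_ext) (rule eqD)
qed

section \<open>An infinite conjugacy class\<close>

text \<open>The formula arccos z = -i log (z + i sqrt (1 - z^2)). Since \<open>f\<close> avoids 1
  and -1, the radicand has no zeros and a continuous root s exists; as (f + i s)(f - i s) = 1, the
  argument of the logarithm has no zeros either, and f - i s is its inverse.\<close>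

lemma continuous_cos_lift_exists:
  fixes f :: "'a::real_normed_vector \<Rightarrow> complex"
  assumes S: "contractible S" and f: "continuous_on S f" "\<And>x. x \<in> S \<Longrightarrow> f x \<noteq> 1 \<and> f x \<noteq> -1"
  obtains l where "continuous_on S l" "\<And>x. x \<in> S \<Longrightarrow> cos (l x) = f x"
proof -
  have "1 - (f x)\<^sup>2 \<noteq> 0" if "x \<in> S" for x
    using f(2)[OF that] by (metis eq_iff_diff_eq_0 power2_eq_1_iff)
  moreover have "continuous_on S (\<lambda>x. 1 - (f x)\<^sup>2)" by (intro continuous_intros f)
  ultimately obtain s where s: "continuous_on S s" "\<And>x. x \<in> S \<Longrightarrow> 1 - (f x)\<^sup>2 = (s x)\<^sup>2"
    using continuous_sqrt_on_contractible[OF _ S, of "\<lambda>x. 1 - (f x)\<^sup>2"] by blast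
  have inv: "(f x + \<i> * s x) * (f x - \<i> * s x) = 1" if "x \<in> S" for x
    using s(2)[OF that] by (simp add: algebra_simps power2_eq_square flip: add_diff_eq)
  have "continuous_on S (\<lambda>x. f x + \<i> * s x)" by (intro continuous_intros f s)
  moreover have "f x + \<i> * s x \<noteq> 0" if "x \<in> S" for x using inv[OF that] by auto
  ultimately obtain L where L: "continuous_on S L" "\<And>x. x \<in> S \<Longrightarrow> f x + \<i> * s x = exp (L x)"
    using continuous_logarithm_on_contractible[OF _ S, of "\<lambda>x. f x + \<i> * s x"] by blast
  show ?thesis
  proof
    show "continuous_on S (\<lambda>x. - \<i> * L x)" by (intro continuous_intros L)
    fix x assume x: "x \<in> S"
    have "exp (- L x) = f x - \<i> * s x"
      using inv[OF x] L(2)[OF x] by (simp add: exp_minus inverse_unique)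
    then show "cos (- \<i> * L x) = f x"
      by (simp add: cos_exp_eq L(2)[OF x, symmetric])
  qed
qed

lemma cos_add_periods: "cos (u + of_real (of_int (2 * n) * pi)) = cos (u :: complex)"
proof -
  have "u + of_real (of_int (2 * n) * pi) = u + of_real (2 * of_int n * pi)" by simp
  then show ?thesis unfolding complex_cos_eq using Ints_of_int by blast
qed

text \<open>Equal cosines force sines that agree up to sign. The quotient of the sines is
  continuous, so the sign is constant, and it is 1 at \<open>a\<close>. Then exp(i l) = exp(i l'),
  and l - l' is a continuous function with values in a discrete set.\<close>

lemma continuous_cos_lift_unique:
  fixes l l' :: "'a::real_normed_vector \<Rightarrow> complex"
  assumes S: "connected S" and l: "continuous_on S l" "continuous_on S l'"
    and eq: "\<And>x. x \<in> S \<Longrightarrow> cos (l x) = cos (l' x)" and nz: "\<And>x. x \<in> S \<Longrightarrow> cos (l x) \<noteq> 1 \<and> cos (l x) \<noteq> -1"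
    and a: "a \<in> S" "l a = l' a" and x: "x \<in> S"
  shows "l x = l' x"
proof -
  have sin: "sin (l x) \<noteq> 0" if "x \<in> S" for x
    using nz[OF that] sin_cos_squared_add[of "l x"] by (metis add_0 power2_eq_1_iff power_zero_numeral)
  have "continuous_on S (\<lambda>x. sin (l' x) / sin (l x))"
    using sin by (intro continuous_intros l) auto
  moreover have "(\<lambda>x. sin (l' x) / sin (l x)) ` S \<subseteq> {1, -1}"
  proof (rule image_subsetI)
    fix x assume x: "x \<in> S"
    have "(sin (l' x))\<^sup>2 = (sin (l x))\<^sup>2"
      using eq[OF x] by (simp add: sin_squared_eq)
    then show "sin (l' x) / sin (l x) \<in> {1, -1}"
      using sin[OF x] by (auto simp: power2_eq_iff)
  qed
  then have "finite ((\<lambda>x. sin (l' x) / sin (l x)) ` S)" by (rule finite_subset) simp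
  ultimately have "(\<lambda>x. sin (l' x) / sin (l x)) constant_on S"
    by (rule continuous_finite_range_constant[OF S])
  then have "sin (l' x) / sin (l x) = sin (l' a) / sin (l a)" if "x \<in> S" for x
    using that a(1) unfolding constant_on_def by metis
  then have sin_eq: "sin (l' x) = sin (l x)" if "x \<in> S" for x
    using that a sin by (metis divide_eq_1_iff)
  have exp_eq': "exp (\<i> * l x) = exp (\<i> * l' x)" if "x \<in> S" for x
    using sin_eq[OF that] eq[OF that] by (simp add: exp_Euler)
  have int: "\<exists>n::int. l x - l' x = of_int (2 * n) * pi" if "x \<in> S" for x
  proof -
    note e = exp_eq'[OF that]
    obtain n :: int where "\<i> * l x = \<i> * l' x + (of_int (2 * n) * pi) * \<i>"
      using e unfolding exp_eq by blast
    then have "\<i> * l x = \<i> * (l' x + of_int (2 * n) * pi)" by (simp add: algebra_simps)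
    then have "l x = l' x + of_int (2 * n) * pi" by (subst (asm) mult_left_cancel) auto
    then show ?thesis by (intro exI[of _ n]) simp
  qed
  have "(\<lambda>x. l x - l' x) constant_on S"
  proof (rule continuous_discrete_range_constant[OF S])
    show "continuous_on S (\<lambda>x. l x - l' x)" by (intro continuous_intros l)
    fix x assume x: "x \<in> S"
    \<comment> \<open>Distinct values differ by a nonzero multiple of 2 pi, so pi is a safe
      gap.\<close>
    have "pi \<le> norm (l y - l' y - (l x - l' x))" if y: "y \<in> S" "l y - l' y \<noteq> l x - l' x" for y
    proof -
      obtain m n :: int where mn: "l x - l' x = of_int (2 * n) * pi" "l y - l' y = of_int (2 * m) * pi"
        using int x y(1) by blast
      then have "m \<noteq> n" using y(2) by auto
      then have "1 \<le> \<bar>2 * (m - n)\<bar>" by presburger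
      then have "1 \<le> real_of_int \<bar>2 * (m - n)\<bar>" by (simp only: of_int_1_le_iff)
      then have "1 \<le> \<bar>of_int (2 * (m - n)) :: real\<bar>" by (simp only: of_int_abs)
      moreover have "l y - l' y - (l x - l' x) = of_real (of_int (2 * (m - n)) * pi)"
        unfolding mn by (simp add: algebra_simps)
      then have "norm (l y - l' y - (l x - l' x)) = \<bar>of_int (2 * (m - n)) :: real\<bar> * pi"
        by (simp only: norm_of_real abs_mult abs_of_pos[OF pi_gt_zero])
      ultimately show ?thesis by simp
    qed
    then show "\<exists>e>0. \<forall>y. y \<in> S \<and> l y - l' y \<noteq> l x - l' x \<longrightarrow> e \<le> norm (l y - l' y - (l x - l' x))"
      using pi_gt_zero by blast
  qed
  then have "l x - l' x = l a - l' a"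
    using x a(1) unfolding constant_on_def by metis
  then show ?thesis using a(2) by simp
qed

text \<open>The monodromy of the covering \<open>cos\<close> along \<open>k\<close>, kept as a
  relation between points of two fibres. Lifts along the loops of interest will be explicit, and
  only uniqueness of their ends needs an argument.\<close>

definition cos_lift :: "(real \<Rightarrow> complex) \<Rightarrow> complex \<Rightarrow> complex \<Rightarrow> bool" where
  "cos_lift k w w' \<longleftrightarrow>
     (\<exists>l. path l \<and> (\<forall>t\<in>{0..1}. cos (l t) = k t) \<and> pathstart l = w \<and> pathfinish l = w')"

lemma cos_lift_join:
  assumes "cos_lift k w w'" "cos_lift k' w' w''" shows "cos_lift (k +++ k') w w''"
proof -
  obtain l where l: "path l" "\<forall>t\<in>{0..1}. cos (l t) = k t" "pathstart l = w" "pathfinish l = w'"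
    using assms(1) by (auto simp: cos_lift_def)
  obtain l' where l': "path l'" "\<forall>t\<in>{0..1}. cos (l' t) = k' t" "pathstart l' = w'" "pathfinish l' = w''"
    using assms(2) by (auto simp: cos_lift_def)
  show ?thesis
    unfolding cos_lift_def
  proof (intro exI conjI ballI)
    show "path (l +++ l')" using l l' by simp
    show "cos ((l +++ l') t) = (k +++ k') t" if "t \<in> {0..1}" for t
      using that l(2) l'(2) by (cases "t \<le> 1 / 2") (simp_all add: joinpaths_def)
  qed (use l l' in simp_all)
qed

lemma cos_lift_reverse:
  assumes "cos_lift k w w'" shows "cos_lift (reversepath k) w' w"
proof -
  obtain l where l: "path l" "\<forall>t\<in>{0..1}. cos (l t) = k t" "pathstart l = w" "pathfinish l = w'"
    using assms by (auto simp: cos_lift_def)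
  show ?thesis
    unfolding cos_lift_def
  proof (intro exI conjI ballI)
    show "path (reversepath l)" using l by simp
    show "cos (reversepath l t) = reversepath k t" if "t \<in> {0..1}" for t
      using that l(2) by (simp add: reversepath_def)
  qed (use l in simp_all)
qed

text \<open>The homotopy is lifted at once on the contractible square. By uniqueness on each edge,
  the lift restricts to the two given lifts on the edges of the paths and is constant on the edges
  of the fixed ends.\<close>

lemma cos_lift_homotopic:
  assumes h: "homotopic_paths (- {1, -1}) k k'" and k: "cos_lift k w v" "cos_lift k' w v'"
  shows "v = v'"
proof -
  let ?S = "{0..1} \<times> {0..1} :: (real \<times> real) set"
  obtain H where H: "continuous_on ?S H" "H \<in> ?S \<rightarrow> - {1, -1}"
    "\<And>x. x \<in> {0..1} \<Longrightarrow> H (0, x) = k x" "\<And>x. x \<in> {0..1} \<Longrightarrow> H (1, x) = k' x"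
    "\<And>t. t \<in> {0..1} \<Longrightarrow> H (t, 0) = k 0" "\<And>t. t \<in> {0..1} \<Longrightarrow> H (t, 1) = k 1"
    using h unfolding homotopic_paths pathstart_def pathfinish_def by auto
  have nz: "H z \<noteq> 1 \<and> H z \<noteq> -1" if "z \<in> ?S" for z using H(2) that by auto
  have "contractible ?S" by (intro convex_imp_contractible convex_Times convex_real_interval)
  then obtain m where m: "continuous_on ?S m" "\<And>z. z \<in> ?S \<Longrightarrow> cos (m z) = H z"
    using continuous_cos_lift_exists[OF _ H(1)] nz by blast
  obtain l where l: "path l" "\<And>t. t \<in> {0..1} \<Longrightarrow> cos (l t) = k t" "l 0 = w" "l 1 = v"
    using k(1) by (auto simp: cos_lift_def pathstart_def pathfinish_def)
  obtain l' where l': "path l'" "\<And>t. t \<in> {0..1} \<Longrightarrow> cos (l' t) = k' t" "l' 0 = w" "l' 1 = v'"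
    using k(2) by (auto simp: cos_lift_def pathstart_def pathfinish_def)
  have "cos w = cos (m (0, 0))" using l(2)[of 0] l(3) m(2)[of "(0, 0)"] H(3)[of 0] by simp
  then obtain a where "a \<in> \<int>" "w = m (0, 0) + of_real (2 * a * pi) \<or> w = - m (0, 0) + of_real (2 * a * pi)"
    unfolding complex_cos_eq by blast
  moreover then obtain n :: int where "a = of_int n" by (auto elim: Ints_cases)
  ultimately have n: "w = m (0, 0) + of_int (2 * n) * pi \<or> w = - m (0, 0) + of_int (2 * n) * pi"
    by simp
  \<comment> \<open>\<open>m\<close> need not start at \<open>w\<close>; the deck transformation z
    -> z + 2 pi n or z -> -z + 2 pi n taking \<open>m (0, 0)\<close> to \<open>w\<close> corrects
    this.\<close>
  define M where "M z = (if w = m (0, 0) + of_int (2 * n) * pi then m z else - m z) + of_int (2 * n) * pi" for z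
  have M: "continuous_on ?S M" "\<And>z. z \<in> ?S \<Longrightarrow> cos (M z) = H z" "M (0, 0) = w"
  proof -
    show "continuous_on ?S M"
      unfolding M_def by (cases "w = m (0, 0) + of_int (2 * n) * pi") (auto intro!: continuous_intros m)
    show "cos (M z) = H z" if "z \<in> ?S" for z
      unfolding M_def cos_add_periods using m(2)[OF that] by simp
    show "M (0, 0) = w" using n unfolding M_def by auto
  qed
  have c: "continuous_on {0..1} (\<lambda>t. M (t, a))" "continuous_on {0..1} (\<lambda>t. M (a, t))" if "a \<in> {0..1}" for a
    using that by (intro continuous_on_compose2[OF M(1)] continuous_intros; auto)+
  have con: "connected {0..1::real}" by simp
  have pl: "continuous_on {0..1} l" "continuous_on {0..1} l'" using l l' by (auto simp: path_def)
  have kk: "k t \<noteq> 1" "k t \<noteq> -1" "k' t \<noteq> 1" "k' t \<noteq> -1" if "t \<in> {0..1}" for t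
    using nz[of "(0, t)"] nz[of "(1, t)"] H(3)[OF that] H(4)[OF that] that by auto
  \<comment> \<open>The edges are identified in an order in which each one fixes the starting value
    for another: the start, then \<open>l\<close>, the far end, and \<open>l'\<close>.\<close>
  have left: "M (t, 0) = w" if "t \<in> {0..1}" for t
    by (rule continuous_cos_lift_unique[OF con c(1) continuous_on_const _ _ _ _ that, of 0 w 0])
       (use M(2,3) kk H(5) l(2)[of 0] l(3) in auto)
  have bot: "M (0, t) = l t" if "t \<in> {0..1}" for t
    by (rule continuous_cos_lift_unique[OF con c(2) pl(1) _ _ _ _ that, of 0 0])
       (use M(2,3) kk H(3) l in auto)
  have right: "M (t, 1) = v" if "t \<in> {0..1}" for t
    by (rule continuous_cos_lift_unique[OF con c(1) continuous_on_const _ _ _ _ that, of 1 v 0])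
       (use M(2) kk H(6) bot[of 1] l(4) l(2)[of 1] in auto)
  have top: "M (1, t) = l' t" if "t \<in> {0..1}" for t
    by (rule continuous_cos_lift_unique[OF con c(2) pl(2) _ _ _ _ that, of 1 0])
       (use M(2) kk H(4) l' left[of 1] in auto)
  show ?thesis using right[of 1] top[of 1] l'(4) by simp
qed

text \<open>The path \<open>strand\<close> runs in the \<open>cos\<close>-cover of \<open>\<complex> - {1, -1}\<close> from \<open>\<pi>/2\<close> to \<open>-\<pi>/2\<close> around \<open>0\<close> for
  positive arguments and from \<open>\<pi>/2\<close> to \<open>3\<pi>/2\<close> around \<open>\<pi>\<close> for negative ones, so \<open>cos \<circ> strand\<close> maps
  \<open>[-1,1]\<close> onto a figure eight whose two loops act on the fibre over \<open>0\<close> as the generating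
  reflections of the infinite dihedral group.\<close>

definition strand :: "real \<Rightarrow> complex" where
  "strand x = (if x \<le> 0 then of_real pi - of_real (pi / 2) * cis (- pi * x) else of_real (pi / 2) * cis (pi * x))"

lemma continuous_strand: "continuous_on UNIV strand"
  unfolding strand_def by (rule continuous_on_cases_le) (auto intro!: continuous_intros)

lemma strand_values: "strand 0 = pi / 2" "strand 1 = - pi / 2" "strand (- 1) = 3 * pi / 2"
  by (simp_all add: strand_def field_simps)

lemma cos_strand_values: "cos (strand 0) = 0" "cos (strand 1) = 0" "cos (strand (- 1)) = 0"
proof -
  have "cos (strand 0) = of_real (cos (pi / 2))" "cos (strand 1) = of_real (cos (- pi / 2))"
    "cos (strand (- 1)) = of_real (cos (3 * pi / 2))"
    unfolding strand_values cos_of_real by simp_all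
  moreover have "cos (3 * pi / 2) = 0" using cos_3over2_pi by simp
  ultimately show "cos (strand 0) = 0" "cos (strand 1) = 0" "cos (strand (- 1)) = 0"
    by (simp_all add: cos_minus)
qed

text \<open>cos takes the values 1 and -1 exactly at the zeros of sin, the multiples of pi. Up to
  the reflection z -> pi - z, which preserves sin, points of the strand have modulus pi/2.\<close>

lemma cos_strand_avoids: "cos (strand x) \<noteq> 1" "cos (strand x) \<noteq> -1"
proof -
  have *: "sin (of_real (pi / 2) * cis a) \<noteq> 0" for a
  proof
    assume "sin (of_real (pi / 2) * cis a) = 0"
    then obtain n :: int where "of_real (pi / 2) * cis a = of_real (n * pi)" by (auto simp: sin_eq_0)
    then have "norm (of_real (pi / 2) * cis a) = norm (of_real (n * pi) :: complex)" by (rule arg_cong)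
    also have "norm (of_real (pi / 2) * cis a) = 1 / 2 * pi" by (simp add: norm_mult)
    also have "norm (of_real (n * pi) :: complex) = \<bar>real_of_int n\<bar> * pi"
      unfolding norm_of_real abs_mult by simp
    finally have "1 / 2 = \<bar>real_of_int n\<bar>" by (simp only: mult_right_cancel[OF pi_neq_zero])
    then have "real_of_int (2 * \<bar>n\<bar>) = 1" by (simp only: of_int_mult of_int_abs of_int_numeral)
    then have "2 * \<bar>n\<bar> = 1" by (simp only: of_int_eq_1_iff)
    then show False by presburger
  qed
  have "sin (of_real pi - z) = sin z" for z :: complex
    by (simp add: sin_diff)
  then have "sin (strand x) \<noteq> 0" using * by (simp add: strand_def)
  then have "(cos (strand x))\<^sup>2 \<noteq> 1"
    using sin_squared_eq[of "strand x"] by auto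
  then show "cos (strand x) \<noteq> 1" "cos (strand x) \<noteq> -1" by auto
qed

text \<open>The pairs \<open>(e, n)\<close> enumerate the deck transformations z -> e z + 2 pi n;
  every translate of the strand by one of them is a lift.\<close>

lemma cos_lift_strand:
  assumes h: "continuous_on {0..1} h" "\<And>t. t \<in> {0..1} \<Longrightarrow> k t = cos (strand (h t))" and e: "e \<in> {1, -1}"
  shows "cos_lift k (of_int e * strand (h 0) + of_int (2 * n) * pi) (of_int e * strand (h 1) + of_int (2 * n) * pi)"
  unfolding cos_lift_def
proof (intro exI conjI ballI)
  let ?l = "\<lambda>t. of_int e * strand (h t) + of_int (2 * n) * pi"
  have "continuous_on {0..1} (\<lambda>t. strand (h t))"
    by (rule continuous_on_compose2[OF continuous_strand h(1)]) auto
  then show "path ?l" unfolding path_def by (intro continuous_intros)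
  fix t :: real assume t: "t \<in> {0..1}"
  have "cos (of_int e * strand (h t) + of_int (2 * n) * pi) = cos (of_int e * strand (h t))"
    by (rule cos_add_periods)
  then show "cos (?l t) = k t" using e h(2)[OF t] by auto
qed (auto simp: pathstart_def pathfinish_def)

section \<open>Folding the polygon onto an interval\<close>

context
  fixes g :: nat
  assumes g: "g \<ge> 2"
begin

definition side_angle :: real where "side_angle = pi / (2 * real g)"

lemma side_angle: "4 * real g * side_angle = 2 * pi" "0 < side_angle" "3 / 2 * side_angle < pi"
  "polygon_boundary g t = cis (t * side_angle)"
proof -
  have "real g \<ge> 2" using g by simp
  then show "4 * real g * side_angle = 2 * pi" "0 < side_angle"
    "polygon_boundary g t = cis (t * side_angle)"
    by (auto simp: side_angle_def polygon_boundary_def field_simps)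
  have "side_angle \<le> pi / 4"
    unfolding side_angle_def using \<open>real g \<ge> 2\<close> by (intro divide_left_mono) auto
  then show "3 / 2 * side_angle < pi" using pi_gt_zero by linarith
qed

text \<open>On the boundary of the polygon, \<open>tent c\<close> is \<open>1\<close> on the side with midpoint \<open>c\<close>, falls off
  symmetrically on the two adjacent sides and is \<open>0\<close> on all others.\<close>

definition tent :: "real \<Rightarrow> complex \<Rightarrow> real" where
  "tent c z = max 0 (min 1 ((Re (z * cis (- c * side_angle)) - cos (3 / 2 * side_angle)) /
     (cos (1 / 2 * side_angle) - cos (3 / 2 * side_angle))))"

lemma continuous_tent: "continuous_on S (tent c)"
proof -
  have "cos (3 / 2 * side_angle) < cos (1 / 2 * side_angle)"
    using side_angle(2,3) by (intro cos_monotone_0_pi) auto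
  then show ?thesis
    unfolding tent_def by (intro continuous_intros) auto
qed

text \<open>On the unit circle the real part in \<open>tent\<close> is the cosine of the angular
  distance to the midpoint of the side. Dependence on the absolute value alone is what makes the
  fold compatible with the gluing of the two neighbouring sides.\<close>

lemma tent_boundary:
  "tent c (polygon_boundary g t) = max 0 (min 1 ((cos (\<bar>t - c\<bar> * side_angle) - cos (3 / 2 * side_angle)) /
     (cos (1 / 2 * side_angle) - cos (3 / 2 * side_angle))))"
proof -
  have "Re (polygon_boundary g t * cis (- c * side_angle)) = cos ((t - c) * side_angle)"
    unfolding side_angle(4) by (simp add: cis_mult algebra_simps)
  also have "\<dots> = cos (\<bar>t - c\<bar> * side_angle)"
    using side_angle(2) by (metis abs_mult abs_of_pos cos_abs_real)
  finally show ?thesis by (simp add: tent_def)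
qed

lemma tent_1:
  assumes "\<bar>t - c\<bar> \<le> 1 / 2" shows "tent c (polygon_boundary g t) = 1"
proof -
  have "cos (3 / 2 * side_angle) < cos (1 / 2 * side_angle)"
    using side_angle(2,3) by (intro cos_monotone_0_pi) auto
  moreover have "\<bar>t - c\<bar> * side_angle \<le> 1 / 2 * side_angle"
    using assms side_angle(2) by (intro mult_right_mono) auto
  then have "cos (1 / 2 * side_angle) \<le> cos (\<bar>t - c\<bar> * side_angle)"
    using side_angle(2,3) by (intro cos_monotone_0_pi_le) auto
  ultimately show ?thesis unfolding tent_boundary by (simp add: field_simps)
qed

text \<open>The circle consists of 4g sides, so two bounds are needed to stay 3/2 sides away from
  the centre in both directions; beyond angle pi the cosine is read off from the complementary
  angle.\<close>

lemma tent_0: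
  assumes "3 / 2 \<le> \<bar>t - c\<bar>" "\<bar>t - c\<bar> \<le> 4 * real g - 3 / 2"
  shows "tent c (polygon_boundary g t) = 0"
proof -
  let ?x = "\<bar>t - c\<bar> * side_angle"
  have x: "3 / 2 * side_angle \<le> ?x"
    using assms(1) side_angle(2) by (intro mult_right_mono) auto
  have "?x \<le> (4 * real g - 3 / 2) * side_angle"
    using assms(2) side_angle(2) by (intro mult_right_mono) auto
  also have "\<dots> = 2 * pi - 3 / 2 * side_angle"
    using side_angle(1) by (simp add: algebra_simps)
  finally have x': "?x \<le> 2 * pi - 3 / 2 * side_angle" .
  have "cos ?x \<le> cos (3 / 2 * side_angle)"
  proof (cases "?x \<le> pi")
    case True
    then show ?thesis using x side_angle(2) by (intro cos_monotone_0_pi_le) auto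
  next
    case False
    have "cos (2 * pi - ?x) \<le> cos (3 / 2 * side_angle)"
      using False x' side_angle(2) by (intro cos_monotone_0_pi_le) auto
    then show ?thesis by simp
  qed
  moreover have "cos (3 / 2 * side_angle) < cos (1 / 2 * side_angle)"
    using side_angle(2,3) by (intro cos_monotone_0_pi) auto
  ultimately show ?thesis
    unfolding tent_boundary by (simp add: divide_nonpos_pos)
qed

text \<open>The centres are the midpoints of the sides b_1 = [1,2] and b_2 = [5,6]. Along a_1 and
  a_2 the value runs from 0 to 1 and from 0 to -1, while every b-side has a constant value in {-1,
  0, 1}. After \<open>cos \<circ> strand\<close> this becomes the map to the figure eight in which
  a_1 and a_2 survive as the two loops.\<close>

definition fold_disc :: "complex \<Rightarrow> real" where
  "fold_disc z = tent (3 / 2) z - tent (11 / 2) z"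

lemma continuous_fold_disc: "continuous_on S fold_disc"
  unfolding fold_disc_def by (intro continuous_intros continuous_tent)

lemma fold_disc_symmetric:
  "0 \<le> s \<Longrightarrow> s \<le> 1 \<Longrightarrow> fold_disc (polygon_boundary g s) = fold_disc (polygon_boundary g (3 - s))"
  "0 \<le> s \<Longrightarrow> s \<le> 1 \<Longrightarrow> fold_disc (polygon_boundary g (4 + s)) = fold_disc (polygon_boundary g (7 - s))"
proof -
  have g': "real g \<ge> 2" using g by simp
  have "\<bar>s - 3 / 2\<bar> = \<bar>3 - s - 3 / 2\<bar>" "\<bar>4 + s - 11 / 2\<bar> = \<bar>7 - s - 11 / 2\<bar>" by linarith+
  then have e: "tent (3 / 2) (polygon_boundary g s) = tent (3 / 2) (polygon_boundary g (3 - s))"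
    "tent (11 / 2) (polygon_boundary g (4 + s)) = tent (11 / 2) (polygon_boundary g (7 - s))"
    unfolding tent_boundary by presburger+
  assume s: "0 \<le> s" "s \<le> 1"
  have "tent (11 / 2) (polygon_boundary g s) = 0" "tent (11 / 2) (polygon_boundary g (3 - s)) = 0"
    "tent (3 / 2) (polygon_boundary g (4 + s)) = 0" "tent (3 / 2) (polygon_boundary g (7 - s)) = 0"
    using s g' by (intro tent_0; simp add: abs_if)+
  then show "fold_disc (polygon_boundary g s) = fold_disc (polygon_boundary g (3 - s))"
    "fold_disc (polygon_boundary g (4 + s)) = fold_disc (polygon_boundary g (7 - s))"
    using e by (simp_all add: fold_disc_def)
qed

lemma fold_disc_values:
  "t \<in> {1..2} \<Longrightarrow> fold_disc (polygon_boundary g t) = 1"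
  "t \<in> {3..4} \<Longrightarrow> fold_disc (polygon_boundary g t) = 0"
  "t \<in> {5..6} \<Longrightarrow> fold_disc (polygon_boundary g t) = -1"
  "t \<in> {7..4 * real g} \<Longrightarrow> fold_disc (polygon_boundary g t) = 0"
proof -
  have g': "real g \<ge> 2" using g by simp
  show "fold_disc (polygon_boundary g t) = 1" if "t \<in> {1..2}"
  proof -
    have "tent (3 / 2) (polygon_boundary g t) = 1"
      using that by (intro tent_1) (auto simp: abs_if)
    moreover have "tent (11 / 2) (polygon_boundary g t) = 0"
      using that g' by (intro tent_0) (auto simp: abs_if)
    ultimately show ?thesis by (simp add: fold_disc_def)
  qed
  show "fold_disc (polygon_boundary g t) = 0" if "t \<in> {3..4}"
  proof -
    have "tent (3 / 2) (polygon_boundary g t) = 0" "tent (11 / 2) (polygon_boundary g t) = 0"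
      using that g' by (intro tent_0; auto simp: abs_if)+
    then show ?thesis by (simp add: fold_disc_def)
  qed
  show "fold_disc (polygon_boundary g t) = -1" if "t \<in> {5..6}"
  proof -
    have "tent (11 / 2) (polygon_boundary g t) = 1"
      using that by (intro tent_1) (auto simp: abs_if)
    moreover have "tent (3 / 2) (polygon_boundary g t) = 0"
      using that g' by (intro tent_0) (auto simp: abs_if)
    ultimately show ?thesis by (simp add: fold_disc_def)
  qed
  show "fold_disc (polygon_boundary g t) = 0" if "t \<in> {7..4 * real g}"
  proof -
    have "tent (3 / 2) (polygon_boundary g t) = 0" "tent (11 / 2) (polygon_boundary g t) = 0"
      using that g' by (intro tent_0; auto simp: abs_if)+
    then show ?thesis by (simp add: fold_disc_def)
  qed
qed

lemma fold_disc_0: "fold_disc (polygon_boundary g 0) = 0"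
  using fold_disc_symmetric(1)[of 0] fold_disc_values(2)[of 3] by simp

text \<open>Paired a-sides carry equal values of the fold, by symmetry for the first two handles and
  because both are 0 for the others. Paired b-sides may carry different constants, but
  \<open>cos \<circ> strand\<close> vanishes at -1, 0 and 1.\<close>

lemma cos_strand_side_pairing:
  assumes "side_pairing g x y"
  shows "cos (strand (fold_disc x)) = cos (strand (fold_disc y))"
  using assms
proof cases
  case (side_a i s)
  consider "i = 0" | "i = 1" | "i \<ge> 2" by linarith
  then show ?thesis
  proof cases
    case 3
    then have "2 \<le> real i" "real i + 1 \<le> real g" using side_a by linarith+
    then show ?thesis using side_a fold_disc_values(4) by simp
  qed (use side_a fold_disc_symmetric[of s] in auto)
next
  case (side_b i s)
  consider "i = 0" | "i = 1" | "i \<ge> 2" by linarith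
  then show ?thesis
  proof cases
    case 1
    then show ?thesis
      using side_b fold_disc_values(1)[of "1 + s"] fold_disc_values(2)[of "4 - s"] cos_strand_values by simp
  next
    case 2
    have "real g \<ge> 2" using g by simp
    then show ?thesis
      using 2 side_b fold_disc_values(3)[of "5 + s"] fold_disc_values(4)[of "8 - s"] cos_strand_values by simp
  next
    case 3
    then have "2 \<le> real i" "real i + 1 \<le> real g" using side_b by linarith+
    then show ?thesis using side_b fold_disc_values(4) by simp
  qed
qed

section \<open>The dihedral action on a fibre\<close>

text \<open>The conjugates of the class \<open>a\<close> by powers of \<open>a b\<close> are told
  apart by where their lifts from one fixed point of the fibre end.\<close>

lemma infinite_conjugacy_class:
  fixes X :: "'a::topological_space set" and star :: 'a
  assumes genus: "has_genus X g" and star: "star \<in> X"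
  shows "\<exists>d\<in>carrier (fundamental_group X star).
    infinite ((\<lambda>a. conj_by (fundamental_group X star) a d) ` carrier (fundamental_group X star))"
proof -
  let ?\<pi> = "fundamental_group X star"
  interpret group ?\<pi> by (rule group_fundamental_group[OF star])
  let ?D = "cball 0 1 :: complex set"
  obtain q where q: "quotient_map (top_of_set ?D) (top_of_set X) q"
    and q_eq: "\<And>x y. x \<in> ?D \<Longrightarrow> y \<in> ?D \<Longrightarrow> q x = q y \<longleftrightarrow> equivclp (side_pairing g) x y"
    using genus g by (auto simp: has_genus_def)
  have qD: "q ` ?D = X" using quotient_imp_surjective_map[OF q] by simp
  have q_cont: "continuous_on ?D q" using quotient_imp_continuous_map[OF q] by simp
  have f_eq: "cos (strand (fold_disc x)) = cos (strand (fold_disc y))" if "equivclp (side_pairing g) x y" for x y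
    using that by (induction rule: equivclp_induct) (auto dest: cos_strand_side_pairing)
  have "continuous_on ?D (\<lambda>z. cos (strand (fold_disc z)))"
    by (intro continuous_on_compose2[OF continuous_on_cos[OF continuous_on_id]]
        continuous_on_compose2[OF continuous_strand continuous_fold_disc]) auto
  then have cm: "continuous_map (top_of_set ?D) euclidean (\<lambda>z. cos (strand (fold_disc z)))" by simp
  have comp: "cos (strand (fold_disc x)) = cos (strand (fold_disc y))"
    if "x \<in> topspace (top_of_set ?D)" "y \<in> topspace (top_of_set ?D)" "q x = q y" for x y
    using that q_eq[of x y] f_eq by simp
  obtain F where F': "continuous_map (top_of_set X) euclidean F"
    "F ` topspace (top_of_set X) = (\<lambda>z. cos (strand (fold_disc z))) ` topspace (top_of_set ?D)"
    "\<And>z. z \<in> topspace (top_of_set ?D) \<Longrightarrow> F (q z) = cos (strand (fold_disc z))"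
    by (rule quotient_map_lift_exists[OF q cm], erule (2) comp, rule that, assumption+)
  then have F: "continuous_on X F" "\<And>z. z \<in> ?D \<Longrightarrow> F (q z) = cos (strand (fold_disc z))" by simp_all
  have F_avoids: "F \<in> X \<rightarrow> - {1, -1}"
    using F(2) cos_strand_avoids unfolding qD[symmetric] by auto
  \<comment> \<open>The loops used below are composed of images of paths in the disc, and for those
    the lift is a translate of the strand evaluated along the fold.\<close>
  have disc_lift: "cos_lift (F \<circ> (q \<circ> \<gamma>)) (of_int e * strand (fold_disc (pathstart \<gamma>)) + of_int (2 * n) * pi)
      (of_int e * strand (fold_disc (pathfinish \<gamma>)) + of_int (2 * n) * pi)"
    if "path \<gamma>" "path_image \<gamma> \<subseteq> ?D" "e \<in> {1, -1}" for \<gamma> e n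
  proof -
    have "continuous_on {0..1} (\<lambda>t. fold_disc (\<gamma> t))"
      using that(1) unfolding path_def by (intro continuous_on_compose2[OF continuous_fold_disc]) auto
    moreover have "(F \<circ> (q \<circ> \<gamma>)) t = cos (strand (fold_disc (\<gamma> t)))" if "t \<in> {0..1}" for t
    proof -
      have "\<gamma> t \<in> ?D" using \<open>path_image \<gamma> \<subseteq> ?D\<close> that unfolding path_image_def by blast
      then show ?thesis by (simp only: o_def F(2))
    qed
    ultimately show ?thesis
      using cos_lift_strand[of "\<lambda>t. fold_disc (\<gamma> t)", OF _ _ that(3)] by (simp add: pathstart_def pathfinish_def)
  qed
  let ?v = "polygon_boundary g"
  have v: "?v t \<in> ?D" for t by (simp add: polygon_boundary_def)
  have a_glue: "q (?v (4 * real i + s)) = q (?v (4 * real i + 3 - s))" if "i < g" "s \<in> {0..1}" for i s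
    using q_eq[OF v v] side_a[OF that] by blast
  have b_glue: "q (?v (4 * real i + 1 + s)) = q (?v (4 * real i + 4 - s))" if "i < g" "s \<in> {0..1}" for i s
    using q_eq[OF v v] side_b[OF that] by blast
  \<comment> \<open>The vertices 0, 1, 4 and 5 become one point of the surface, so the sides a_1 and
    a_2 close up to loops.\<close>
  have v01: "q (?v 1) = q (?v 0)" and v04: "q (?v 4) = q (?v 0)" and v05: "q (?v 5) = q (?v 0)"
    using a_glue[of 0 0] a_glue[of 0 1] b_glue[of 0 0] b_glue[of 0 1]
      a_glue[of 1 0] a_glue[of 1 1] b_glue[of 1 0] b_glue[of 1 1] g by simp_all
  obtain z where z: "z \<in> ?D" "q z = star" using star qD by blast
  have qpath: "path (q \<circ> \<gamma>)" "path_image (q \<circ> \<gamma>) \<subseteq> X" if "path \<gamma>" "path_image \<gamma> \<subseteq> ?D" for \<gamma>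
    using that qD by (auto simp: path_image_compose intro!: path_continuous_image continuous_on_subset[OF q_cont])
  \<comment> \<open>The marked point is arbitrary, so the loops based at the common vertex are
    transported along a segment in the disc.\<close>
  define \<sigma> where "\<sigma> = linepath z (?v 0)"
  have \<sigma>: "path \<sigma>" "path_image \<sigma> \<subseteq> ?D" "pathstart \<sigma> = z" "pathfinish \<sigma> = ?v 0"
    using z(1) v[of 0] by (auto simp: \<sigma>_def closed_segment_subset)
  define arc where "arc a = (\<lambda>s. ?v (a + s))" for a
  have arc: "path (arc a)" "path_image (arc a) \<subseteq> ?D" "pathstart (arc a) = ?v a" "pathfinish (arc a) = ?v (a + 1)" for a
    using v g by (auto simp: arc_def path_def path_image_def pathstart_def pathfinish_def polygon_boundary_def
        simp del: mem_cball intro!: continuous_intros)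
  define tour where "tour a = (q \<circ> \<sigma>) +++ ((q \<circ> arc a) +++ reversepath (q \<circ> \<sigma>))" for a
  have tour: "tour a \<in> loops X star" if "q (?v a) = q (?v 0)" "q (?v (a + 1)) = q (?v 0)" for a
    using that qpath[OF \<sigma>(1,2)] qpath[OF arc(1,2)] \<sigma> arc(3,4)[of a] z(2)
    by (simp add: loops_def tour_def subset_path_image_join pathstart_compose pathfinish_compose)
  \<comment> \<open>The points of the fibre of \<open>cos\<close> over \<open>F star\<close>,
    labelled by deck transformations.\<close>
  define W where "W e n = of_int e * strand (fold_disc z) + complex_of_real (of_int (2 * n) * pi)" for e n :: int
  have \<sigma>_lift: "cos_lift (F \<circ> (q \<circ> \<sigma>)) (W e n) (of_int e * (pi / 2) + of_int (2 * n) * pi)" if "e \<in> {1, -1}" for e n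
    using disc_lift[OF \<sigma>(1,2) that, of n] \<sigma>(3,4) fold_disc_0 by (simp add: W_def strand_values)
  \<comment> \<open>The last hypothesis says that the lift of the arc ends at the point over the
    vertex with label \<open>(e', n')\<close>; from there the reversed segment leads back to
    \<open>W e' n'\<close>.\<close>
  have tour_lift: "cos_lift (F \<circ> tour a) (W e n) (W e' n')"
    if "e \<in> {1, -1}" "e' \<in> {1, -1}" "fold_disc (?v a) = 0"
      "of_int e * strand (fold_disc (?v (a + 1))) + complex_of_real (of_int (2 * n) * pi)
        = of_int e' * (pi / 2) + of_int (2 * n') * pi" for a e n e' n'
  proof -
    have "cos_lift (F \<circ> (q \<circ> arc a)) (of_int e * (pi / 2) + of_int (2 * n) * pi)
        (of_int e' * (pi / 2) + of_int (2 * n') * pi)"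
      using disc_lift[OF arc(1,2) that(1), of a n] arc(3,4)[of a] that(3,4) by (simp add: strand_values)
    then show ?thesis
      unfolding tour_def path_compose_join path_compose_reversepath
      using \<sigma>_lift that by (intro cos_lift_join cos_lift_reverse)
  qed
  \<comment> \<open>Asking for just one representative keeps products and inverses easy; homotopy
    invariance is confined to \<open>lifts_unique\<close>.\<close>
  define lifts where "lifts c w w' \<longleftrightarrow> (\<exists>p\<in>loops X star. c = loop_class X p \<and> cos_lift (F \<circ> p) w w')" for c w w'
  have lifts_mult: "lifts (c \<otimes>\<^bsub>?\<pi>\<^esub> d) w w''" if l: "lifts c w w'" "lifts d w' w''" for c d w w' w''
  proof -
    obtain p r where "p \<in> loops X star" "c = loop_class X p" "cos_lift (F \<circ> p) w w'"
      "r \<in> loops X star" "d = loop_class X r" "cos_lift (F \<circ> r) w' w''"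
      using l unfolding lifts_def by blast
    then show ?thesis
      unfolding lifts_def
      by (intro bexI[of _ "p +++ r"]) (auto simp: fundamental_group_mult path_compose_join cos_lift_join loops_join)
  qed
  have lifts_inv: "lifts (inv\<^bsub>?\<pi>\<^esub> c) w' w" if l: "lifts c w w'" for c w w'
  proof -
    obtain p where "p \<in> loops X star" "c = loop_class X p" "cos_lift (F \<circ> p) w w'"
      using l unfolding lifts_def by blast
    then show ?thesis
      unfolding lifts_def
      by (intro bexI[of _ "reversepath p"])
         (auto simp: fundamental_group_inv[OF star] path_compose_reversepath cos_lift_reverse loops_reverse)
  qed
  have lifts_unique: "w' = w''" if l: "lifts c w w'" "lifts c w w''" for c w w' w''
  proof -
    obtain p r where p: "p \<in> loops X star" "c = loop_class X p" "cos_lift (F \<circ> p) w w'"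
      and r: "r \<in> loops X star" "c = loop_class X r" "cos_lift (F \<circ> r) w w''"
      using l unfolding lifts_def by blast
    have "homotopic_paths X p r" using loop_class_eqD[OF p(1)] p(2) r(2) by simp
    then have "homotopic_paths (- {1, -1}) (F \<circ> p) (F \<circ> r)"
      by (rule homotopic_paths_continuous_image[OF _ F(1) F_avoids])
    then show ?thesis using cos_lift_homotopic p(3) r(3) by blast
  qed
  define a b where "a = loop_class X (tour 0)" and "b = loop_class X (tour 4)"
  have ab: "a \<in> carrier ?\<pi>" "b \<in> carrier ?\<pi>"
    using tour[of 0] tour[of 4] v01 v04 v05 by (auto simp: a_def b_def fundamental_group_carrier)
  \<comment> \<open>\<open>strand 1\<close> is -pi/2, so the sign changes and \<open>n\<close> is
    kept.\<close>
  have a_lift: "lifts a (W e n) (W (- e) n)" if "e \<in> {1, -1}" for e n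
  proof -
    have "cos_lift (F \<circ> tour 0) (W e n) (W (- e) n)"
      using that fold_disc_0 fold_disc_values(1)[of 1]
      by (intro tour_lift) (auto simp: strand_values)
    then show ?thesis using tour[of 0] v01 by (auto simp: lifts_def a_def)
  qed
  \<comment> \<open>\<open>strand (- 1)\<close> is 3 pi/2, and e 3 pi/2 = -e pi/2 + 2 pi e accounts
    for the shift by \<open>e\<close>.\<close>
  have b_lift: "lifts b (W e n) (W (- e) (n + e))" if "e \<in> {1, -1}" for e n
  proof -
    have "cos_lift (F \<circ> tour 4) (W e n) (W (- e) (n + e))"
      using that fold_disc_values(2)[of 4] fold_disc_values(3)[of 5]
      by (intro tour_lift) (auto simp: strand_values algebra_simps)
    then show ?thesis using tour[of 4] v04 v05 by (auto simp: lifts_def b_def)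
  qed
  define x where "x m = (a \<otimes>\<^bsub>?\<pi>\<^esub> b) [^]\<^bsub>?\<pi>\<^esub> (m :: nat)" for m
  have x: "x m \<in> carrier ?\<pi>" for m using ab by (simp add: x_def)
  have ab_lift: "lifts (a \<otimes>\<^bsub>?\<pi>\<^esub> b) (W e n) (W e (n - e))" if "e \<in> {1, -1}" for e n
    using lifts_mult[OF a_lift[OF that, of n] b_lift[of "- e" n]] that by auto
  have x_lift: "lifts (x m) (W e n) (W e (n - e * int m))" if "e \<in> {1, -1}" for e n m
  proof (induction m)
    case 0
    \<comment> \<open>The trivial class is written as a product for which a closed lift at
      \<open>W e n\<close> is already available.\<close>
    have "\<one>\<^bsub>?\<pi>\<^esub> = a \<otimes>\<^bsub>?\<pi>\<^esub> inv\<^bsub>?\<pi>\<^esub> a" using ab by simp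
    then show ?case
      using lifts_mult[OF a_lift[OF that, of n] lifts_inv[OF a_lift[OF that, of n]]] by (simp add: x_def)
  next
    case (Suc m)
    show ?case
      using lifts_mult[OF Suc.IH ab_lift[OF that]] by (simp add: x_def algebra_simps)
  qed
  \<comment> \<open>The label goes from (1, 0) to (1, -m), to (-1, -m), to (-1, -2m). Translations
    act in opposite directions on the two sheets, so the outward and the returning shift add up
    instead of cancelling.\<close>
  have conj_lift: "lifts (conj_by ?\<pi> (x m) a) (W 1 0) (W (- 1) (- 2 * int m))" for m
  proof -
    have "lifts (x m \<otimes>\<^bsub>?\<pi>\<^esub> a) (W 1 0) (W (- 1) (- int m))"
      using lifts_mult[OF x_lift[of 1 m 0] a_lift[of 1]] by simp
    moreover have "lifts (inv\<^bsub>?\<pi>\<^esub> (x m)) (W (- 1) (- int m)) (W (- 1) (- 2 * int m))"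
      using lifts_inv[OF x_lift[of "- 1" m "- 2 * int m"]] by simp
    ultimately show ?thesis using lifts_mult ab by (simp add: conj_by_def)
  qed
  have "inj (\<lambda>m. conj_by ?\<pi> (x m) a)"
  proof (rule injI)
    fix m m' assume "conj_by ?\<pi> (x m) a = conj_by ?\<pi> (x m') a"
    then have "W (- 1) (- 2 * int m) = W (- 1) (- 2 * int m')"
      using lifts_unique conj_lift by metis
    then have "complex_of_real (of_int (2 * (- 2 * int m)) * pi) = complex_of_real (of_int (2 * (- 2 * int m')) * pi)"
      by (simp only: W_def add_left_cancel)
    then show "m = m'" by (simp only: of_real_eq_iff) simp
  qed
  then have "infinite (range (\<lambda>m. conj_by ?\<pi> (x m) a))"
    by (rule range_inj_infinite)
  moreover have "range (\<lambda>m. conj_by ?\<pi> (x m) a) \<subseteq> (\<lambda>c. conj_by ?\<pi> c a) ` carrier ?\<pi>"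
    using x by auto
  ultimately show ?thesis using ab(1) finite_subset by blast
qed

end

section \<open>Mapping classes acting by inner automorphisms\<close>

lemma finite_index_of_finite: "finite (carrier G) \<Longrightarrow> finite_index H G"
  by (simp add: finite_index_def RCOSETS_def)

section \<open>The action of mapping classes on the fundamental group\<close>

context smooth_surface
begin

context
  fixes star :: 'a
  assumes star: "star \<in> X"
begin

abbreviation "\<Gamma> \<equiv> mapping_class_group X A star"
abbreviation "\<pi>\<^sub>1 \<equiv> fundamental_group X star"

interpretation D: group "Diff_group X A star" by (rule group_Diff_group[OF star])
interpretation N: normal "Diff_isotopic_id X A star" "Diff_group X A star"
  by (rule normal_Diff_isotopic_id[OF star])
interpretation P: group \<pi>\<^sub>1 by (rule group_fundamental_group[OF star])

lemma group_mapping_class_group: "group \<Gamma>"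
  unfolding mapping_class_group_def by (rule N.factorgroup_is_group)

interpretation M: group \<Gamma> by (rule group_mapping_class_group)

lemma Diff_marked_continuous:
  assumes "f \<in> Diff_marked X A star" shows "continuous_on X f" "f ` X \<subseteq> X" "f star = star"
  using Diff_markedD[OF assms] by auto

text \<open>The isotopy fixes the marked point at all times, so following it along the image of a
  loop under \<open>f\<close> is a homotopy with fixed ends. Hence the action is well defined on
  cosets.\<close>

lemma pushforward_isotopic:
  assumes n: "n \<in> Diff_isotopic_id X A star" and f: "f \<in> Diff_marked X A star"
  shows "pushforward X star (compose X n f) = pushforward X star f"
proof -
  obtain J F where F: "smooth_family J F" "{0..1} \<subseteq> J"
    "\<And>t. t \<in> {0..1} \<Longrightarrow> (\<lambda>x\<in>X. F (t, x)) \<in> Diff_marked X A star"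
    "\<And>x. x \<in> X \<Longrightarrow> F (0, x) = x" "\<And>x. x \<in> X \<Longrightarrow> F (1, x) = n x"
    and nD: "n \<in> Diff_marked X A star"
    using Diff_isotopic_idE[OF n] by metis
  have FJ: "F ` (J \<times> X) \<subseteq> X" "continuous_on (J \<times> X) F" using F(1) by (auto simp: smooth_family_def)
  note f' = Diff_marked_continuous[OF f]
  note nf' = Diff_marked_continuous[OF Diff_marked_compose[OF nD f star]]
  have "pushforward X star (compose X n f) (loop_class X p) = pushforward X star f (loop_class X p)"
    if p: "p \<in> loops X star" for p
  proof -
    note fp = loopsD[OF loops_image[OF p f']]
    have fpX: "f (p s) \<in> X" "p s \<in> X" if "s \<in> {0..1}" for s
      using fp(2) loopsD(2)[OF p] that by (auto simp: path_image_def)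
    have F_star: "F (t, star) = star" if "t \<in> {0..1}" for t
      using Diff_markedD(4)[OF F(3)[OF that]] star by simp
    have "continuous_on ({0..1} \<times> {0..1}) (\<lambda>w :: real \<times> real. (f \<circ> p) (snd w))"
      by (rule continuous_on_compose2[OF fp(1)[unfolded path_def]]) (auto intro: continuous_intros)
    then have "continuous_on ({0..1} \<times> {0..1}) (\<lambda>w. F (fst w, (f \<circ> p) (snd w)))"
      using F(2) fpX by (intro continuous_on_compose2[OF FJ(2)] continuous_intros) auto
    moreover have "(\<lambda>w. F (fst w, (f \<circ> p) (snd w))) \<in> ({0..1} \<times> {0..1}) \<rightarrow> X"
      using FJ(1) F(2) fpX by (force simp: image_subset_iff)
    ultimately have "homotopic_paths X (f \<circ> p) (compose X n f \<circ> p)"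
      unfolding homotopic_paths
      using F(4,5) fpX fp(3,4) F_star
      by (intro exI[of _ "\<lambda>w. F (fst w, (f \<circ> p) (snd w))"])
         (auto simp: compose_def pathstart_def pathfinish_def)
    then show ?thesis
      by (simp add: pushforward_loop_class[OF p f'(1,2)] pushforward_loop_class[OF p nf'(1,2)] loop_class_eqI)
  qed
  then show ?thesis
    by (intro extensionalityI[of _ "carrier \<pi>\<^sub>1"]) (auto simp: pushforward_def fundamental_group_carrier)
qed

lemma mapping_class_action_coset:
  assumes f: "f \<in> Diff_marked X A star"
  shows "mapping_class_action X star (Diff_isotopic_id X A star #>\<^bsub>Diff_group X A star\<^esub> f) = pushforward X star f"
proof -
  have "n \<otimes>\<^bsub>Diff_group X A star\<^esub> f = compose X n f" if "n \<in> Diff_isotopic_id X A star" for n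
    using that f by (intro Diff_group_simps(3)) (auto simp: Diff_isotopic_id_def)
  moreover have nonempty: "Diff_isotopic_id X A star \<noteq> {}" using N.one_closed by blast
  ultimately have "pushforward X star ` (Diff_isotopic_id X A star #>\<^bsub>Diff_group X A star\<^esub> f) = {pushforward X star f}"
    using nonempty pushforward_isotopic[OF _ f] by (auto simp: r_coset_def image_iff)
  then show ?thesis by (simp add: mapping_class_action_def)
qed

lemma mapping_classE:
  assumes "c \<in> carrier \<Gamma>"
  obtains f where "f \<in> Diff_marked X A star" "c = Diff_isotopic_id X A star #>\<^bsub>Diff_group X A star\<^esub> f"
  using assms by (auto simp: mapping_class_group_def carrier_FactGroup Diff_group_simps)

lemma pushforward_closed:
  assumes "f \<in> Diff_marked X A star" "x \<in> carrier \<pi>\<^sub>1"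
  shows "pushforward X star f x \<in> carrier \<pi>\<^sub>1"
  using assms pushforward_loop_class[of _ X star f] loops_image[of _ X star f] Diff_marked_continuous[OF assms(1)]
  by (auto simp: fundamental_group_carrier)

lemma mapping_class_action_extensional:
  "c \<in> carrier \<Gamma> \<Longrightarrow> mapping_class_action X star c \<in> extensional (carrier \<pi>\<^sub>1)"
  by (erule mapping_classE) (simp add: mapping_class_action_coset pushforward_def)

lemma mapping_class_action_mult:
  assumes c: "c \<in> carrier \<Gamma>" and d: "d \<in> carrier \<Gamma>" and x: "x \<in> carrier \<pi>\<^sub>1"
  shows "mapping_class_action X star (c \<otimes>\<^bsub>\<Gamma>\<^esub> d) x = mapping_class_action X star c (mapping_class_action X star d x)"
proof -
  obtain f where f: "f \<in> Diff_marked X A star" "c = Diff_isotopic_id X A star #>\<^bsub>Diff_group X A star\<^esub> f"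
    using c by (rule mapping_classE)
  obtain h where h: "h \<in> Diff_marked X A star" "d = Diff_isotopic_id X A star #>\<^bsub>Diff_group X A star\<^esub> h"
    using d by (rule mapping_classE)
  obtain p where p: "p \<in> loops X star" "x = loop_class X p" using x by (auto simp: fundamental_group_carrier)
  note f' = Diff_marked_continuous[OF f(1)] and h' = Diff_marked_continuous[OF h(1)]
  have fh: "compose X f h \<in> Diff_marked X A star" by (rule Diff_marked_compose[OF f(1) h(1) star])
  have "c \<otimes>\<^bsub>\<Gamma>\<^esub> d = Diff_isotopic_id X A star #>\<^bsub>Diff_group X A star\<^esub> compose X f h"
    using f h by (simp add: mapping_class_group_def N.rcos_sum Diff_group_simps)
  then have "mapping_class_action X star (c \<otimes>\<^bsub>\<Gamma>\<^esub> d) x = loop_class X (compose X f h \<circ> p)"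
    using p fh pushforward_loop_class[OF p(1) Diff_marked_continuous(1,2)[OF fh]]
    by (simp add: mapping_class_action_coset)
  also have "\<dots> = loop_class X (f \<circ> (h \<circ> p))"
  proof (rule loop_class_eqI, rule homotopic_paths_eq)
    have "compose X f h \<circ> p \<in> loops X star"
      by (rule loops_image[OF p(1) Diff_marked_continuous[OF fh]])
    then show "path (compose X f h \<circ> p)" "path_image (compose X f h \<circ> p) \<subseteq> X"
      using loopsD by blast+
    show "(compose X f h \<circ> p) t = (f \<circ> (h \<circ> p)) t" if "t \<in> {0..1}" for t
      using loops_in[OF p(1) that] by (simp add: compose_def)
  qed
  also have "\<dots> = mapping_class_action X star c (mapping_class_action X star d x)"
    using pushforward_loop_class[OF loops_image[OF p(1) h'] f'(1,2)] pushforward_loop_class[OF p(1) h'(1,2)]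
    by (simp add: f h p mapping_class_action_coset)
  finally show ?thesis .
qed

lemma mapping_class_action_one:
  assumes x: "x \<in> carrier \<pi>\<^sub>1" shows "mapping_class_action X star \<one>\<^bsub>\<Gamma>\<^esub> x = x"
proof -
  note id = Diff_marked_id[OF star]
  obtain p where p: "p \<in> loops X star" "x = loop_class X p" using x by (auto simp: fundamental_group_carrier)
  have "Diff_isotopic_id X A star #>\<^bsub>Diff_group X A star\<^esub> (\<lambda>x\<in>X. x) = Diff_isotopic_id X A star"
    using N.one_closed D.coset_mult_one[OF N.subset] by (simp add: Diff_group_simps)
  then have "mapping_class_action X star \<one>\<^bsub>\<Gamma>\<^esub> = pushforward X star (\<lambda>x\<in>X. x)"
    using mapping_class_action_coset[OF id] by (simp add: mapping_class_group_def)
  moreover have "loop_class X ((\<lambda>x\<in>X. x) \<circ> p) = loop_class X p"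
    using loopsD[OF p(1)] loops_in[OF p(1)] by (intro loop_class_eqI[symmetric] homotopic_paths_eq) simp_all
  ultimately show ?thesis
    using pushforward_loop_class[OF p(1) Diff_marked_continuous(1,2)[OF id]] p(2) by simp
qed

section \<open>The group of inner classes\<close>

text \<open>Described by the action instead of as the image of a push map. Any classes acting
  trivially on \<open>\<pi>\<^sub>1\<close> are included, which does no harm since
  \<open>homological_rep\<close> depends on the action only.\<close>

definition inner_classes :: "('a \<Rightarrow> 'a) set set" where
  "inner_classes = {c \<in> carrier \<Gamma>. \<exists>a\<in>carrier \<pi>\<^sub>1. mapping_class_action X star c = conj_by \<pi>\<^sub>1 a}"

lemma subgroup_inner_classes: "subgroup inner_classes \<Gamma>"
proof (rule M.subgroupI)
  have "mapping_class_action X star \<one>\<^bsub>\<Gamma>\<^esub> = conj_by \<pi>\<^sub>1 \<one>\<^bsub>\<pi>\<^sub>1\<^esub>"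
    by (rule extensionalityI[OF mapping_class_action_extensional])
       (auto simp: conj_by_def[of \<pi>\<^sub>1] mapping_class_action_one)
  then show "inner_classes \<noteq> {}" unfolding inner_classes_def by blast
  show "inner_classes \<subseteq> carrier \<Gamma>" by (auto simp: inner_classes_def)
  fix c assume "c \<in> inner_classes"
  then obtain a where c: "c \<in> carrier \<Gamma>" "a \<in> carrier \<pi>\<^sub>1" "mapping_class_action X star c = conj_by \<pi>\<^sub>1 a"
    by (auto simp: inner_classes_def)
  have "mapping_class_action X star (inv\<^bsub>\<Gamma>\<^esub> c) x = conj_by \<pi>\<^sub>1 (inv\<^bsub>\<pi>\<^sub>1\<^esub> a) x" if x: "x \<in> carrier \<pi>\<^sub>1" for x
  proof -
    define y where "y = conj_by \<pi>\<^sub>1 (inv\<^bsub>\<pi>\<^sub>1\<^esub> a) x"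
    have y: "y \<in> carrier \<pi>\<^sub>1" using x c P.conj_by_closed by (simp add: y_def)
    have "mapping_class_action X star (inv\<^bsub>\<Gamma>\<^esub> c) (mapping_class_action X star c y) = y"
      using mapping_class_action_mult[of "inv\<^bsub>\<Gamma>\<^esub> c" c y] c y by (simp add: mapping_class_action_one)
    moreover have "mapping_class_action X star c y = x"
      using c x P.conj_by_inv(1) by (simp add: y_def)
    ultimately show ?thesis by (simp add: y_def)
  qed
  then have "mapping_class_action X star (inv\<^bsub>\<Gamma>\<^esub> c) = conj_by \<pi>\<^sub>1 (inv\<^bsub>\<pi>\<^sub>1\<^esub> a)"
    using c by (intro extensionalityI[OF mapping_class_action_extensional]) (auto simp: conj_by_def)
  then show "inv\<^bsub>\<Gamma>\<^esub> c \<in> inner_classes"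
    using c by (auto simp: inner_classes_def)
  fix d assume "d \<in> inner_classes"
  then obtain b where d: "d \<in> carrier \<Gamma>" "b \<in> carrier \<pi>\<^sub>1" "mapping_class_action X star d = conj_by \<pi>\<^sub>1 b"
    by (auto simp: inner_classes_def)
  have "mapping_class_action X star (c \<otimes>\<^bsub>\<Gamma>\<^esub> d) x = conj_by \<pi>\<^sub>1 (a \<otimes>\<^bsub>\<pi>\<^sub>1\<^esub> b) x" if "x \<in> carrier \<pi>\<^sub>1" for x
    using c d that by (simp add: mapping_class_action_mult P.conj_by_mult)
  then have "mapping_class_action X star (c \<otimes>\<^bsub>\<Gamma>\<^esub> d) = conj_by \<pi>\<^sub>1 (a \<otimes>\<^bsub>\<pi>\<^sub>1\<^esub> b)"
    using c d by (intro extensionalityI[OF mapping_class_action_extensional]) (auto simp: conj_by_def)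
  then show "c \<otimes>\<^bsub>\<Gamma>\<^esub> d \<in> inner_classes"
    using c d by (auto simp: inner_classes_def)
qed

lemma inner_realized:
  assumes a: "a \<in> carrier \<pi>\<^sub>1"
  shows "\<exists>c\<in>inner_classes. mapping_class_action X star c = conj_by \<pi>\<^sub>1 a"
proof -
  \<comment> \<open>The inverse is pushed along: if f is the end of the push along \<gamma>, then
    \<open>homotopy_conjugates\<close> reads q = \<gamma> f(q) \<gamma>^-1, so f acts as conjugation
    by the inverse of \<gamma>.\<close>
  obtain p where p: "p \<in> loops X star" "inv\<^bsub>\<pi>\<^sub>1\<^esub> a = loop_class X p"
    using P.inv_closed[OF a] by (auto simp: fundamental_group_carrier)
  note p' = loopsD[OF p(1)]
  obtain H where "pushes p H" using push_along_path[OF p'(1,2)] by blast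
  then have H: "continuous_on ({0..1} \<times> X) H" "H ` ({0..1} \<times> X) \<subseteq> X" "\<And>y. y \<in> X \<Longrightarrow> H (0, y) = y"
    "diffeo X A (\<lambda>y. H (1, y))" "orientation_preserving X A (\<lambda>y. H (1, y))"
    "homotopic_paths X (\<lambda>t. H (t, star)) p"
    using p'(3) unfolding pushes_def by auto
  let ?\<gamma> = "\<lambda>t. H (t, star)"
  have g: "?\<gamma> \<in> loops X star" "loop_class X ?\<gamma> = inv\<^bsub>\<pi>\<^sub>1\<^esub> a"
    using loops_homotopic[OF p(1) homotopic_paths_sym[OF H(6)]] loop_class_eqI[OF H(6)] p(2) by auto
  have "H (1, star) = star" using loopsD(4)[OF g(1)] by (simp add: pathfinish_def)
  then have f: "(\<lambda>x\<in>X. H (1, x)) \<in> Diff_marked X A star" (is "?f \<in> _")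
    using Diff_marked_restrictI[OF H(4,5) _ star] by blast
  note f' = Diff_marked_continuous[OF f]
  let ?c = "Diff_isotopic_id X A star #>\<^bsub>Diff_group X A star\<^esub> ?f"
  have c: "?c \<in> carrier \<Gamma>"
    using f by (auto simp: mapping_class_group_def carrier_FactGroup Diff_group_simps)
  have "pushforward X star ?f x = conj_by \<pi>\<^sub>1 a x" if x: "x \<in> carrier \<pi>\<^sub>1" for x
  proof -
    obtain q where q: "q \<in> loops X star" "x = loop_class X q" using x by (auto simp: fundamental_group_carrier)
    have fq: "?f \<circ> q \<in> loops X star" by (rule loops_image[OF q(1) f'])
    have "homotopic_paths X (?f \<circ> q) (\<lambda>s. H (1, q s))"
      using loopsD[OF fq] loops_in[OF q(1)] by (intro homotopic_paths_eq) simp_all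
    then have l: "(\<lambda>s. H (1, q s)) \<in> loops X star" "loop_class X (\<lambda>s. H (1, q s)) = loop_class X (?f \<circ> q)"
      using loops_homotopic[OF fq] loop_class_eqI[symmetric] by blast+
    have "x = loop_class X (?\<gamma> +++ ((\<lambda>s. H (1, q s)) +++ reversepath ?\<gamma>))"
      unfolding q(2) by (rule loop_class_eqI[OF homotopy_conjugates[OF H(1-3) q(1)]])
    also have "\<dots> = inv\<^bsub>\<pi>\<^sub>1\<^esub> a \<otimes>\<^bsub>\<pi>\<^sub>1\<^esub> (loop_class X (?f \<circ> q) \<otimes>\<^bsub>\<pi>\<^sub>1\<^esub> inv\<^bsub>\<pi>\<^sub>1\<^esub> (inv\<^bsub>\<pi>\<^sub>1\<^esub> a))"
      using g l loops_join[OF l(1) loops_reverse[OF g(1)]] loops_reverse[OF g(1)]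
      by (simp flip: fundamental_group_mult fundamental_group_inv[OF star g(1)] add: g(2))
    also have "\<dots> = inv\<^bsub>\<pi>\<^sub>1\<^esub> a \<otimes>\<^bsub>\<pi>\<^sub>1\<^esub> pushforward X star ?f x \<otimes>\<^bsub>\<pi>\<^sub>1\<^esub> a"
      using a pushforward_closed[OF f x] pushforward_loop_class[OF q(1) f'(1,2)] q(2) by (simp add: P.m_assoc)
    finally have "x = inv\<^bsub>\<pi>\<^sub>1\<^esub> a \<otimes>\<^bsub>\<pi>\<^sub>1\<^esub> pushforward X star ?f x \<otimes>\<^bsub>\<pi>\<^sub>1\<^esub> a" .
    then have "x = conj_by \<pi>\<^sub>1 (inv\<^bsub>\<pi>\<^sub>1\<^esub> a) (pushforward X star ?f x)"
      using a pushforward_closed[OF f x] by (simp add: conj_by_def)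
    then show ?thesis
      using P.conj_by_inv(1)[OF a pushforward_closed[OF f x]] by simp
  qed
  then have "mapping_class_action X star ?c = conj_by \<pi>\<^sub>1 a"
    using mapping_class_action_coset[OF f]
    by (intro extensionalityI[OF mapping_class_action_extensional[OF c]]) (auto simp: conj_by_def)
  then show ?thesis using c a unfolding inner_classes_def by blast
qed

text \<open>Evaluating the action at \<open>d\<close> maps the inner classes onto a set that
  contains all conjugates of \<open>d\<close>, as each inner automorphism is realized.\<close>

lemma infinite_inner_classes:
  assumes "d \<in> carrier \<pi>\<^sub>1" "infinite ((\<lambda>a. conj_by \<pi>\<^sub>1 a d) ` carrier \<pi>\<^sub>1)"
  shows "infinite inner_classes"
proof
  assume "finite inner_classes"
  then have "finite ((\<lambda>c. mapping_class_action X star c d) ` inner_classes)" by simp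
  moreover have "(\<lambda>a. conj_by \<pi>\<^sub>1 a d) ` carrier \<pi>\<^sub>1 \<subseteq> (\<lambda>c. mapping_class_action X star c d) ` inner_classes"
    using inner_realized by (force simp: image_iff)
  ultimately show False using assms(2) finite_subset by blast
qed

lemma homological_reps_of_inner_classes:
  assumes inf: "d \<in> carrier \<pi>\<^sub>1" "infinite ((\<lambda>a. conj_by \<pi>\<^sub>1 a d) ` carrier \<pi>\<^sub>1)"
  shows "\<exists>G H. subgroup G \<Gamma> \<and> subgroup H \<Gamma> \<and> H \<subseteq> G \<and> \<not> finite_index H (\<Gamma> \<lparr>carrier := G\<rparr>) \<and>
    (\<forall>K. characteristic_subgroup K \<pi>\<^sub>1 \<and> finite_index K \<pi>\<^sub>1 \<longrightarrow>
       finite_index (homological_rep X star K ` H)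
         (AutoGroup (H1 (cover_group X star K)) \<lparr>carrier := homological_rep X star K ` G\<rparr>))"
proof (intro exI conjI allI impI)
  show "subgroup inner_classes \<Gamma>" by (rule subgroup_inner_classes)
  show "subgroup {\<one>\<^bsub>\<Gamma>\<^esub>} \<Gamma>" by (rule M.triv_subgroup)
  show "{\<one>\<^bsub>\<Gamma>\<^esub>} \<subseteq> inner_classes" using subgroup.one_closed[OF subgroup_inner_classes] by blast
  have sub: "inner_classes \<subseteq> carrier \<Gamma>" by (auto simp: inner_classes_def)
  \<comment> \<open>The cosets of the trivial subgroup are singletons, so its index is the
    cardinality of the group.\<close>
  have "{\<one>\<^bsub>\<Gamma>\<^esub>} #>\<^bsub>\<Gamma>\<lparr>carrier := inner_classes\<rparr>\<^esub> c = {c}" if "c \<in> inner_classes" for c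
    using sub that by (auto simp: r_coset_def)
  then have "rcosets\<^bsub>\<Gamma>\<lparr>carrier := inner_classes\<rparr>\<^esub> {\<one>\<^bsub>\<Gamma>\<^esub>} = (\<lambda>c. {c}) ` inner_classes"
    by (auto simp: RCOSETS_def)
  moreover have "infinite ((\<lambda>c. {c}) ` inner_classes)"
    using infinite_inner_classes[OF inf] by (simp add: finite_image_iff inj_on_def)
  ultimately show "\<not> finite_index {\<one>\<^bsub>\<Gamma>\<^esub>} (\<Gamma>\<lparr>carrier := inner_classes\<rparr>)"
    by (simp add: finite_index_def)
  fix K assume K: "characteristic_subgroup K \<pi>\<^sub>1 \<and> finite_index K \<pi>\<^sub>1"
  \<comment> \<open>An inner class acts on \<open>K\<close> as the restriction of some conjugation,
    so the finiteness of \<open>finite_inner_on_H1\<close> bounds the whole image of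
    \<open>inner_classes\<close>, and with it every index in the image.\<close>
  have "homological_rep X star K ` inner_classes
      \<subseteq> (\<lambda>a. H1_map (\<pi>\<^sub>1\<lparr>carrier := K\<rparr>) (restrict (conj_by \<pi>\<^sub>1 a) K)) ` carrier \<pi>\<^sub>1"
    by (auto simp: homological_rep_def cover_group_def inner_classes_def)
  then have "finite (homological_rep X star K ` inner_classes)"
    using finite_inner_on_H1[OF P.is_group] K finite_subset by blast
  then show "finite_index (homological_rep X star K ` {\<one>\<^bsub>\<Gamma>\<^esub>})
      (AutoGroup (H1 (cover_group X star K)) \<lparr>carrier := homological_rep X star K ` inner_classes\<rparr>)"
    by (intro finite_index_of_finite) simp
qed

end

end

theorem theorem1p3:
  fixes X :: "'a::t2_space set" and A :: "'a chart set" and star :: 'a and g :: nat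
  assumes "closed_oriented_surface X A"
    and "has_genus X g" and "g \<ge> 2"
    and "star \<in> X"
  shows "\<exists>G H.
    subgroup G (mapping_class_group X A star) \<and>
    subgroup H (mapping_class_group X A star) \<and>
    H \<subseteq> G \<and>
    \<not> finite_index H (mapping_class_group X A star \<lparr>carrier := G\<rparr>) \<and>
    (\<forall>K. characteristic_subgroup K (fundamental_group X star) \<and>
         finite_index K (fundamental_group X star) \<longrightarrow>
       finite_index (homological_rep X star K ` H)
         (AutoGroup (H1 (cover_group X star K)) \<lparr>carrier := homological_rep X star K ` G\<rparr>))"
proof -
  interpret smooth_surface X A
    by unfold_locales (use assms(1) in \<open>simp add: closed_oriented_surface_def\<close>)
  obtain d where "d \<in> carrier (fundamental_group X star)"
    "infinite ((\<lambda>a. conj_by (fundamental_group X star) a d) ` carrier (fundamental_group X star))"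
    using infinite_conjugacy_class[OF assms(3,2,4)] by blast
  then show ?thesis
    by (rule homological_reps_of_inner_classes[OF assms(4)])
qed

end
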